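(* Let $n$ be a non-negative integer. The local-global principle for the in dimension $<n$ of local cohomology modules holds at level $1$ over any commutative Noetherian ring; that is, for every commutative Noetherian ring $R$, all ideals $\mathfrak b\subseteq\mathfrak a$ of $R$ and every finitely generated $R$-module $M$, $$h_{\mathfrak{a}R_{\mathfrak p}}^{\mathfrak{b}R_{\mathfrak p}}(M_{\mathfrak p})^{n}>1 \ \text{ for all } \mathfrak{p}\in\operatorname{Spec}(R)\iff h_{\mathfrak a}^{\mathfrak b}(M)^{n}>1 .$$
   Context: Rings have non-zero identity; $H^i_{\mathfrak a}(M)$ denotes local cohomology. For a non-negative integer $n$, an $R$-module $L$ is in dimension $<n$ if there is a finitely generated submodule $N$ of $L$ with $\dim\operatorname{Supp}(L/N)<n$ (the empty set has negative dimension). For ideals $\mathfrak a,\mathfrak b$ of $R$ and an $R$-module $M$, $$h_{\mathfrak a}^{\mathfrak b}(M)^{n}:=\inf\{i\in\mathbb{N}_0 : \mathfrak b^tH^i_{\mathfrak a}(M)\text{ is not in dimension }<n\text{ for all }t\in\mathbb{N}\},$$ with $\inf\emptyset=\infty$; $h_{\mathfrak{a}R_{\mathfrak p}}^{\mathfrak{b}R_{\mathfrak p}}(M_{\mathfrak p})^{n}$ is computed over $R_{\mathfrak p}$. *)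

theory Defs
  imports "HOL-Algebra.Module" "HOL-Algebra.Ideal_Product" "HOL-Algebra.Ring_Divisibility" "HOL-Library.Extended_Real"
begin

section \<open>Modules\<close>

text \<open>
  Modules are the records of \<^theory>\<open>HOL-Algebra.Module\<close>. Their inherited ring fields
  \<open>mult\<close> and \<open>one\<close> play no role for \<^const>\<open>module\<close>, so they are left undefined below.
\<close>

definition mod_hom ::
  "('r, 'k) ring_scheme \<Rightarrow> ('r, 'm) module \<Rightarrow> ('r, 'n) module \<Rightarrow> ('m \<Rightarrow> 'n) set" where
  "mod_hom R M N = {f. f \<in> carrier M \<rightarrow> carrier N \<and>
     (\<forall>x\<in>carrier M. \<forall>y\<in>carrier M. f (x \<oplus>\<^bsub>M\<^esub> y) = f x \<oplus>\<^bsub>N\<^esub> f y) \<and>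
     (\<forall>r\<in>carrier R. \<forall>x\<in>carrier M. f (r \<odot>\<^bsub>M\<^esub> x) = r \<odot>\<^bsub>N\<^esub> f x)}"

definition gen_submodule :: "('r, 'k) ring_scheme \<Rightarrow> ('r, 'm) module \<Rightarrow> 'm set \<Rightarrow> 'm set" where
  "gen_submodule R M X = \<Inter>{N. submodule N R M \<and> X \<subseteq> N}"

definition fg_submodule :: "('r, 'k) ring_scheme \<Rightarrow> ('r, 'm) module \<Rightarrow> 'm set \<Rightarrow> bool" where
  "fg_submodule R M N \<longleftrightarrow> (\<exists>X. finite X \<and> X \<subseteq> carrier M \<and> N = gen_submodule R M X)"

definition fg_module :: "('r, 'k) ring_scheme \<Rightarrow> ('r, 'm) module \<Rightarrow> bool" where
  "fg_module R M \<longleftrightarrow> module R M \<and> fg_submodule R M (carrier M)"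

definition quot_module :: "('r, 'm) module \<Rightarrow> 'm set \<Rightarrow> ('r, 'm set) module" where
  "quot_module M N =
    \<lparr>carrier = a_rcosets\<^bsub>M\<^esub> N, monoid.mult = undefined, one = undefined, zero = N, add = set_add M,
     smult = (\<lambda>r X. \<Union>x\<in>X. N +>\<^bsub>M\<^esub> (r \<odot>\<^bsub>M\<^esub> x))\<rparr>"

definition ideal_power :: "('r, 'k) ring_scheme \<Rightarrow> 'r set \<Rightarrow> nat \<Rightarrow> 'r set" where
  "ideal_power R I t = I [^]\<^bsub>ideals_set R\<^esub> t"

definition ideal_smult ::
  "('r, 'k) ring_scheme \<Rightarrow> 'r set \<Rightarrow> ('r, 'm) module \<Rightarrow> ('r, 'm) module" where
  "ideal_smult R I M =
    M\<lparr>carrier := gen_submodule R M {r \<odot>\<^bsub>M\<^esub> x |r x. r \<in> I \<and> x \<in> carrier M}\<rparr>"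


section \<open>Localization\<close>

text \<open>
  The fraction \<open>x/s\<close> is the set of all pairs \<open>(y, t)\<close> with \<open>u t x = u s y\<close> for some
  \<open>u\<close> in the multiplicative set \<open>S\<close>. Operations on fractions take the union over all
  representatives; since they are well defined, this union is a single fraction.
\<close>

definition fract :: "'r set \<Rightarrow> ('r, 'm) module \<Rightarrow> 'm \<Rightarrow> 'r \<Rightarrow> ('m \<times> 'r) set" where
  "fract S M x s = {(y, t). y \<in> carrier M \<and> t \<in> S \<and>
     (\<exists>u\<in>S. u \<odot>\<^bsub>M\<^esub> (t \<odot>\<^bsub>M\<^esub> x) = u \<odot>\<^bsub>M\<^esub> (s \<odot>\<^bsub>M\<^esub> y))}"

definition frac_add ::
  "('r, 'k) ring_scheme \<Rightarrow> 'r set \<Rightarrow> ('r, 'm) module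
     \<Rightarrow> ('m \<times> 'r) set \<Rightarrow> ('m \<times> 'r) set \<Rightarrow> ('m \<times> 'r) set" where
  "frac_add R S M X Y =
    (\<Union>(x, s)\<in>X. \<Union>(y, t)\<in>Y. fract S M ((t \<odot>\<^bsub>M\<^esub> x) \<oplus>\<^bsub>M\<^esub> (s \<odot>\<^bsub>M\<^esub> y)) (s \<otimes>\<^bsub>R\<^esub> t))"

definition frac_smult ::
  "('r, 'k) ring_scheme \<Rightarrow> 'r set \<Rightarrow> ('r, 'm) module
     \<Rightarrow> ('r \<times> 'r) set \<Rightarrow> ('m \<times> 'r) set \<Rightarrow> ('m \<times> 'r) set" where
  "frac_smult R S M X Y = (\<Union>(r, s)\<in>X. \<Union>(x, t)\<in>Y. fract S M (r \<odot>\<^bsub>M\<^esub> x) (s \<otimes>\<^bsub>R\<^esub> t))"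

definition self_module :: "('r, 'k) ring_scheme \<Rightarrow> ('r, 'r) module" where
  "self_module R = \<lparr>carrier = carrier R, monoid.mult = monoid.mult R, one = one R, zero = zero R, add = add R,
     smult = monoid.mult R\<rparr>"

definition loc_ring :: "('r, 'k) ring_scheme \<Rightarrow> 'r set \<Rightarrow> ('r \<times> 'r) set ring" where
  "loc_ring R S =
    \<lparr>carrier = {fract S (self_module R) r s |r s. r \<in> carrier R \<and> s \<in> S},
     monoid.mult = frac_smult R S (self_module R),
     one = fract S (self_module R) \<one>\<^bsub>R\<^esub> \<one>\<^bsub>R\<^esub>,
     zero = fract S (self_module R) \<zero>\<^bsub>R\<^esub> \<one>\<^bsub>R\<^esub>,
     add = frac_add R S (self_module R)\<rparr>"

definition loc_module ::
  "('r, 'k) ring_scheme \<Rightarrow> 'r set \<Rightarrow> ('r, 'm) module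
     \<Rightarrow> (('r \<times> 'r) set, ('m \<times> 'r) set) module" where
  "loc_module R S M =
    \<lparr>carrier = {fract S M x s |x s. x \<in> carrier M \<and> s \<in> S},
     monoid.mult = undefined, one = undefined,
     zero = fract S M \<zero>\<^bsub>M\<^esub> \<one>\<^bsub>R\<^esub>,
     add = frac_add R S M,
     smult = frac_smult R S M\<rparr>"

definition ring_at :: "('r, 'k) ring_scheme \<Rightarrow> 'r set \<Rightarrow> ('r \<times> 'r) set ring" where
  "ring_at R p = loc_ring R (carrier R - p)"

definition module_at ::
  "('r, 'k) ring_scheme \<Rightarrow> 'r set \<Rightarrow> ('r, 'm) module
     \<Rightarrow> (('r \<times> 'r) set, ('m \<times> 'r) set) module" where
  "module_at R p M = loc_module R (carrier R - p) M"

definition ideal_at :: "('r, 'k) ring_scheme \<Rightarrow> 'r set \<Rightarrow> 'r set \<Rightarrow> ('r \<times> 'r) set set" where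
  "ideal_at R p I =
    Idl\<^bsub>ring_at R p\<^esub> ((\<lambda>r. fract (carrier R - p) (self_module R) r \<one>\<^bsub>R\<^esub>) ` I)"


section \<open>Support, dimension, and modules in dimension \<open>< n\<close>\<close>

definition Spec :: "('r, 'k) ring_scheme \<Rightarrow> 'r set set" where
  "Spec R = {p. primeideal p R}"

definition Supp :: "('r, 'k) ring_scheme \<Rightarrow> ('r, 'm) module \<Rightarrow> 'r set set" where
  "Supp R M = {p \<in> Spec R. carrier (module_at R p M) \<noteq> {\<zero>\<^bsub>module_at R p M\<^esub>}}"

text \<open>
  The dimension of a set of primes is the supremum of the lengths of the chains of primes in it.
  A support is closed under specialization, so its dimension is the supremum of
  \<open>dim (R/p)\<close> over its elements \<open>p\<close>. The dimension of the empty set is \<open>-\<infinity>\<close>.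
\<close>

definition dim_primes :: "'r set set \<Rightarrow> ereal" where
  "dim_primes V =
    (SUP k\<in>{k. \<exists>c :: nat \<Rightarrow> 'r set. (\<forall>i\<le>k. c i \<in> V) \<and> (\<forall>i<k. c i \<subset> c (Suc i))}. ereal (real k))"

definition in_dim_less :: "('r, 'k) ring_scheme \<Rightarrow> ('r, 'm) module \<Rightarrow> nat \<Rightarrow> bool" where
  "in_dim_less R L n \<longleftrightarrow>
    (\<exists>N. fg_submodule R L N \<and> dim_primes (Supp R (quot_module L N)) < ereal (real n))"


section \<open>Local cohomology\<close>

text \<open>
  Injectivity is tested against the modules whose carrier lives in the same type as that of \<open>E\<close>.
  By Baer's criterion this is injectivity in the usual sense as soon as that type is at least
  as large as the type of ring elements.
\<close>

definition injective_module :: "('r, 'k) ring_scheme \<Rightarrow> ('r, 'e) module \<Rightarrow> bool" where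
  "injective_module R E \<longleftrightarrow> module R E \<and>
    (\<forall>(B :: ('r, 'e) module) A. module R B \<longrightarrow> submodule A R B \<longrightarrow>
       (\<forall>f\<in>mod_hom R (B\<lparr>carrier := A\<rparr>) E. \<exists>g\<in>mod_hom R B E. \<forall>x\<in>A. g x = f x))"

definition injective_resolution ::
  "('r, 'k) ring_scheme \<Rightarrow> ('r, 'm) module \<Rightarrow> ('m \<Rightarrow> 'e)
     \<Rightarrow> (nat \<Rightarrow> ('r, 'e) module) \<Rightarrow> (nat \<Rightarrow> 'e \<Rightarrow> 'e) \<Rightarrow> bool" where
  "injective_resolution R M \<epsilon> E d \<longleftrightarrow>
    (\<forall>i. injective_module R (E i)) \<and>
    \<epsilon> \<in> mod_hom R M (E 0) \<and> inj_on \<epsilon> (carrier M) \<and>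
    (\<forall>i. d i \<in> mod_hom R (E i) (E (Suc i))) \<and>
    \<epsilon> ` carrier M = a_kernel (E 0) (E 1) (d 0) \<and>
    (\<forall>i. d i ` carrier (E i) = a_kernel (E (Suc i)) (E (Suc (Suc i))) (d (Suc i)))"

text \<open>
  A type in which every module over a ring on \<open>'r\<close> with carrier in \<open>'m\<close> has an injective
  resolution. Its cardinality \<open>\<kappa> = (|'m| \<aleph>\<^sub>0) ^ (|'r| \<aleph>\<^sub>0)\<close> is at least \<open>|'r|\<close>, \<open>|'m|\<close> and \<open>\<aleph>\<^sub>0\<close>
  and satisfies \<open>\<kappa> ^ |'r| = \<kappa>\<close>. Every module \<open>M\<close> with at most \<open>\<kappa>\<close> elements lies in a divisible
  abelian group \<open>D\<close> (a quotient of the rational vector space on \<open>M\<close>) with at most \<open>\<kappa>\<close> elements,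
  hence in the injective module of additive maps from \<open>R\<close> to \<open>D\<close>, which again has at most
  \<open>\<kappa>\<close> elements.
\<close>

type_synonym ('r, 'm) univ = "'r \<times> nat \<Rightarrow> 'm \<times> nat"

definition inj_res ::
  "('r, 'k) ring_scheme \<Rightarrow> ('r, 'm) module
     \<Rightarrow> (nat \<Rightarrow> ('r, ('r, 'm) univ) module) \<times> (nat \<Rightarrow> ('r, 'm) univ \<Rightarrow> ('r, 'm) univ)" where
  "inj_res R M = (SOME (E, d). \<exists>\<epsilon>. injective_resolution R M \<epsilon> E d)"

definition torsion :: "('r, 'k) ring_scheme \<Rightarrow> 'r set \<Rightarrow> ('r, 'm) module \<Rightarrow> 'm set" where
  "torsion R I M = {x \<in> carrier M. \<exists>t. \<forall>r\<in>ideal_power R I t. r \<odot>\<^bsub>M\<^esub> x = \<zero>\<^bsub>M\<^esub>}"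

text \<open>
  The \<open>i\<close>-th cohomology of the complex obtained by applying the \<open>I\<close>-torsion functor to \<open>E, d\<close>.
\<close>

definition torsion_cohomology ::
  "('r, 'k) ring_scheme \<Rightarrow> 'r set \<Rightarrow> (nat \<Rightarrow> ('r, 'e) module) \<Rightarrow> (nat \<Rightarrow> 'e \<Rightarrow> 'e)
     \<Rightarrow> nat \<Rightarrow> ('r, 'e set) module" where
  "torsion_cohomology R I E d i =
    quot_module
      ((E i)\<lparr>carrier := torsion R I (E i) \<inter> a_kernel (E i) (E (Suc i)) (d i)\<rparr>)
      (case i of 0 \<Rightarrow> {\<zero>\<^bsub>E 0\<^esub>} | Suc j \<Rightarrow> d j ` torsion R I (E j))"

definition local_cohomology ::
  "('r, 'k) ring_scheme \<Rightarrow> 'r set \<Rightarrow> nat \<Rightarrow> ('r, 'm) module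
     \<Rightarrow> ('r, ('r, 'm) univ set) module" where
  "local_cohomology R I i M = (case inj_res R M of (E, d) \<Rightarrow> torsion_cohomology R I E d i)"

definition h_dim ::
  "('r, 'k) ring_scheme \<Rightarrow> 'r set \<Rightarrow> 'r set \<Rightarrow> ('r, 'm) module \<Rightarrow> nat \<Rightarrow> enat" where
  "h_dim R I J M n =
    Inf (enat ` {i. \<forall>t\<ge>1. \<not> in_dim_less R
      (ideal_smult R (ideal_power R J t) (local_cohomology R I i M)) n})"

end

theory Submission
  imports Defs
begin

text \<open>
  The module \<open>H\<^sup>0(M)\<close> is finitely generated, so only \<open>H = H\<^sup>1(M)\<close> matters. By injectivity of the first
  term of a resolution, \<open>H\<close> is the direct limit of \<open>Hom(\<aa>\<^sup>k, M)\<close> modulo the multiplications by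
  elements of \<open>M\<close>, a description that localizes. As \<open>H\<close> is \<open>\<aa>\<close>-torsion and \<open>\<bb> \<subseteq> \<aa>\<close>, every finitely
  generated submodule is killed by a power of \<open>\<bb>\<close>; hence some \<open>\<bb>\<^sup>t H\<close> is in dimension \<open>< n\<close> iff some
  \<open>\<bb>\<^sup>t\<close> kills \<open>H\<^sub>q\<close> for all primes \<open>q\<close> from which a chain of primes of length \<open>n\<close> ascends. The local
  hypothesis at the top of such a chain provides a \<open>t\<close> for each \<open>q\<close>. A uniform \<open>t\<close> is found by looking
  only at the associated primes of \<open>H\<close>, and these are finitely many because the socle \<open>0 :\<^sub>H \<aa>\<close> embeds
  into a quotient of a finite power of \<open>M\<close>.
\<close>


section \<open>Modules and submodules\<close>

text \<open>The obstacle is the choice hidden in \<open>inj_res\<close>: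
  \<open>local_cohomology\<close> refers to an unspecified injective resolution, and the resolutions
  over \<open>R\<close> and over its localizations are unrelated and live in different types. So a
  resolution must first be shown to exist in the prescribed type, since otherwise nothing could be
  said about the chosen one. After that, \<open>H\<^sup>1\<close> over \<open>R\<close> and over a
  localization are never compared as modules: only the predicate \<open>killed_at\<close>, which
  mentions nothing but powers of ideals and \<open>M\<close>, passes between the rings.

  Looking only at associated primes loses nothing for two reasons. An element that survives at
  \<open>q\<close> has a multiple whose annihilator is a prime \<open>p \<subseteq> q\<close>, and a
  chain of length \<open>n\<close> above \<open>q\<close> becomes one above \<open>p\<close> by
  replacing its first member. Moreover such a \<open>p\<close> contains a power of
  \<open>\<aa>\<close>, because the element is torsion, hence contains \<open>\<aa>\<close>; this is
  why the socle sees every associated prime.\<close>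

definition noeth_module :: "('r, 'k) ring_scheme \<Rightarrow> ('r, 'm) module \<Rightarrow> bool" where
  "noeth_module R M \<longleftrightarrow> module R M \<and> (\<forall>N. submodule N R M \<longrightarrow> fg_submodule R M N)"

lemma (in cring) idealI':
  assumes "I \<subseteq> carrier R" "\<zero> \<in> I" "\<And>x y. x \<in> I \<Longrightarrow> y \<in> I \<Longrightarrow> x \<oplus> y \<in> I"
    "\<And>r x. r \<in> carrier R \<Longrightarrow> x \<in> I \<Longrightarrow> r \<otimes> x \<in> I"
  shows "ideal I R"
proof (rule idealI)
  show "ring R" by (rule ring_axioms)
  have inv: "\<ominus> x \<in> I" if "x \<in> I" for x
    using assms(4)[of "\<ominus> \<one>" x] assms(1) that l_minus[of \<one> x] by auto
  show "subgroup I (add_monoid R)"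
    using assms inv by (intro subgroup.intro) (auto simp: a_inv_def)
  fix a x assume "a \<in> I" "x \<in> carrier R"
  then show "x \<otimes> a \<in> I" "a \<otimes> x \<in> I" using assms(1,4) m_comm[of a x] by auto
qed

lemma (in ideal) ideal_closed:
  shows "I \<subseteq> carrier R" "\<zero> \<in> I" "x \<in> I \<Longrightarrow> y \<in> I \<Longrightarrow> x \<oplus> y \<in> I"
    "r \<in> carrier R \<Longrightarrow> x \<in> I \<Longrightarrow> r \<otimes> x \<in> I" "r \<in> carrier R \<Longrightarrow> x \<in> I \<Longrightarrow> x \<otimes> r \<in> I"
  using a_subset I_l_closed I_r_closed by auto

lemma (in cring) self_module: "module R (self_module R)"
proof (rule moduleI)
  show "abelian_group (self_module R)"
    by (rule abelian_groupI) (auto simp: self_module_def a_ac intro: l_neg)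
qed (auto simp: self_module_def l_distr r_distr m_assoc is_cring)

lemma self_module_simps [simp]:
  "carrier (self_module R) = carrier R" "zero (self_module R) = zero R"
  "add (self_module R) = add R" "smult (self_module R) = monoid.mult R"
  by (simp_all add: self_module_def)

lemma (in cring) submodule_self: "submodule I R (self_module R) \<longleftrightarrow> ideal I R"
proof
  interpret S: module R "self_module R" by (rule self_module)
  show "ideal I R" if "submodule I R (self_module R)"
    using S.submoduleE[OF that] submodule.axioms(1)[OF that]
    by (intro idealI') (auto simp: subgroup.one_closed[of I "add_monoid (self_module R)", simplified])
  show "submodule I R (self_module R)" if "ideal I R"
  proof (rule S.submoduleI)
    interpret I: ideal I R by fact
    fix a assume "a \<in> I"
    then have "(\<ominus> \<one>) \<otimes> a \<in> I" by (simp add: I.ideal_closed)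
    moreover have "(\<ominus> \<one>) \<otimes> a = \<ominus>\<^bsub>self_module R\<^esub> a"
      using S.smult_l_minus[of \<one> a] \<open>a \<in> I\<close> I.Icarr by simp
    ultimately show "\<ominus>\<^bsub>self_module R\<^esub> a \<in> I" by simp
  qed (use ideal.ideal_closed[OF that] in auto)
qed

text \<open>The constants for modules are only available on plain module records, without extension fields.\<close>

locale rmodule = module R M for R :: "('r, 'k) ring_scheme" (structure) and M :: "('r, 'm) module" (structure)
begin

lemma smult_neg_one: "x \<in> carrier M \<Longrightarrow> (\<ominus> \<one>) \<odot>\<^bsub>M\<^esub> x = \<ominus>\<^bsub>M\<^esub> x"
  by (simp add: smult_l_minus)

lemma smult_comm: "r \<in> carrier R \<Longrightarrow> s \<in> carrier R \<Longrightarrow> x \<in> carrier M \<Longrightarrow>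
   r \<odot>\<^bsub>M\<^esub> (s \<odot>\<^bsub>M\<^esub> x) = s \<odot>\<^bsub>M\<^esub> (r \<odot>\<^bsub>M\<^esub> x)"
  by (metis R.m_comm smult_assoc1)

lemma smult_minus: "r \<in> carrier R \<Longrightarrow> x \<in> carrier M \<Longrightarrow> y \<in> carrier M \<Longrightarrow>
   r \<odot>\<^bsub>M\<^esub> (x \<ominus>\<^bsub>M\<^esub> y) = r \<odot>\<^bsub>M\<^esub> x \<ominus>\<^bsub>M\<^esub> r \<odot>\<^bsub>M\<^esub> y"
  by (simp add: M.minus_eq smult_r_distr smult_r_minus)

lemma minus_eq_zero: "x \<in> carrier M \<Longrightarrow> y \<in> carrier M \<Longrightarrow> x \<ominus>\<^bsub>M\<^esub> y = \<zero>\<^bsub>M\<^esub> \<longleftrightarrow> x = y"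
  by (metis M.add.inv_closed M.add.inv_equality M.minus_eq M.minus_minus M.r_neg)

lemma diff_add: "x \<in> carrier M \<Longrightarrow> y \<in> carrier M \<Longrightarrow> (x \<ominus>\<^bsub>M\<^esub> y) \<oplus>\<^bsub>M\<^esub> y = x"
  by (simp add: M.minus_eq M.a_assoc M.l_neg)

lemma submoduleI':
  assumes "H \<subseteq> carrier M" "\<zero>\<^bsub>M\<^esub> \<in> H" "\<And>a b. \<lbrakk>a \<in> H; b \<in> H\<rbrakk> \<Longrightarrow> a \<oplus>\<^bsub>M\<^esub> b \<in> H"
    "\<And>a x. \<lbrakk>a \<in> carrier R; x \<in> H\<rbrakk> \<Longrightarrow> a \<odot>\<^bsub>M\<^esub> x \<in> H"
  shows "submodule H R M"
proof (rule submoduleI)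
  show "\<ominus>\<^bsub>M\<^esub> a \<in> H" if "a \<in> H" for a
    using assms(4)[of "\<ominus> \<one>" a] smult_neg_one[of a] that assms(1) by auto
qed (use assms in auto)

lemma submodule_closed:
  assumes "submodule N R M"
  shows "N \<subseteq> carrier M" "\<zero>\<^bsub>M\<^esub> \<in> N" "x \<in> N \<Longrightarrow> y \<in> N \<Longrightarrow> x \<oplus>\<^bsub>M\<^esub> y \<in> N"
    "x \<in> N \<Longrightarrow> \<ominus>\<^bsub>M\<^esub> x \<in> N" "x \<in> N \<Longrightarrow> y \<in> N \<Longrightarrow> x \<ominus>\<^bsub>M\<^esub> y \<in> N"
    "r \<in> carrier R \<Longrightarrow> x \<in> N \<Longrightarrow> r \<odot>\<^bsub>M\<^esub> x \<in> N"
  using submoduleE[OF assms] subgroup.one_closed[OF submodule.axioms(1)[OF assms]]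
  by (auto simp: M.minus_eq)

lemma submodule_subgroup: "submodule N R M \<Longrightarrow> subgroup N (add_monoid M)"
  by (rule submodule.axioms(1))

lemma submodule_restrict:
  assumes "submodule N R M"
  shows "submodule A R (M\<lparr>carrier := N\<rparr>) \<longleftrightarrow> submodule A R M \<and> A \<subseteq> N"
proof -
  interpret N: rmodule R "M\<lparr>carrier := N\<rparr>" by (intro rmodule.intro submodule.submodule_is_module[OF assms module_axioms])
  show ?thesis
  proof
    assume "submodule A R (M\<lparr>carrier := N\<rparr>)"
    from N.submodule_closed[OF this] show "submodule A R M \<and> A \<subseteq> N"
      using submodule_closed[OF assms] by (auto intro!: submoduleI')
  next
    assume "submodule A R M \<and> A \<subseteq> N"
    then show "submodule A R (M\<lparr>carrier := N\<rparr>)"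
      using submodule_closed[of A] by (intro N.submoduleI') auto
  qed
qed

section \<open>Generated and finitely generated submodules\<close>

lemma gen_submodule_subset: "X \<subseteq> gen_submodule R M X"
  by (auto simp: gen_submodule_def)

lemma gen_submodule_minimal: "submodule N R M \<Longrightarrow> X \<subseteq> N \<Longrightarrow> gen_submodule R M X \<subseteq> N"
  by (auto simp: gen_submodule_def)

lemma gen_submodule:
  assumes "X \<subseteq> carrier M"
  shows "submodule (gen_submodule R M X) R M"
proof (rule submoduleI')
  show "gen_submodule R M X \<subseteq> carrier M"
    using assms carrier_is_submodule gen_submodule_minimal by blast
qed (use submodule_closed in \<open>auto simp: gen_submodule_def\<close>)

lemma gen_submodule_mono: "X \<subseteq> Y \<Longrightarrow> gen_submodule R M X \<subseteq> gen_submodule R M Y"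
  by (auto simp: gen_submodule_def)

lemma gen_submodule_restrict:
  assumes "submodule N R M" "X \<subseteq> N"
  shows "gen_submodule R (M\<lparr>carrier := N\<rparr>) X = gen_submodule R M X"
proof -
  have "{A. submodule A R (M\<lparr>carrier := N\<rparr>) \<and> X \<subseteq> A} = {A. submodule A R M \<and> A \<subseteq> N \<and> X \<subseteq> A}"
    using submodule_restrict[OF assms(1)] by auto
  moreover have "\<Inter>{A. submodule A R M \<and> A \<subseteq> N \<and> X \<subseteq> A} = gen_submodule R M X"
  proof
    have g: "gen_submodule R M X \<in> {A. submodule A R M \<and> A \<subseteq> N \<and> X \<subseteq> A}"
      using assms submodule_closed(1)[OF assms(1)] gen_submodule[of X] gen_submodule_minimal[OF assms]
        gen_submodule_subset[of X] by blast
    show "\<Inter>{A. submodule A R M \<and> A \<subseteq> N \<and> X \<subseteq> A} \<subseteq> gen_submodule R M X" using g by blast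
  qed (auto simp: gen_submodule_def)
  ultimately show ?thesis by (simp add: gen_submodule_def)
qed

lemma fg_submodule_restrict:
  assumes "submodule N R M"
  shows "fg_submodule R (M\<lparr>carrier := N\<rparr>) A \<longleftrightarrow> fg_submodule R M A \<and> A \<subseteq> N"
proof
  assume "fg_submodule R (M\<lparr>carrier := N\<rparr>) A"
  then obtain X where X: "finite X" "X \<subseteq> N" "A = gen_submodule R M X"
    by (auto simp: fg_submodule_def gen_submodule_restrict[OF assms])
  then show "fg_submodule R M A \<and> A \<subseteq> N"
    using submodule_closed(1)[OF assms] gen_submodule_minimal[OF assms X(2)]
    by (auto simp: fg_submodule_def)
next
  assume *: "fg_submodule R M A \<and> A \<subseteq> N"
  then obtain X where X: "finite X" "X \<subseteq> carrier M" "A = gen_submodule R M X"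
    by (auto simp: fg_submodule_def)
  then have "X \<subseteq> N" using * gen_submodule_subset by blast
  then show "fg_submodule R (M\<lparr>carrier := N\<rparr>) A"
    using X by (auto simp: fg_submodule_def gen_submodule_restrict[OF assms])
qed

lemma fg_zero: "fg_submodule R M {\<zero>\<^bsub>M\<^esub>}"
proof -
  have "submodule {\<zero>\<^bsub>M\<^esub>} R M" by (rule submoduleI') auto
  then have "gen_submodule R M {} \<subseteq> {\<zero>\<^bsub>M\<^esub>}" by (rule gen_submodule_minimal) auto
  moreover have "\<zero>\<^bsub>M\<^esub> \<in> gen_submodule R M {}"
    using submodule_closed(2)[OF gen_submodule] by blast
  ultimately have "{\<zero>\<^bsub>M\<^esub>} = gen_submodule R M {}" by auto
  then show ?thesis unfolding fg_submodule_def by (metis empty_subsetI finite.emptyI)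
qed

lemma gen_submodule_insert:
  assumes X: "X \<subseteq> carrier M" and x: "x \<in> carrier M" and z: "z \<in> gen_submodule R M (insert x X)"
  shows "\<exists>r\<in>carrier R. \<exists>y\<in>gen_submodule R M X. z = r \<odot>\<^bsub>M\<^esub> x \<oplus>\<^bsub>M\<^esub> y"
proof -
  note G = submodule_closed[OF gen_submodule[OF X]]
  let ?N = "{r \<odot>\<^bsub>M\<^esub> x \<oplus>\<^bsub>M\<^esub> y | r y. r \<in> carrier R \<and> y \<in> gen_submodule R M X}"
  have "submodule ?N R M"
  proof (rule submoduleI')
    show "?N \<subseteq> carrier M" using x G by auto
    have "\<zero>\<^bsub>M\<^esub> = \<zero> \<odot>\<^bsub>M\<^esub> x \<oplus>\<^bsub>M\<^esub> \<zero>\<^bsub>M\<^esub>" using x by simp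
    then show "\<zero>\<^bsub>M\<^esub> \<in> ?N" using G(2) by blast
    fix a b assume "a \<in> ?N" "b \<in> ?N"
    then obtain r y s w where *: "a = r \<odot>\<^bsub>M\<^esub> x \<oplus>\<^bsub>M\<^esub> y" "b = s \<odot>\<^bsub>M\<^esub> x \<oplus>\<^bsub>M\<^esub> w" "r \<in> carrier R" "s \<in> carrier R"
      "y \<in> gen_submodule R M X" "w \<in> gen_submodule R M X" by auto
    then have "y \<in> carrier M" "w \<in> carrier M" using G by auto
    then have "a \<oplus>\<^bsub>M\<^esub> b = (r \<oplus> s) \<odot>\<^bsub>M\<^esub> x \<oplus>\<^bsub>M\<^esub> (y \<oplus>\<^bsub>M\<^esub> w)"
      using * x by (simp add: smult_l_distr M.a_ac)
    then show "a \<oplus>\<^bsub>M\<^esub> b \<in> ?N" using * G(3) R.add.m_closed by blast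
  next
    fix c a assume c: "c \<in> carrier R" and "a \<in> ?N"
    then obtain r y where *: "a = r \<odot>\<^bsub>M\<^esub> x \<oplus>\<^bsub>M\<^esub> y" "r \<in> carrier R" "y \<in> gen_submodule R M X" by auto
    then have "y \<in> carrier M" using G by auto
    then have "c \<odot>\<^bsub>M\<^esub> a = (c \<otimes> r) \<odot>\<^bsub>M\<^esub> x \<oplus>\<^bsub>M\<^esub> c \<odot>\<^bsub>M\<^esub> y"
      using * x c by (simp add: smult_r_distr smult_assoc1)
    then show "c \<odot>\<^bsub>M\<^esub> a \<in> ?N" using * G(6) c R.m_closed by blast
  qed
  moreover have "insert x X \<subseteq> ?N"
  proof -
    have "x = \<one> \<odot>\<^bsub>M\<^esub> x \<oplus>\<^bsub>M\<^esub> \<zero>\<^bsub>M\<^esub>" using x by simp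
    then have "x \<in> ?N" using G(2) by blast
    moreover have "y \<in> ?N" if "y \<in> X" for y
    proof -
      have "y = \<zero> \<odot>\<^bsub>M\<^esub> x \<oplus>\<^bsub>M\<^esub> y" "y \<in> gen_submodule R M X"
        using x X that gen_submodule_subset[of X] by auto
      then show ?thesis by blast
    qed
    ultimately show ?thesis by auto
  qed
  ultimately have "z \<in> ?N" using gen_submodule_minimal[of ?N "insert x X"] z by blast
  then show ?thesis by blast
qed

text \<open>This is the colon ideal \<open>(N + G) : x\<close>. With \<open>G\<close> spanned by all
  generators but one, it collects the coefficients at the remaining generator \<open>x\<close>;
  through it the Noetherian property of the ring enters.\<close>

lemma coefficient_ideal:
  assumes N: "submodule N R M" and G: "submodule G R M" and x: "x \<in> carrier M"
  shows "ideal {r \<in> carrier R. \<exists>y\<in>G. r \<odot>\<^bsub>M\<^esub> x \<oplus>\<^bsub>M\<^esub> y \<in> N} R" (is "ideal ?I R")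
proof (rule R.idealI')
  note N = submodule_closed[OF N] and G = submodule_closed[OF G]
  have "\<zero> \<odot>\<^bsub>M\<^esub> x \<oplus>\<^bsub>M\<^esub> \<zero>\<^bsub>M\<^esub> \<in> N" using x N(2) by simp
  then show "\<zero> \<in> ?I" using G(2) by blast
  fix r s assume "r \<in> ?I" "s \<in> ?I"
  then obtain y w where *: "y \<in> G" "w \<in> G" "r \<in> carrier R" "s \<in> carrier R"
    "r \<odot>\<^bsub>M\<^esub> x \<oplus>\<^bsub>M\<^esub> y \<in> N" "s \<odot>\<^bsub>M\<^esub> x \<oplus>\<^bsub>M\<^esub> w \<in> N" by auto
  have "(r \<oplus> s) \<odot>\<^bsub>M\<^esub> x \<oplus>\<^bsub>M\<^esub> (y \<oplus>\<^bsub>M\<^esub> w) = (r \<odot>\<^bsub>M\<^esub> x \<oplus>\<^bsub>M\<^esub> y) \<oplus>\<^bsub>M\<^esub> (s \<odot>\<^bsub>M\<^esub> x \<oplus>\<^bsub>M\<^esub> w)"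
    using * x G(1) by (simp add: subset_iff smult_l_distr M.a_ac)
  then have "(r \<oplus> s) \<odot>\<^bsub>M\<^esub> x \<oplus>\<^bsub>M\<^esub> (y \<oplus>\<^bsub>M\<^esub> w) \<in> N" using N(3)[OF *(5,6)] by simp
  then show "r \<oplus> s \<in> ?I" using * G(3)[OF *(1,2)] by auto
next
  note N = submodule_closed[OF N] and G = submodule_closed[OF G]
  fix c r assume c: "c \<in> carrier R" and "r \<in> ?I"
  then obtain y where *: "y \<in> G" "r \<in> carrier R" "r \<odot>\<^bsub>M\<^esub> x \<oplus>\<^bsub>M\<^esub> y \<in> N" by auto
  have "(c \<otimes> r) \<odot>\<^bsub>M\<^esub> x \<oplus>\<^bsub>M\<^esub> c \<odot>\<^bsub>M\<^esub> y = c \<odot>\<^bsub>M\<^esub> (r \<odot>\<^bsub>M\<^esub> x \<oplus>\<^bsub>M\<^esub> y)"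
    using * x G(1) c by (simp add: subset_iff smult_r_distr smult_assoc1)
  then have "(c \<otimes> r) \<odot>\<^bsub>M\<^esub> x \<oplus>\<^bsub>M\<^esub> c \<odot>\<^bsub>M\<^esub> y \<in> N" using N(6)[OF c *(3)] by simp
  then show "c \<otimes> r \<in> ?I" using * c G(6)[OF c *(1)] by auto
qed auto

end

subsection \<open>Noetherian modules\<close>

text \<open>Induction on the number of generators. After adding a generator \<open>x\<close>, a
  submodule \<open>N\<close> is generated by generators of its part inside the span of
  \<open>X\<close>, together with lifts of finitely many generators of the ideal of coefficients at
  \<open>x\<close>.\<close>

lemma (in cring) fg_imp_noeth:
  assumes "noetherian_ring R" "fg_module R (M :: ('a, 'm) module)"
  shows "noeth_module R M"
proof -
  interpret NR: noetherian_ring R by fact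
  interpret rmodule R M using assms(2) by (intro rmodule.intro) (simp add: fg_module_def)
  have "fg_submodule R M N"
    if "finite X" "X \<subseteq> carrier M" "submodule N R M" "N \<subseteq> gen_submodule R M X" for X N
    using that
  proof (induct X arbitrary: N rule: finite_induct)
    case empty
    have "N \<subseteq> {\<zero>\<^bsub>M\<^esub>}"
      using empty gen_submodule_minimal[of "{\<zero>\<^bsub>M\<^esub>}" "{}"] submoduleI'[of "{\<zero>\<^bsub>M\<^esub>}"] by auto
    then have "N = {\<zero>\<^bsub>M\<^esub>}" using submodule_closed(2)[OF empty(2)] by auto
    then show ?case using fg_zero by simp
  next
    case (insert x X)
    note N = submodule_closed[OF insert(5)]
    have X: "X \<subseteq> carrier M" "x \<in> carrier M" using insert by auto
    note G = submodule_closed[OF gen_submodule[OF X(1)]]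
    define I where "I = {r \<in> carrier R. \<exists>y\<in>gen_submodule R M X. r \<odot>\<^bsub>M\<^esub> x \<oplus>\<^bsub>M\<^esub> y \<in> N}"
    have "ideal I R"
      unfolding I_def by (rule coefficient_ideal[OF insert(5) gen_submodule[OF X(1)] X(2)])
    then obtain A where A: "A \<subseteq> carrier R" "finite A" "I = Idl A" using NR.finetely_gen by blast
    have AI: "A \<subseteq> I" using A genideal_self by auto
    have "\<forall>a\<in>A. \<exists>y. y \<in> gen_submodule R M X \<and> a \<odot>\<^bsub>M\<^esub> x \<oplus>\<^bsub>M\<^esub> y \<in> N" using AI by (auto simp: I_def)
    then obtain y where y: "\<And>a. a \<in> A \<Longrightarrow> y a \<in> gen_submodule R M X \<and> a \<odot>\<^bsub>M\<^esub> x \<oplus>\<^bsub>M\<^esub> y a \<in> N" by metis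
    \<comment> \<open>One element of \<open>N\<close> for each generator \<open>a\<close> of the
      coefficient ideal, with coefficient \<open>a\<close> at \<open>x\<close>.\<close>
    define Z where "Z = (\<lambda>a. a \<odot>\<^bsub>M\<^esub> x \<oplus>\<^bsub>M\<^esub> y a) ` A"
    have ZN: "Z \<subseteq> N" using y by (auto simp: Z_def)
    have ZM: "Z \<subseteq> carrier M" using ZN N by auto
    note GZ = submodule_closed[OF gen_submodule[OF ZM]]
    have "submodule (N \<inter> gen_submodule R M X) R M" using N G by (intro submoduleI') auto
    then have "fg_submodule R M (N \<inter> gen_submodule R M X)" using insert by auto
    then obtain Y where Y: "finite Y" "Y \<subseteq> carrier M" "N \<inter> gen_submodule R M X = gen_submodule R M Y"
      by (auto simp: fg_submodule_def)
    \<comment> \<open>The same ideal for the span of \<open>Z\<close> instead of \<open>N\<close>.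
      It contains the generators \<open>A\<close>, hence all of \<open>I\<close>, so every
      coefficient occurring in \<open>N\<close> also occurs in the span of \<open>Z\<close>.\<close>
    define J where "J = {r \<in> carrier R. \<exists>y\<in>gen_submodule R M X. r \<odot>\<^bsub>M\<^esub> x \<oplus>\<^bsub>M\<^esub> y \<in> gen_submodule R M Z}"
    have "ideal J R"
      unfolding J_def by (rule coefficient_ideal[OF gen_submodule[OF ZM] gen_submodule[OF X(1)] X(2)])
    moreover have "A \<subseteq> J"
    proof
      fix a assume a: "a \<in> A"
      then have "a \<odot>\<^bsub>M\<^esub> x \<oplus>\<^bsub>M\<^esub> y a \<in> gen_submodule R M Z" using gen_submodule_subset[of Z] by (auto simp: Z_def)
      then show "a \<in> J" using A a y unfolding J_def by auto
    qed
    ultimately have IJ: "I \<subseteq> J" using A genideal_minimal by auto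
    have YN: "Y \<subseteq> N" using Y(3) gen_submodule_subset by blast
    have "N = gen_submodule R M (Y \<union> Z)"
    proof
      show "gen_submodule R M (Y \<union> Z) \<subseteq> N" using YN ZN gen_submodule_minimal[OF insert(5)] by auto
      note GYZ = submodule_closed[OF gen_submodule[of "Y \<union> Z"]]
      show "N \<subseteq> gen_submodule R M (Y \<union> Z)"
      proof
        fix z assume z: "z \<in> N"
        then obtain r u where ru: "r \<in> carrier R" "u \<in> gen_submodule R M X" "z = r \<odot>\<^bsub>M\<^esub> x \<oplus>\<^bsub>M\<^esub> u"
          using gen_submodule_insert[OF X] insert(6) by blast
        then have "r \<in> I" using z by (auto simp: I_def)
        then obtain w v where wv: "w \<in> gen_submodule R M Z" "v \<in> gen_submodule R M X" "w = r \<odot>\<^bsub>M\<^esub> x \<oplus>\<^bsub>M\<^esub> v"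
          using IJ unfolding J_def by blast
        have car: "u \<in> carrier M" "v \<in> carrier M" "w \<in> carrier M" using ru wv G(1) GZ(1) by auto
        have zw: "z = (u \<ominus>\<^bsub>M\<^esub> v) \<oplus>\<^bsub>M\<^esub> w"
        proof -
          have "(u \<ominus>\<^bsub>M\<^esub> v) \<oplus>\<^bsub>M\<^esub> w = (r \<odot>\<^bsub>M\<^esub> x \<oplus>\<^bsub>M\<^esub> u) \<oplus>\<^bsub>M\<^esub> (v \<oplus>\<^bsub>M\<^esub> \<ominus>\<^bsub>M\<^esub> v)"
            unfolding wv(3) M.minus_eq using car X(2) ru(1) by (simp add: M.a_ac del: M.r_neg M.l_neg)
          then show ?thesis using car X(2) ru by (simp add: M.r_neg)
        qed
        have wN: "w \<in> N" using wv(1) gen_submodule_minimal[OF insert(5) ZN] by auto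
        \<comment> \<open>Written in two ways, this difference lies in \<open>N\<close> and in the
          span of \<open>X\<close>, hence in the span of \<open>Y\<close>.\<close>
        have "u \<ominus>\<^bsub>M\<^esub> v = z \<ominus>\<^bsub>M\<^esub> w" unfolding zw M.minus_eq using car by (simp add: M.a_assoc M.r_neg)
        then have "u \<ominus>\<^bsub>M\<^esub> v \<in> gen_submodule R M Y" using Y(3) N(5)[OF z wN] G(5)[OF ru(2) wv(2)] by auto
        then have 1: "u \<ominus>\<^bsub>M\<^esub> v \<in> gen_submodule R M (Y \<union> Z)"
          using gen_submodule_mono[of Y "Y \<union> Z"] by auto
        have 2: "w \<in> gen_submodule R M (Y \<union> Z)"
          using wv(1) gen_submodule_mono[of Z "Y \<union> Z"] by auto
        have "Y \<union> Z \<subseteq> carrier M" using Y(2) ZM by auto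
        then show "z \<in> gen_submodule R M (Y \<union> Z)"
          unfolding zw by (rule GYZ(3)[OF _ 1 2])
      qed
    qed
    moreover have "finite (Y \<union> Z)" "Y \<union> Z \<subseteq> carrier M" using Y A ZM by (auto simp: Z_def)
    ultimately show ?case unfolding fg_submodule_def by blast
  qed
  then show ?thesis using assms(2) submodule_closed(1) module_axioms
    unfolding noeth_module_def fg_module_def fg_submodule_def by metis
qed

text \<open>The union of an ascending chain is finitely generated, and its generators already lie in
  one member. The larger submodule comes first in the pairs, so minimal elements are maximal
  submodules and induction proceeds from larger submodules to smaller ones.\<close>

lemma wf_submodules:
  assumes "noeth_module R (M :: ('r, 'm) module)"
  shows "wf {(B, A). submodule A R M \<and> submodule B R M \<and> A \<subset> B}"
proof -
  interpret rmodule R M using assms by (intro rmodule.intro) (simp add: noeth_module_def)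
  show ?thesis unfolding wf_iff_no_infinite_down_chain
  proof
    assume "\<exists>f. \<forall>i. (f (Suc i), f i) \<in> {(B, A). submodule A R M \<and> submodule B R M \<and> A \<subset> B}"
    then obtain f where f: "\<And>i. submodule (f i) R M" "\<And>i. f i \<subset> f (Suc i)" by blast
    have "f i \<subseteq> f (Suc i)" for i using f(2)[of i] by (rule psubset_imp_subset)
    then have mono: "i \<le> j \<Longrightarrow> f i \<subseteq> f j" for i j by (rule lift_Suc_mono_le)
    have "submodule (\<Union>i. f i) R M"
    proof (rule submoduleI')
      show "\<Union> (range f) \<subseteq> carrier M" "\<zero>\<^bsub>M\<^esub> \<in> \<Union> (range f)"
        using submodule_closed(1,2)[OF f(1)] by blast+
      fix a b assume "a \<in> \<Union> (range f)" "b \<in> \<Union> (range f)"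
      then obtain i j where "a \<in> f i" "b \<in> f j" by auto
      then have "a \<in> f (max i j)" "b \<in> f (max i j)" using mono[of i "max i j"] mono[of j "max i j"] by fastforce+
      then show "a \<oplus>\<^bsub>M\<^esub> b \<in> \<Union> (range f)" using submodule_closed(3)[OF f(1)] by blast
    qed (use submodule_closed(6)[OF f(1)] in blast)
    then obtain X where X: "finite X" "X \<subseteq> carrier M" "(\<Union>i. f i) = gen_submodule R M X"
      using assms by (auto simp: noeth_module_def fg_submodule_def)
    have "X \<subseteq> (\<Union>i. f i)" using X gen_submodule_subset by auto
    then have "\<forall>x\<in>X. \<exists>i. x \<in> f i" by auto
    then obtain k where k: "\<And>x. x \<in> X \<Longrightarrow> x \<in> f (k x)" by metis
    \<comment> \<open>Inserting 0 keeps \<open>Max\<close> meaningful when there are no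
      generators.\<close>
    have "X \<subseteq> f (Max (insert 0 (k ` X)))"
    proof
      fix x assume "x \<in> X"
      then show "x \<in> f (Max (insert 0 (k ` X)))"
        using k[of x] X(1) mono[of "k x" "Max (insert 0 (k ` X))"] by auto
    qed
    then have "(\<Union>i. f i) \<subseteq> f (Max (insert 0 (k ` X)))" using X(3) gen_submodule_minimal[OF f(1)] by auto
    then show False using f(2)[of "Max (insert 0 (k ` X))"] by blast
  qed
qed

lemma (in noetherian_ring) noeth_self: "cring R \<Longrightarrow> noeth_module R (self_module R)"
proof -
  assume "cring R"
  then interpret cring R .
  interpret S: rmodule R "self_module R" by (intro rmodule.intro self_module)
  have "carrier R = gen_submodule R (self_module R) {\<one>}"
  proof
    note G = S.submodule_closed[OF S.gen_submodule[of "{\<one>}"]]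
    show "gen_submodule R (self_module R) {\<one>} \<subseteq> carrier R" using G by auto
    have o: "\<one> \<in> gen_submodule R (self_module R) {\<one>}" using S.gen_submodule_subset by auto
    show "carrier R \<subseteq> gen_submodule R (self_module R) {\<one>}"
    proof
      fix r assume "r \<in> carrier R"
      then show "r \<in> gen_submodule R (self_module R) {\<one>}" using G(6)[of r \<one>] o by auto
    qed
  qed
  then have "fg_module R (self_module R)"
    unfolding fg_module_def fg_submodule_def by (intro conjI self_module exI[of _ "{\<one>}"]) auto
  then show ?thesis by (intro fg_imp_noeth noetherian_ring_axioms)
qed

section \<open>Powers of ideals\<close>

context cring
begin

lemma ideal_power_0 [simp]: "ideal_power R I 0 = carrier R"
  by (simp add: ideal_power_def ideals_set_def)

lemma ideal_power_Suc: "ideal_power R I (Suc t) = ideal_prod R (ideal_power R I t) I"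
  by (simp add: ideal_power_def ideals_set_def)

lemma ideal_power_ideal: "ideal I R \<Longrightarrow> ideal (ideal_power R I t) R"
  by (induct t) (simp_all add: oneideal ideal_power_Suc ideal_prod_is_ideal)

lemma ideal_power_carrier: "ideal I R \<Longrightarrow> x \<in> ideal_power R I t \<Longrightarrow> x \<in> carrier R"
  using ideal.ideal_closed(1)[OF ideal_power_ideal] by blast

lemma ideal_power_1: "ideal I R \<Longrightarrow> ideal_power R I (Suc 0) = I"
  using ideal_prod_commute[OF oneideal, of I] ideal_prod_one[of I] by (simp add: ideal_power_Suc)

lemma ideal_power_add:
  assumes "ideal I R"
  shows "ideal_power R I (s + t) = ideal_prod R (ideal_power R I s) (ideal_power R I t)"
proof -
  interpret IS: comm_monoid "ideals_set R" by (rule ideals_set_is_comm_monoid)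
  have "I \<in> carrier (ideals_set R)" using assms by (simp add: ideals_set_def)
  from IS.nat_pow_mult[OF this, of s t] show ?thesis
    by (simp add: ideal_power_def ideals_set_def)
qed

lemma ideal_power_antimono:
  assumes "ideal I R" "s \<le> t" shows "ideal_power R I t \<subseteq> ideal_power R I s"
proof -
  have "ideal_power R I (s + (t - s)) \<subseteq> ideal_power R I s"
    unfolding ideal_power_add[OF assms(1)]
    using ideal_prod_inter[OF ideal_power_ideal[OF assms(1)] ideal_power_ideal[OF assms(1)]] by blast
  then show ?thesis using assms(2) by simp
qed

lemma ideal_prod_mono: "I \<subseteq> I' \<Longrightarrow> J \<subseteq> J' \<Longrightarrow> ideal_prod R I J \<subseteq> ideal_prod R I' J'"
proof
  fix x assume "I \<subseteq> I'" "J \<subseteq> J'" "x \<in> ideal_prod R I J"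
  from this(3,1,2) show "x \<in> ideal_prod R I' J'"
    by (induct x rule: ideal_prod.induct) (auto intro: ideal_prod.intros)
qed

lemma ideal_power_mono: "I \<subseteq> J \<Longrightarrow> ideal_power R I t \<subseteq> ideal_power R J t"
  by (induct t) (simp_all add: ideal_power_Suc ideal_prod_mono)

text \<open>A product of ideals consists of sums of products, so a property stable under sums need
  only be checked on products. Membership in the carrier is carried along to make the hypothesis on
  sums applicable.\<close>

lemma ideal_power_add_induct:
  assumes "ideal I R" "x \<in> ideal_power R I (s + t)"
    and "\<And>a b. a \<in> ideal_power R I s \<Longrightarrow> b \<in> ideal_power R I t \<Longrightarrow> P (a \<otimes> b)"
    and "\<And>a b. a \<in> carrier R \<Longrightarrow> b \<in> carrier R \<Longrightarrow> P a \<Longrightarrow> P b \<Longrightarrow> P (a \<oplus> b)"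
  shows "P x"
proof -
  have "x \<in> carrier R \<and> P x" using assms(2) unfolding ideal_power_add[OF assms(1)]
  proof (induct x rule: ideal_prod.induct)
    case (prod i j)
    then show ?case using assms(3) ideal_power_carrier[OF assms(1)] by auto
  next
    case (sum a b)
    then show ?case using assms(4) by auto
  qed
  then show ?thesis ..
qed

lemma prime_contains_power:
  assumes "ideal I R" "primeideal p R" "ideal_power R I t \<subseteq> p"
  shows "I \<subseteq> p"
  using assms(3)
proof (induct t)
  case 0
  then show ?case using ideal.ideal_closed(1)[OF assms(1)] by auto
next
  case (Suc t)
  interpret p: primeideal p R by fact
  show ?case
  proof
    fix x assume x: "x \<in> I"
    show "x \<in> p"
    proof (rule ccontr)
      assume nx: "x \<notin> p"
      have "ideal_power R I t \<subseteq> p"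
      proof
        fix y assume y: "y \<in> ideal_power R I t"
        then have "y \<otimes> x \<in> p" using Suc(2) x by (auto simp: ideal_power_Suc intro: ideal_prod.prod)
        then show "y \<in> p"
          using p.I_prime[of y x] nx ideal_power_carrier[OF assms(1) y] ideal.Icarr[OF assms(1) x] by blast
      qed
      then show False using Suc(1) x nx by blast
    qed
  qed
qed

end

section \<open>Quotients and homomorphisms\<close>

lemma quot_module_simps [simp]:
  "carrier (quot_module M N) = a_rcosets\<^bsub>M\<^esub> N" "zero (quot_module M N) = N"
  "add (quot_module M N) = set_add M"
  by (simp_all add: quot_module_def)

text \<open>Only the additive structure is assumed, because the same facts serve for
  \<open>rat_span\<close>, whose scalar multiplication is \<open>undefined\<close>.\<close>

locale additive_quotient = G?: abelian_group G
  for G :: "('r, 'm) module" (structure) +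
  fixes N
  assumes subgroup: "subgroup N (add_monoid G)"
begin

sublocale N: abelian_subgroup N G
  by (intro abelian_subgroupI3 additive_subgroupI subgroup abelian_group_axioms)

lemma carrier_quot: "carrier (quot_module G N) = (\<lambda>x. N +>\<^bsub>G\<^esub> x) ` carrier G"
  by (auto simp: A_RCOSETS_def')

lemma coset_eq_iff:
  assumes "x \<in> carrier G" "y \<in> carrier G"
  shows "N +>\<^bsub>G\<^esub> x = N +>\<^bsub>G\<^esub> y \<longleftrightarrow> x \<ominus>\<^bsub>G\<^esub> y \<in> N"
proof
  assume "N +>\<^bsub>G\<^esub> x = N +>\<^bsub>G\<^esub> y"
  then have "x \<in> N +>\<^bsub>G\<^esub> y" using N.a_rcos_self assms by auto
  then obtain h where h: "h \<in> N" "x = h \<oplus>\<^bsub>G\<^esub> y" by (auto simp: a_r_coset_def')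
  then have "x \<ominus>\<^bsub>G\<^esub> y = h" using assms N.a_subset by (auto simp: G.minus_eq G.a_assoc G.r_neg)
  then show "x \<ominus>\<^bsub>G\<^esub> y \<in> N" using h by simp
next
  assume h: "x \<ominus>\<^bsub>G\<^esub> y \<in> N"
  have "x = (x \<ominus>\<^bsub>G\<^esub> y) \<oplus>\<^bsub>G\<^esub> y" using assms by (simp add: G.minus_eq G.a_assoc G.l_neg)
  then have "x \<in> N +>\<^bsub>G\<^esub> y" using h by (auto simp: a_r_coset_def')
  then show "N +>\<^bsub>G\<^esub> x = N +>\<^bsub>G\<^esub> y" using G.a_repr_independence[OF _ assms(2) subgroup] by auto
qed

lemma coset_eq_iff_zero:
  assumes "x \<in> carrier G" shows "N +>\<^bsub>G\<^esub> x = N \<longleftrightarrow> x \<in> N"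
  using G.a_coset_join1[OF _ assms subgroup] G.a_coset_join2[OF assms subgroup] by auto

lemma coset_add:
  "x \<in> carrier G \<Longrightarrow> y \<in> carrier G \<Longrightarrow> (N +>\<^bsub>G\<^esub> x) <+>\<^bsub>G\<^esub> (N +>\<^bsub>G\<^esub> y) = N +>\<^bsub>G\<^esub> (x \<oplus>\<^bsub>G\<^esub> y)"
  by (rule N.a_rcos_sum)

lemma coset_zero: "N +>\<^bsub>G\<^esub> \<zero>\<^bsub>G\<^esub> = N"
  using coset_eq_iff_zero[of "\<zero>\<^bsub>G\<^esub>"] by simp

lemma coset_in: "x \<in> carrier G \<Longrightarrow> N +>\<^bsub>G\<^esub> x \<in> a_rcosets\<^bsub>G\<^esub> N"
  using carrier_quot by auto

lemma coset_cases:
  assumes "X \<in> a_rcosets\<^bsub>G\<^esub> N"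
  obtains x where "x \<in> carrier G" "X = N +>\<^bsub>G\<^esub> x"
  using assms carrier_quot by auto

lemma abelian_group_quot: "abelian_group (quot_module G N)"
proof (rule abelian_groupI)
  fix X assume "X \<in> carrier (quot_module G N)"
  then obtain x where x: "x \<in> carrier G" "X = N +>\<^bsub>G\<^esub> x" by (auto elim: coset_cases)
  show "\<exists>Y\<in>carrier (quot_module G N). Y \<oplus>\<^bsub>quot_module G N\<^esub> X = \<zero>\<^bsub>quot_module G N\<^esub>"
    using x by (intro bexI[of _ "N +>\<^bsub>G\<^esub> (\<ominus>\<^bsub>G\<^esub> x)"]) (auto simp: coset_add G.l_neg coset_zero coset_in)
  show "\<zero>\<^bsub>quot_module G N\<^esub> \<oplus>\<^bsub>quot_module G N\<^esub> X = X"
    using x coset_add[of "\<zero>\<^bsub>G\<^esub>" x] by (simp add: coset_zero)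
next
  show "\<zero>\<^bsub>quot_module G N\<^esub> \<in> carrier (quot_module G N)"
    using coset_in[of "\<zero>\<^bsub>G\<^esub>"] by (simp add: coset_zero)
qed (auto elim!: coset_cases simp: coset_add coset_in G.a_ac)

end

locale module_quotient = rmodule R M for R (structure) and M :: "('r, 'm) module" (structure) +
  fixes N assumes submodule: "submodule N R M"
begin

sublocale additive_quotient M N
  by (intro additive_quotient.intro additive_quotient_axioms.intro M.abelian_group_axioms
      submodule_subgroup submodule)

text \<open>\<open>quot_module\<close> defines scalar multiplication as a union over all
  representatives. Two representatives differ by an element of \<open>N\<close>, and
  \<open>N\<close> is stable under scalars, so the cosets in this union coincide.\<close>

lemma coset_smult:
  assumes "r \<in> carrier R" "x \<in> carrier M"
  shows "r \<odot>\<^bsub>quot_module M N\<^esub> (N +>\<^bsub>M\<^esub> x) = N +>\<^bsub>M\<^esub> (r \<odot>\<^bsub>M\<^esub> x)"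
proof -
  have "N +>\<^bsub>M\<^esub> (r \<odot>\<^bsub>M\<^esub> y) = N +>\<^bsub>M\<^esub> (r \<odot>\<^bsub>M\<^esub> x)" if "y \<in> N +>\<^bsub>M\<^esub> x" for y
  proof -
    have y: "y \<in> carrier M" using that a_r_coset_subset_G[OF N.a_subset assms(2)] by auto
    have "N +>\<^bsub>M\<^esub> y = N +>\<^bsub>M\<^esub> x" using M.a_repr_independence[OF that assms(2) subgroup] ..
    then have "y \<ominus>\<^bsub>M\<^esub> x \<in> N" using coset_eq_iff[OF y assms(2)] by simp
    then have "r \<odot>\<^bsub>M\<^esub> (y \<ominus>\<^bsub>M\<^esub> x) \<in> N" using submodule_closed(6)[OF submodule] assms by auto
    then show ?thesis using assms y coset_eq_iff by (simp add: smult_minus)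
  qed
  moreover have "x \<in> N +>\<^bsub>M\<^esub> x" using N.a_rcos_self assms by auto
  ultimately have "(\<Union>y\<in>N +>\<^bsub>M\<^esub> x. N +>\<^bsub>M\<^esub> (r \<odot>\<^bsub>M\<^esub> y)) = N +>\<^bsub>M\<^esub> (r \<odot>\<^bsub>M\<^esub> x)" by blast
  then show ?thesis by (simp add: quot_module_def)
qed

lemma module_quot: "module R (quot_module M N)"
proof (rule moduleI)
  show "abelian_group (quot_module M N)" by (rule abelian_group_quot)
qed (auto elim!: coset_cases simp: coset_add coset_in coset_smult smult_l_distr smult_r_distr smult_assoc1 R.is_cring)

end

section \<open>Linear maps, their kernels and images\<close>

lemma mod_homD:
  assumes "f \<in> mod_hom R M N"
  shows "x \<in> carrier M \<Longrightarrow> f x \<in> carrier N"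
    "x \<in> carrier M \<Longrightarrow> y \<in> carrier M \<Longrightarrow> f (x \<oplus>\<^bsub>M\<^esub> y) = f x \<oplus>\<^bsub>N\<^esub> f y"
    "r \<in> carrier R \<Longrightarrow> x \<in> carrier M \<Longrightarrow> f (r \<odot>\<^bsub>M\<^esub> x) = r \<odot>\<^bsub>N\<^esub> f x"
  using assms by (auto simp: mod_hom_def)

lemma mod_homI:
  assumes "\<And>x. x \<in> carrier M \<Longrightarrow> f x \<in> carrier N"
    "\<And>x y. x \<in> carrier M \<Longrightarrow> y \<in> carrier M \<Longrightarrow> f (x \<oplus>\<^bsub>M\<^esub> y) = f x \<oplus>\<^bsub>N\<^esub> f y"
    "\<And>r x. r \<in> carrier R \<Longrightarrow> x \<in> carrier M \<Longrightarrow> f (r \<odot>\<^bsub>M\<^esub> x) = r \<odot>\<^bsub>N\<^esub> f x"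
  shows "f \<in> mod_hom R M N"
  using assms by (auto simp: mod_hom_def)

lemma mod_hom_comp:
  assumes "f \<in> mod_hom R L M" "g \<in> mod_hom R M N" shows "(\<lambda>x. g (f x)) \<in> mod_hom R L N"
  using mod_homD[OF assms(1)] mod_homD[OF assms(2)] by (intro mod_homI) auto

lemma mod_hom_zero:
  assumes "f \<in> mod_hom R M N" "module R M" "module R N"
  shows "f \<zero>\<^bsub>M\<^esub> = \<zero>\<^bsub>N\<^esub>"
proof -
  interpret M: module R M by fact
  interpret N: module R N by fact
  have "f (\<zero>\<^bsub>R\<^esub> \<odot>\<^bsub>M\<^esub> \<zero>\<^bsub>M\<^esub>) = \<zero>\<^bsub>R\<^esub> \<odot>\<^bsub>N\<^esub> f \<zero>\<^bsub>M\<^esub>" by (rule mod_homD(3)[OF assms(1)]) auto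
  then show ?thesis using mod_homD(1)[OF assms(1)] by auto
qed

lemma mod_hom_minus:
  assumes "f \<in> mod_hom R M N" "module R M" "module R N" "x \<in> carrier M" "y \<in> carrier M"
  shows "f (x \<ominus>\<^bsub>M\<^esub> y) = f x \<ominus>\<^bsub>N\<^esub> f y"
proof -
  interpret M: rmodule R M using assms by (intro rmodule.intro)
  interpret N: rmodule R N using assms by (intro rmodule.intro)
  note f = mod_homD[OF assms(1)]
  have "f (x \<oplus>\<^bsub>M\<^esub> (\<ominus>\<^bsub>R\<^esub> \<one>\<^bsub>R\<^esub>) \<odot>\<^bsub>M\<^esub> y) = f x \<oplus>\<^bsub>N\<^esub> (\<ominus>\<^bsub>R\<^esub> \<one>\<^bsub>R\<^esub>) \<odot>\<^bsub>N\<^esub> f y"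
    using assms f(2)[of x "(\<ominus>\<^bsub>R\<^esub> \<one>\<^bsub>R\<^esub>) \<odot>\<^bsub>M\<^esub> y"] f(3)[of "\<ominus>\<^bsub>R\<^esub> \<one>\<^bsub>R\<^esub>" y] by auto
  then show ?thesis using assms f(1) M.smult_neg_one[of y] N.smult_neg_one[of "f y"]
    by (simp add: a_minus_def)
qed

lemma a_kernel_submodule:
  assumes "f \<in> mod_hom R M N" "module R M" "module R N"
  shows "submodule (a_kernel M N f) R M"
proof -
  interpret M: rmodule R M using assms by (intro rmodule.intro)
  interpret N: rmodule R N using assms by (intro rmodule.intro)
  note f = mod_homD[OF assms(1)]
  show ?thesis using f mod_hom_zero[OF assms] by (intro M.submoduleI') (auto simp: a_kernel_def')
qed

lemma mod_hom_image_submodule: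
  assumes "f \<in> mod_hom R M N" "module R M" "module R N" "submodule A R M"
  shows "submodule (f ` A) R N"
proof -
  interpret M: rmodule R M using assms by (intro rmodule.intro)
  interpret N: rmodule R N using assms by (intro rmodule.intro)
  note f = mod_homD[OF assms(1)]
  note A = M.submodule_closed[OF assms(4)]
  show ?thesis
  proof (rule N.submoduleI')
    show "f ` A \<subseteq> carrier N" using f(1) A(1) by auto
    show "\<zero>\<^bsub>N\<^esub> \<in> f ` A" using mod_hom_zero[OF assms(1-3)] A(2) by (metis image_eqI)
    fix a b assume "a \<in> f ` A" "b \<in> f ` A"
    then obtain x y where "x \<in> A" "y \<in> A" "a = f x" "b = f y" by auto
    then show "a \<oplus>\<^bsub>N\<^esub> b \<in> f ` A" using f(2)[of x y] subsetD[OF A(1)] A(3)[of x y] by (auto intro!: image_eqI[of _ _ "x \<oplus>\<^bsub>M\<^esub> y"])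
  next
    fix r a assume r: "r \<in> carrier R" "a \<in> f ` A"
    then obtain x where "x \<in> A" "a = f x" by auto
    then show "r \<odot>\<^bsub>N\<^esub> a \<in> f ` A" using f(3)[of r x] subsetD[OF A(1)] A(6)[of r x] r(1) by (auto intro!: image_eqI[of _ _ "r \<odot>\<^bsub>M\<^esub> x"])
  qed
qed

subsection \<open>Finite powers\<close>

text \<open>Extensional functions, so that an element is determined by its entries on
  \<open>I\<close>. The index set will be a finite set of generators of an ideal.\<close>

definition pow_module :: "('r, 'm) module \<Rightarrow> 'i set \<Rightarrow> ('r, 'i \<Rightarrow> 'm) module" where
  "pow_module M I = \<lparr>carrier = I \<rightarrow>\<^sub>E carrier M, monoid.mult = undefined, one = undefined,
     zero = (\<lambda>i\<in>I. \<zero>\<^bsub>M\<^esub>), add = (\<lambda>f g. \<lambda>i\<in>I. f i \<oplus>\<^bsub>M\<^esub> g i),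
     smult = (\<lambda>r f. \<lambda>i\<in>I. r \<odot>\<^bsub>M\<^esub> f i)\<rparr>"

lemma pow_module_simps [simp]:
  "carrier (pow_module M I) = I \<rightarrow>\<^sub>E carrier M" "zero (pow_module M I) = (\<lambda>i\<in>I. \<zero>\<^bsub>M\<^esub>)"
  "add (pow_module M I) = (\<lambda>f g. \<lambda>i\<in>I. f i \<oplus>\<^bsub>M\<^esub> g i)"
  "smult (pow_module M I) = (\<lambda>r f. \<lambda>i\<in>I. r \<odot>\<^bsub>M\<^esub> f i)"
  by (simp_all add: pow_module_def)

lemma (in rmodule) pow_module: "module R (pow_module M I)"
proof (rule moduleI)
  show "abelian_group (pow_module M I)"
  proof (rule abelian_groupI)
    fix f assume f: "f \<in> carrier (pow_module M I)"
    have "(\<lambda>i\<in>I. \<ominus>\<^bsub>M\<^esub> f i) \<oplus>\<^bsub>pow_module M I\<^esub> f = \<zero>\<^bsub>pow_module M I\<^esub>"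
      using f by (auto simp: PiE_iff M.l_neg intro!: restrict_ext)
    then show "\<exists>g\<in>carrier (pow_module M I). g \<oplus>\<^bsub>pow_module M I\<^esub> f = \<zero>\<^bsub>pow_module M I\<^esub>"
      using f by (intro bexI[of _ "\<lambda>i\<in>I. \<ominus>\<^bsub>M\<^esub> f i"]) (auto simp: PiE_iff)
  qed (auto simp: PiE_iff M.a_ac extensional_def fun_eq_iff)
qed (auto simp: PiE_iff smult_l_distr smult_r_distr smult_assoc1 extensional_def fun_eq_iff R.is_cring)

text \<open>Induction on a finite set of coordinates outside which the submodule vanishes.
  Evaluation at a new coordinate \<open>j\<close> splits \<open>N\<close> into a kernel, to which
  the induction hypothesis applies, and an image in \<open>M\<close>; generators of the kernel and
  lifts of generators of the image generate \<open>N\<close>.\<close>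

lemma (in rmodule) noeth_pow:
  assumes "noeth_module R M" "finite I"
  shows "noeth_module R (pow_module M I)"
proof -
  let ?P = "pow_module M I"
  interpret P: rmodule R ?P by (intro rmodule.intro pow_module)
  have "fg_submodule R ?P N" if "finite J" "submodule N R ?P" "\<And>f i. f \<in> N \<Longrightarrow> i \<in> I - J \<Longrightarrow> f i = \<zero>\<^bsub>M\<^esub>" "J \<subseteq> I" for J N
    using that
  proof (induct J arbitrary: N rule: finite_induct)
    case empty
    have "f = \<zero>\<^bsub>?P\<^esub>" if "f \<in> N" for f
      using empty(2)[OF that] P.submodule_closed(1)[OF empty(1)] that by (auto simp: PiE_iff extensional_def fun_eq_iff)
    then have "N = {\<zero>\<^bsub>?P\<^esub>}" using P.submodule_closed(2)[OF empty(1)] by blast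
    then show ?case using P.fg_zero by simp
  next
    case (insert j J)
    note N = P.submodule_closed[OF insert(4)]
    have j: "j \<in> I" using insert by simp
    let ?N0 = "{f\<in>N. f j = \<zero>\<^bsub>M\<^esub>}"
    have car: "f j \<in> carrier M" if "f \<in> N" for f using N(1) j that by auto
    have "submodule ?N0 R ?P"
      using N j by (intro P.submoduleI') auto
    moreover have "f i = \<zero>\<^bsub>M\<^esub>" if "f \<in> ?N0" "i \<in> I - J" for f i
      using that insert(5)[of f i] by (cases "i = j") auto
    moreover have "J \<subseteq> I" using insert(6) by simp
    ultimately have "fg_submodule R ?P ?N0" by (rule insert(3))
    then obtain Y where Y: "finite Y" "Y \<subseteq> carrier ?P" "?N0 = gen_submodule R ?P Y"
      by (auto simp: fg_submodule_def)
    have ev: "(\<lambda>f. f j) \<in> mod_hom R ?P M" using j by (intro mod_homI) auto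
    have "submodule ((\<lambda>f. f j) ` N) R M"
      by (rule mod_hom_image_submodule[OF ev pow_module module_axioms insert(4)])
    then obtain Z where Z: "finite Z" "Z \<subseteq> carrier M" "(\<lambda>f. f j) ` N = gen_submodule R M Z"
      using assms(1) unfolding noeth_module_def fg_submodule_def by blast
    have "Z \<subseteq> (\<lambda>f. f j) ` N" using Z gen_submodule_subset by auto
    then obtain L where L: "L \<subseteq> N" "finite L" "Z = (\<lambda>f. f j) ` L" using Z(1) by (metis finite_subset_image)
    have LP: "Y \<union> L \<subseteq> carrier ?P" using Y L N by auto
    note GL = P.submodule_closed[OF P.gen_submodule[OF LP]]
    have subL: "submodule ((\<lambda>f. f j) ` gen_submodule R ?P (Y \<union> L)) R M"
      by (rule mod_hom_image_submodule[OF ev pow_module module_axioms P.gen_submodule[OF LP]])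
    have "N = gen_submodule R ?P (Y \<union> L)"
    proof
      have "Y \<subseteq> N" using Y P.gen_submodule_subset[of Y] by auto
      then have "Y \<union> L \<subseteq> N" using L by auto
      then show GN: "gen_submodule R ?P (Y \<union> L) \<subseteq> N" by (rule P.gen_submodule_minimal[OF insert(4)])
      show "N \<subseteq> gen_submodule R ?P (Y \<union> L)"
      proof
        fix f assume f: "f \<in> N"
        have "Z \<subseteq> (\<lambda>f. f j) ` gen_submodule R ?P (Y \<union> L)" using L P.gen_submodule_subset[of "Y \<union> L"] by auto
        then have "f j \<in> (\<lambda>f. f j) ` gen_submodule R ?P (Y \<union> L)"
          using gen_submodule_minimal[OF subL, of Z] Z(3) f by auto
        then obtain g where g: "g \<in> gen_submodule R ?P (Y \<union> L)" "f j = g j" by auto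
        have fgP: "f \<in> carrier ?P" "g \<in> carrier ?P" using f g N(1) GN by auto
        \<comment> \<open>Subtracting an element of the span with the same entry at \<open>j\<close>
          leaves an element of the kernel.\<close>
        define h where "h = f \<ominus>\<^bsub>?P\<^esub> g"
        have e: "h \<oplus>\<^bsub>?P\<^esub> g = f" unfolding h_def by (rule P.diff_add[OF fgP])
        have hN: "h \<in> N" unfolding h_def using N(5)[OF f] g(1) GN by blast
        have "h j \<oplus>\<^bsub>M\<^esub> g j = (h \<oplus>\<^bsub>?P\<^esub> g) j" using j by simp
        then have "h j \<oplus>\<^bsub>M\<^esub> g j = g j" unfolding e g(2) .
        then have "h j = \<zero>\<^bsub>M\<^esub>" using car[OF hN] car[OF f] g(2) by (simp add: M.add.r_cancel_one)
        then have "h \<in> ?N0" using hN by auto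
        then have hG: "h \<in> gen_submodule R ?P (Y \<union> L)"
          using Y(3) P.gen_submodule_mono[of Y "Y \<union> L"] by auto
        show "f \<in> gen_submodule R ?P (Y \<union> L)" using GL(3)[OF hG g(1)] e by simp
      qed
    qed
    moreover have "finite (Y \<union> L)" using Y L by auto
    ultimately show ?case using LP unfolding fg_submodule_def by blast
  qed
  from this[OF assms(2)] show ?thesis by (auto simp: noeth_module_def pow_module)
qed

subsection \<open>Transport of structure\<close>

text \<open>A copy of a module along an injection of its carrier. \<open>injective_module\<close>
  tests extension only against modules in one fixed type, so constructed modules have to be moved
  into that type, and so does the ring when a map on an ideal is to be extended.\<close>

definition transport_module :: "('m \<Rightarrow> 'e) \<Rightarrow> ('r, 'm) module \<Rightarrow> ('r, 'e) module" where
  "transport_module \<theta> M =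
    \<lparr>carrier = \<theta> ` carrier M, monoid.mult = undefined, one = undefined, zero = \<theta> \<zero>\<^bsub>M\<^esub>,
     add = (\<lambda>x y. \<theta> (inv_into (carrier M) \<theta> x \<oplus>\<^bsub>M\<^esub> inv_into (carrier M) \<theta> y)),
     smult = (\<lambda>r x. \<theta> (r \<odot>\<^bsub>M\<^esub> inv_into (carrier M) \<theta> x))\<rparr>"

context rmodule
begin

context
  fixes \<theta> :: "'m \<Rightarrow> 'e"
  assumes inj: "inj_on \<theta> (carrier M)"
begin

lemma transport_simps:
  "carrier (transport_module \<theta> M) = \<theta> ` carrier M"
  "\<zero>\<^bsub>transport_module \<theta> M\<^esub> = \<theta> \<zero>\<^bsub>M\<^esub>"
  "x \<in> carrier M \<Longrightarrow> y \<in> carrier M \<Longrightarrow> \<theta> x \<oplus>\<^bsub>transport_module \<theta> M\<^esub> \<theta> y = \<theta> (x \<oplus>\<^bsub>M\<^esub> y)"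
  "x \<in> carrier M \<Longrightarrow> r \<odot>\<^bsub>transport_module \<theta> M\<^esub> \<theta> x = \<theta> (r \<odot>\<^bsub>M\<^esub> x)"
  using inj by (simp_all add: transport_module_def)

lemma transport_module: "module R (transport_module \<theta> M)"
proof (rule moduleI)
  show "abelian_group (transport_module \<theta> M)"
  proof (rule abelian_groupI)
    fix x assume "x \<in> carrier (transport_module \<theta> M)"
    then obtain y where "y \<in> carrier M" "x = \<theta> y" by (auto simp: transport_simps)
    then show "\<exists>y\<in>carrier (transport_module \<theta> M). y \<oplus>\<^bsub>transport_module \<theta> M\<^esub> x = \<zero>\<^bsub>transport_module \<theta> M\<^esub>"
      by (intro bexI[of _ "\<theta> (\<ominus>\<^bsub>M\<^esub> y)"]) (auto simp: transport_simps M.l_neg)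
  qed (auto simp: transport_simps M.a_ac)
qed (auto simp: transport_simps smult_l_distr smult_r_distr smult_assoc1 R.is_cring)

lemma transport_hom: "\<theta> \<in> mod_hom R M (transport_module \<theta> M)"
  by (rule mod_homI) (auto simp: transport_simps)

lemma transport_inv_hom: "inv_into (carrier M) \<theta> \<in> mod_hom R (transport_module \<theta> M) M"
  using inj by (intro mod_homI) (auto simp: transport_simps)

end

end

section \<open>Divisible groups\<close>

context abelian_group
begin

lemma zmult_0: "add_pow G ((0::int)) x = \<zero>"
  by (simp add: add_pow_def int_pow_def2)

lemma zmult_1: "x \<in> carrier G \<Longrightarrow> add_pow G ((1::int)) x = x"
  by (simp add: add_pow_def int_pow_def2)

lemma zmult_closed: "x \<in> carrier G \<Longrightarrow> add_pow G ((n::int)) x \<in> carrier G"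
  by simp

lemma zmult_Suc: "x \<in> carrier G \<Longrightarrow> add_pow G (int (Suc n)) x = add_pow G (int n) x \<oplus> x"
  using add.int_pow_mult[of x "int n" 1] by (simp add: zmult_1 add.commute[of _ 1])

end

definition divisible_group :: "('r, 'd) module \<Rightarrow> bool" where
  "divisible_group D \<longleftrightarrow> abelian_group D \<and>
     (\<forall>d\<in>carrier D. \<forall>n::int. n > 0 \<longrightarrow> (\<exists>e\<in>carrier D. add_pow D n e = d))"

text \<open>Divisible groups are injective among abelian groups: Zorn's lemma gives a maximal
  extension, and a maximal one is total, because division in \<open>D\<close> provides a value at
  one more element \<open>b\<close>.\<close>

lemma divisible_extension:
  fixes D :: "('r, 'd) module" and B :: "('b, 'l) ring_scheme"
  assumes B: "abelian_group B" and D: "divisible_group D" and A: "subgroup A (add_monoid B)"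
    and \<phi>: "\<And>x. x \<in> A \<Longrightarrow> \<phi> x \<in> carrier D"
      "\<And>x y. x \<in> A \<Longrightarrow> y \<in> A \<Longrightarrow> \<phi> (x \<oplus>\<^bsub>B\<^esub> y) = \<phi> x \<oplus>\<^bsub>D\<^esub> \<phi> y"
  obtains \<psi> where "\<And>x. x \<in> carrier B \<Longrightarrow> \<psi> x \<in> carrier D"
    "\<And>x y. x \<in> carrier B \<Longrightarrow> y \<in> carrier B \<Longrightarrow> \<psi> (x \<oplus>\<^bsub>B\<^esub> y) = \<psi> x \<oplus>\<^bsub>D\<^esub> \<psi> y"
    "\<And>x. x \<in> A \<Longrightarrow> \<psi> x = \<phi> x"
proof -
  interpret B: abelian_group B by fact
  interpret D: abelian_group D using D by (simp add: divisible_group_def)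
  have A0: "\<zero>\<^bsub>B\<^esub> \<in> A" using subgroup.one_closed[OF A] by simp
  have Aadd: "x \<oplus>\<^bsub>B\<^esub> y \<in> A" if "x \<in> A" "y \<in> A" for x y using subgroup.m_closed[OF A that] by simp
  have Aneg: "\<ominus>\<^bsub>B\<^esub> x \<in> A" if "x \<in> A" for x using subgroup.m_inv_closed[OF A that] by (simp add: a_inv_def)
  have Acar: "x \<in> carrier B" if "x \<in> A" for x using subgroup.subset[OF A] that by auto
  have \<phi>0: "\<phi> \<zero>\<^bsub>B\<^esub> = \<zero>\<^bsub>D\<^esub>" using \<phi>(2)[OF A0 A0] \<phi>(1)[OF A0] by simp
  have \<phi>neg: "\<phi> (\<ominus>\<^bsub>B\<^esub> x) = \<ominus>\<^bsub>D\<^esub> \<phi> x" if "x \<in> A" for x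
  proof -
    have "\<phi> (\<ominus>\<^bsub>B\<^esub> x) \<oplus>\<^bsub>D\<^esub> \<phi> x = \<zero>\<^bsub>D\<^esub>" using \<phi>(2)[OF Aneg[OF that] that] \<phi>0 Acar[OF that] by (simp add: B.l_neg)
    then show ?thesis using \<phi>(1) Aneg that by (simp add: D.add.inv_equality)
  qed
  \<comment> \<open>Partial additive maps are encoded as relations closed under addition and
    negation, so that chains are bounded by their unions; the last clause makes such a relation
    single-valued.\<close>
  define good where "good G \<longleftrightarrow> G \<subseteq> carrier B \<times> carrier D \<and>
    (\<forall>x y x' y'. (x, y) \<in> G \<longrightarrow> (x', y') \<in> G \<longrightarrow> (x \<oplus>\<^bsub>B\<^esub> x', y \<oplus>\<^bsub>D\<^esub> y') \<in> G) \<and>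
    (\<forall>x y. (x, y) \<in> G \<longrightarrow> (\<ominus>\<^bsub>B\<^esub> x, \<ominus>\<^bsub>D\<^esub> y) \<in> G) \<and>
    (\<forall>y. (\<zero>\<^bsub>B\<^esub>, y) \<in> G \<longrightarrow> y = \<zero>\<^bsub>D\<^esub>)" for G
  define G0 where "G0 = (\<lambda>x. (x, \<phi> x)) ` A"
  have goodG0: "good G0" unfolding good_def G0_def
    using \<phi> \<phi>0 \<phi>neg Aadd Aneg Acar by auto
  define P where "P = {G. good G \<and> G0 \<subseteq> G}"
  have "\<exists>G\<in>P. \<forall>X\<in>P. G \<subseteq> X \<longrightarrow> X = G"
  proof (rule subset_Zorn_nonempty)
    show "P \<noteq> {}" using goodG0 by (auto simp: P_def)
    fix C assume C: "C \<noteq> {}" "subset.chain P C"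
    then have CP: "C \<subseteq> P" and ch: "\<And>X Y. X \<in> C \<Longrightarrow> Y \<in> C \<Longrightarrow> X \<subseteq> Y \<or> Y \<subseteq> X"
      by (auto simp: subset_chain_def)
    have g: "good X" if "X \<in> C" for X using CP that by (auto simp: P_def)
    have "good (\<Union> C)" unfolding good_def
    proof (intro conjI allI impI)
      show "\<Union> C \<subseteq> carrier B \<times> carrier D" using g unfolding good_def by blast
      fix x y assume xy: "(x, y) \<in> \<Union> C"
      then obtain X where X: "X \<in> C" "(x, y) \<in> X" by (elim UnionE)
      then show "(\<ominus>\<^bsub>B\<^esub> x, \<ominus>\<^bsub>D\<^esub> y) \<in> \<Union> C" using g[OF X(1)] unfolding good_def by blast
      fix x' y' assume "(x', y') \<in> \<Union> C"
      then obtain Y where Y: "Y \<in> C" "(x', y') \<in> Y" by (elim UnionE)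
      obtain Z where Z: "Z \<in> C" "(x, y) \<in> Z" "(x', y') \<in> Z"
        using ch[OF X(1) Y(1)] subsetD[of X Y] subsetD[of Y X] X Y by metis
      then show "(x \<oplus>\<^bsub>B\<^esub> x', y \<oplus>\<^bsub>D\<^esub> y') \<in> \<Union> C" using g[OF Z(1)] unfolding good_def by blast
    next
      fix y assume "(\<zero>\<^bsub>B\<^esub>, y) \<in> \<Union> C"
      then show "y = \<zero>\<^bsub>D\<^esub>" using g unfolding good_def by blast
    qed
    then show "\<Union> C \<in> P" using C(1) CP by (auto simp: P_def)
  qed
  then obtain G where G: "G \<in> P" "\<forall>X\<in>P. G \<subseteq> X \<longrightarrow> X = G" by (elim bexE)
  have GP: "good G" "G0 \<subseteq> G" using G(1) unfolding P_def by simp_all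
  have Gmax: "X = G" if "good X" "G \<subseteq> X" for X
  proof -
    have "X \<in> P" using that subset_trans[OF GP(2)] by (simp add: P_def)
    then show ?thesis using G(2) that(2) by simp
  qed
  have Gcar: "x \<in> carrier B" "y \<in> carrier D" if "(x, y) \<in> G" for x y using GP(1) that by (auto simp: good_def)
  have Gadd: "(x \<oplus>\<^bsub>B\<^esub> x', y \<oplus>\<^bsub>D\<^esub> y') \<in> G" if "(x, y) \<in> G" "(x', y') \<in> G" for x y x' y'
    using GP(1) that unfolding good_def by blast
  have Gneg: "(\<ominus>\<^bsub>B\<^esub> x, \<ominus>\<^bsub>D\<^esub> y) \<in> G" if "(x, y) \<in> G" for x y using GP(1) that unfolding good_def by blast
  have Gz: "y = \<zero>\<^bsub>D\<^esub>" if "(\<zero>\<^bsub>B\<^esub>, y) \<in> G" for y using GP(1) that unfolding good_def by blast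
  have G0: "(\<zero>\<^bsub>B\<^esub>, \<zero>\<^bsub>D\<^esub>) \<in> G" using GP(2) A0 \<phi>0 by (force simp: G0_def)
  have Gmult_nat: "(add_pow B (int n) x, add_pow D (int n) y) \<in> G" if xy: "(x, y) \<in> G" for x y n
  proof (induct n)
    case 0
    then show ?case using G0 by (simp add: B.zmult_0 D.zmult_0)
  next
    case (Suc n)
    show ?case using Gadd[OF Suc xy] unfolding B.zmult_Suc[OF Gcar(1)[OF xy]] D.zmult_Suc[OF Gcar(2)[OF xy]] .
  qed
  have Gmult: "(add_pow B n x, add_pow D n y) \<in> G" if xy: "(x, y) \<in> G" for x y and n :: int
  proof (cases "n \<ge> 0")
    case True
    then show ?thesis using Gmult_nat[OF xy, of "nat n"] by simp
  next
    case False
    then have "n = - int (nat (- n))" by simp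
    then show ?thesis
      using Gneg[OF Gmult_nat[OF xy, of "nat (- n)"]] B.add.int_pow_neg[OF Gcar(1)[OF xy], of "int (nat (- n))"]
        D.add.int_pow_neg[OF Gcar(2)[OF xy], of "int (nat (- n))"] by simp
  qed
  have unique: "y = y'" if "(x, y) \<in> G" "(x, y') \<in> G" for x y y'
  proof -
    have "(x \<oplus>\<^bsub>B\<^esub> \<ominus>\<^bsub>B\<^esub> x, y \<oplus>\<^bsub>D\<^esub> \<ominus>\<^bsub>D\<^esub> y') \<in> G" using Gadd[OF that(1) Gneg[OF that(2)]] .
    then have "y \<oplus>\<^bsub>D\<^esub> \<ominus>\<^bsub>D\<^esub> y' = \<zero>\<^bsub>D\<^esub>" using Gz Gcar[OF that(1)] by (simp add: B.r_neg)
    then show ?thesis using Gcar(2)[OF that(1)] Gcar(2)[OF that(2)]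
      by (metis D.add.inv_closed D.add.inv_equality D.minus_minus)
  qed
  have total: "\<exists>y. (b, y) \<in> G" if b: "b \<in> carrier B" for b
  proof -
    \<comment> \<open>The multiples of \<open>b\<close> in the current domain form a subgroup of the
      integers, and the value \<open>d\<close> at \<open>b\<close> must agree with the map on all of
      them. If the subgroup is zero, \<open>d = 0\<close> will do; otherwise its least positive
      element \<open>k\<close> generates it, and \<open>d\<close> is obtained by dividing the value
      at \<open>k b\<close> by \<open>k\<close>.\<close>
    define K where "K = {n::int. \<exists>y. (add_pow B n b, y) \<in> G}"
    obtain d where d: "d \<in> carrier D" and dK: "\<And>n y. (add_pow B (n::int) b, y) \<in> G \<Longrightarrow> y = add_pow D n d"
    proof (cases "\<exists>n\<in>K. n > 0")
      case False
      have "n = 0" if "n \<in> K" for n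
      proof -
        from that obtain y where "(add_pow B n b, y) \<in> G" by (auto simp: K_def)
        then have "(add_pow B (- n) b, \<ominus>\<^bsub>D\<^esub> y) \<in> G" using Gneg B.add.int_pow_neg[OF b] by simp
        then have "- n \<in> K" by (auto simp: K_def)
        then have "\<not> 0 < - n" "\<not> 0 < n" using False that by blast+
        then show ?thesis by linarith
      qed
      then have "y = add_pow D n \<zero>\<^bsub>D\<^esub>" if "(add_pow B (n::int) b, y) \<in> G" for n y
        using that Gz by (force simp: K_def B.zmult_0 D.zmult_0)
      then show ?thesis using that[of "\<zero>\<^bsub>D\<^esub>"] by blast
    next
      case True
      then obtain n0 where n0: "n0 \<in> K" "n0 > 0" by auto
      define k where "k = (LEAST k. k > 0 \<and> int k \<in> K)"
      have "nat n0 > 0 \<and> int (nat n0) \<in> K" using n0 by simp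
      then have k: "k > 0 \<and> int k \<in> K" unfolding k_def by (rule LeastI)
      have kmin: "k \<le> m" if "m > 0" "int m \<in> K" for m unfolding k_def using that by (intro Least_le) auto
      obtain y0 where y0: "(add_pow B (int k) b, y0) \<in> G" using k by (auto simp: K_def)
      have "\<exists>d\<in>carrier D. add_pow D (int k) d = y0" using D Gcar(2)[OF y0] k unfolding divisible_group_def by auto
      then obtain d where d: "d \<in> carrier D" "add_pow D (int k) d = y0" by auto
      have "y = add_pow D n d" if ny: "(add_pow B (n::int) b, y) \<in> G" for n y
      proof -
        let ?j = "n div int k"
        have 1: "(add_pow B (int k * ?j) b, add_pow D (int k * ?j) d) \<in> G"
          using Gmult[OF y0, of ?j] B.add.int_pow_pow[OF b] D.add.int_pow_pow[OF d(1)] d(2) by metis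
        have "(add_pow B (n + - (int k * ?j)) b, y \<oplus>\<^bsub>D\<^esub> \<ominus>\<^bsub>D\<^esub> (add_pow D (int k * ?j) d)) \<in> G"
          using Gadd[OF ny Gneg[OF 1]] B.add.int_pow_mult[OF b, of n "- (int k * ?j)"] B.add.int_pow_neg[OF b] by metis
        then have "n + - (int k * ?j) \<in> K" by (auto simp: K_def)
        then have m: "n mod int k \<in> K" by (simp add: minus_mult_div_eq_mod)
        have "n mod int k = 0"
        proof (rule ccontr)
          assume ne: "n mod int k \<noteq> 0"
          have bnd: "n mod int k \<ge> 0" "n mod int k < int k" using k by auto
          then have "k \<le> nat (n mod int k)" using ne m by (intro kmin) auto
          then show False using bnd by (simp add: le_nat_iff)
        qed
        then have "int k * ?j = n" by auto
        then show ?thesis using unique[OF ny] 1 by simp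
      qed
      then show ?thesis using that d(1) by blast
    qed
    define G' where "G' = {(x \<oplus>\<^bsub>B\<^esub> add_pow B n b, y \<oplus>\<^bsub>D\<^esub> add_pow D n d) | x y n. (x, y) \<in> G \<and> n \<in> (UNIV :: int set)}"
    have G'I: "(x \<oplus>\<^bsub>B\<^esub> add_pow B n b, y \<oplus>\<^bsub>D\<^esub> add_pow D n d) \<in> G'" if "(x, y) \<in> G" for x y and n :: int
      using that unfolding G'_def by blast
    have "good G'" unfolding good_def
    proof (intro conjI allI impI)
      show "G' \<subseteq> carrier B \<times> carrier D" using Gcar b d by (auto simp: G'_def)
      fix u v assume "(u, v) \<in> G'"
      then obtain x y n where 1: "(x, y) \<in> G" "u = x \<oplus>\<^bsub>B\<^esub> add_pow B (n::int) b" "v = y \<oplus>\<^bsub>D\<^esub> add_pow D n d"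
        by (auto simp: G'_def)
      note c1 = Gcar[OF 1(1)]
      have "\<ominus>\<^bsub>B\<^esub> u = \<ominus>\<^bsub>B\<^esub> x \<oplus>\<^bsub>B\<^esub> add_pow B (- n) b" "\<ominus>\<^bsub>D\<^esub> v = \<ominus>\<^bsub>D\<^esub> y \<oplus>\<^bsub>D\<^esub> add_pow D (- n) d"
        using 1 c1 b d by (simp_all add: B.minus_add D.minus_add B.add.int_pow_neg D.add.int_pow_neg)
      then show "(\<ominus>\<^bsub>B\<^esub> u, \<ominus>\<^bsub>D\<^esub> v) \<in> G'" using G'I[OF Gneg[OF 1(1)], of "- n"] by simp
      fix u' v' assume "(u', v') \<in> G'"
      then obtain x' y' m where 2: "(x', y') \<in> G" "u' = x' \<oplus>\<^bsub>B\<^esub> add_pow B (m::int) b" "v' = y' \<oplus>\<^bsub>D\<^esub> add_pow D m d"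
        by (auto simp: G'_def)
      note c2 = Gcar[OF 2(1)]
      have "u \<oplus>\<^bsub>B\<^esub> u' = (x \<oplus>\<^bsub>B\<^esub> x') \<oplus>\<^bsub>B\<^esub> add_pow B (n + m) b" "v \<oplus>\<^bsub>D\<^esub> v' = (y \<oplus>\<^bsub>D\<^esub> y') \<oplus>\<^bsub>D\<^esub> add_pow D (n + m) d"
        using 1 2 c1 c2 b d by (simp_all add: B.add.int_pow_mult D.add.int_pow_mult B.a_ac D.a_ac)
      then show "(u \<oplus>\<^bsub>B\<^esub> u', v \<oplus>\<^bsub>D\<^esub> v') \<in> G'" using G'I[OF Gadd[OF 1(1) 2(1)], of "n + m"] by simp
    next
      fix v assume "(\<zero>\<^bsub>B\<^esub>, v) \<in> G'"
      then obtain x y n where 1: "(x, y) \<in> G" "\<zero>\<^bsub>B\<^esub> = x \<oplus>\<^bsub>B\<^esub> add_pow B (n::int) b" "v = y \<oplus>\<^bsub>D\<^esub> add_pow D n d"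
        by (auto simp: G'_def)
      note c1 = Gcar[OF 1(1)]
      \<comment> \<open>A relation between \<open>b\<close> and the domain exhibits a multiple of
        \<open>b\<close> in the domain, and there \<open>d\<close> was chosen to agree with the
        map.\<close>
      have "x = \<ominus>\<^bsub>B\<^esub> (add_pow B n b)" using 1(2) c1(1) b by (metis B.add.inv_equality B.zmult_closed)
      then have "x = add_pow B (- n) b" using b B.add.int_pow_neg by simp
      then have "y = add_pow D (- n) d" using 1(1) dK by blast
      then show "v = \<zero>\<^bsub>D\<^esub>" using 1(3) d D.add.int_pow_neg[OF d, of n] by (simp add: D.l_neg)
    qed
    moreover have "G \<subseteq> G'"
    proof
      fix p assume p: "p \<in> G"
      obtain x y where xy: "p = (x, y)" by (cases p)
      show "p \<in> G'" using G'I[of x y 0] p Gcar[of x y] unfolding xy by (simp add: B.zmult_0 D.zmult_0)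
    qed
    ultimately have "G' = G" by (rule Gmax)
    then show ?thesis using G'I[OF G0, of 1] b d by (auto simp: B.zmult_1 D.zmult_1)
  qed
  define \<psi> where "\<psi> x = (SOME y. (x, y) \<in> G)" for x
  have \<psi>: "(x, \<psi> x) \<in> G" if "x \<in> carrier B" for x unfolding \<psi>_def using total[OF that] by (rule someI_ex)
  show ?thesis
  proof (rule that[of \<psi>])
    show "\<psi> x \<in> carrier D" if "x \<in> carrier B" for x using \<psi>[OF that] Gcar by blast
    show "\<psi> (x \<oplus>\<^bsub>B\<^esub> y) = \<psi> x \<oplus>\<^bsub>D\<^esub> \<psi> y" if "x \<in> carrier B" "y \<in> carrier B" for x y
      using unique[OF \<psi> Gadd[OF \<psi> \<psi>]] that by simp
    show "\<psi> x = \<phi> x" if "x \<in> A" for x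
      using unique[OF \<psi>[OF Acar[OF that]]] GP(2) that by (auto simp: G0_def)
  qed
qed

subsection \<open>Embedding an abelian group into a divisible one\<close>

text \<open>The rational vector space with basis the underlying set of \<open>A\<close>. It is
  divisible, and \<open>A\<close> is a quotient of its subgroup of integral combinations.\<close>

definition fin_rat :: "('a, 'b) ring_scheme \<Rightarrow> ('a \<Rightarrow> rat) set" where
  "fin_rat A = {f. finite {a. f a \<noteq> 0} \<and> {a. f a \<noteq> 0} \<subseteq> carrier A}"

definition rat_span :: "('a, 'b) ring_scheme \<Rightarrow> (unit, 'a \<Rightarrow> rat) module" where
  "rat_span A = \<lparr>carrier = fin_rat A, monoid.mult = undefined, one = undefined, zero = (\<lambda>_. 0),
     add = (\<lambda>f g a. f a + g a), smult = undefined\<rparr>"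

text \<open>On integer-valued functions the floor is merely the conversion to \<open>int\<close>,
  and the formula is the additive map that sends the basis element of \<open>a\<close> to
  \<open>a\<close>.\<close>

definition rat_eval :: "('a, 'b) ring_scheme \<Rightarrow> ('a \<Rightarrow> rat) \<Rightarrow> 'a" where
  "rat_eval A f = (\<Oplus>\<^bsub>A\<^esub>a\<in>{a. f a \<noteq> 0}. add_pow A (\<lfloor>f a\<rfloor>) a)"

text \<open>The kernel of this map on integral combinations. Dividing the whole rational space by it
  gives a divisible group in which the classes of integral combinations form a copy of
  \<open>A\<close>.\<close>

definition rat_rel :: "('a, 'b) ring_scheme \<Rightarrow> ('a \<Rightarrow> rat) set" where
  "rat_rel A = {f \<in> fin_rat A. (\<forall>a. f a \<in> \<int>) \<and> rat_eval A f = \<zero>\<^bsub>A\<^esub>}"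

definition divisible_hull :: "('a, 'b) ring_scheme \<Rightarrow> (unit, ('a \<Rightarrow> rat) set) module" where
  "divisible_hull A = quot_module (rat_span A) (rat_rel A)"

lemma rat_span_simps [simp]:
  "carrier (rat_span A) = fin_rat A" "zero (rat_span A) = (\<lambda>_. 0)"
  "add (rat_span A) = (\<lambda>f g a. f a + g a)"
  by (simp_all add: rat_span_def)

lemma fin_rat_comb: "f \<in> fin_rat A \<Longrightarrow> g \<in> fin_rat A \<Longrightarrow> (\<lambda>a. c * f a + d * g a) \<in> fin_rat A"
proof -
  assume fg: "f \<in> fin_rat A" "g \<in> fin_rat A"
  have "{a. c * f a + d * g a \<noteq> 0} \<subseteq> {a. f a \<noteq> 0} \<union> {a. g a \<noteq> 0}" by auto
  then show ?thesis using fg unfolding fin_rat_def by (auto intro: finite_subset)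
qed

lemma rat_span_abelian: "abelian_group (rat_span A)"
proof (rule abelian_groupI)
  fix f assume f: "f \<in> carrier (rat_span A)"
  show "\<exists>g\<in>carrier (rat_span A). g \<oplus>\<^bsub>rat_span A\<^esub> f = \<zero>\<^bsub>rat_span A\<^esub>"
    using f fin_rat_comb[of f A f "-1" 0] by (intro bexI[of _ "\<lambda>a. - f a"]) auto
  fix g assume "g \<in> carrier (rat_span A)"
  then show "f \<oplus>\<^bsub>rat_span A\<^esub> g \<in> carrier (rat_span A)"
    using f fin_rat_comb[of f A g 1 1] by simp
qed (auto simp: fin_rat_def add_ac)

lemma rat_span_neg: "f \<in> fin_rat A \<Longrightarrow> \<ominus>\<^bsub>rat_span A\<^esub> f = (\<lambda>a. - f a)"
proof -
  interpret F: abelian_group "rat_span A" by (rule rat_span_abelian)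
  assume f: "f \<in> fin_rat A"
  then show ?thesis using fin_rat_comb[of f A f "-1" 0]
    by (intro F.add.inv_equality) auto
qed

lemma rat_span_minus: "f \<in> fin_rat A \<Longrightarrow> g \<in> fin_rat A \<Longrightarrow> f \<ominus>\<^bsub>rat_span A\<^esub> g = (\<lambda>a. f a - g a)"
  by (simp add: a_minus_def rat_span_neg)

context abelian_group
begin

lemma rat_eval_superset:
  assumes "f \<in> fin_rat G" "finite S" "{a. f a \<noteq> 0} \<subseteq> S" "S \<subseteq> carrier G"
  shows "rat_eval G f = (\<Oplus>a\<in>S. add_pow G (\<lfloor>f a\<rfloor>) a)"
  unfolding rat_eval_def
  by (rule add.finprod_mono_neutral_cong_left) (use assms in \<open>auto simp: zmult_0\<close>)

lemma rat_eval_add: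
  assumes "f \<in> fin_rat G" "g \<in> fin_rat G" "\<And>a. f a \<in> \<int>" "\<And>a. g a \<in> \<int>"
  shows "rat_eval G (\<lambda>a. f a + g a) = rat_eval G f \<oplus> rat_eval G g"
proof -
  let ?S = "{a. f a \<noteq> 0} \<union> {a. g a \<noteq> 0}"
  have S: "finite ?S" "?S \<subseteq> carrier G" using assms(1,2) by (auto simp: fin_rat_def)
  have fl: "\<lfloor>f a + g a\<rfloor> = \<lfloor>f a\<rfloor> + \<lfloor>g a\<rfloor>" for a
    using assms(3)[of a] by (elim Ints_cases) simp
  have fg: "(\<lambda>a. f a + g a) \<in> fin_rat G" using fin_rat_comb[OF assms(1,2), of 1 1] by simp
  have "rat_eval G (\<lambda>a. f a + g a) = (\<Oplus>a\<in>?S. add_pow G (\<lfloor>f a + g a\<rfloor>) a)"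
    by (rule rat_eval_superset) (use S fg in auto)
  also have "\<dots> = (\<Oplus>a\<in>?S. add_pow G (\<lfloor>f a\<rfloor>) a \<oplus> add_pow G (\<lfloor>g a\<rfloor>) a)"
    using S(2) by (intro add.finprod_cong') (auto simp: fl add.int_pow_mult)
  also have "\<dots> = (\<Oplus>a\<in>?S. add_pow G (\<lfloor>f a\<rfloor>) a) \<oplus> (\<Oplus>a\<in>?S. add_pow G (\<lfloor>g a\<rfloor>) a)"
    using S(2) by (intro finsum_addf) auto
  also have "\<dots> = rat_eval G f \<oplus> rat_eval G g"
    using rat_eval_superset[OF assms(1) S(1) _ S(2)] rat_eval_superset[OF assms(2) S(1) _ S(2)] by simp
  finally show ?thesis .
qed

lemma rat_eval_closed: "f \<in> fin_rat G \<Longrightarrow> rat_eval G f \<in> carrier G"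
  unfolding rat_eval_def fin_rat_def by (intro finsum_closed) auto

lemma rat_eval_zero: "rat_eval G (\<lambda>_. 0) = \<zero>"
  by (simp add: rat_eval_def)

lemma rat_eval_uminus:
  assumes "f \<in> fin_rat G" "\<And>a. f a \<in> \<int>"
  shows "rat_eval G (\<lambda>a. - f a) = \<ominus> rat_eval G f"
proof -
  have n: "(\<lambda>a. - f a) \<in> fin_rat G" using fin_rat_comb[OF assms(1,1), of "-1" 0] by simp
  have "rat_eval G (\<lambda>a. - f a) \<oplus> rat_eval G f = \<zero>"
    using rat_eval_add[OF n assms(1)] assms(2) by (simp add: rat_eval_zero)
  then show ?thesis using rat_eval_closed[OF n] rat_eval_closed[OF assms(1)] by (simp add: add.inv_equality)
qed

lemma rat_rel_quotient: "additive_quotient (rat_span G) (rat_rel G)"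
proof (intro additive_quotient.intro additive_quotient_axioms.intro rat_span_abelian subgroup.intro)
  show "\<one>\<^bsub>add_monoid (rat_span G)\<^esub> \<in> rat_rel G" by (simp add: rat_rel_def fin_rat_def rat_eval_zero)
  fix f g assume fg: "f \<in> rat_rel G" "g \<in> rat_rel G"
  then have c: "f \<in> fin_rat G" "g \<in> fin_rat G" "\<And>a. f a \<in> \<int>" "\<And>a. g a \<in> \<int>" by (auto simp: rat_rel_def)
  show "f \<otimes>\<^bsub>add_monoid (rat_span G)\<^esub> g \<in> rat_rel G"
    using fg rat_eval_add[OF c] fin_rat_comb[OF c(1,2), of 1 1] by (simp add: rat_rel_def)
next
  fix f assume f: "f \<in> rat_rel G"
  then have c: "f \<in> fin_rat G" "\<And>a. f a \<in> \<int>" by (auto simp: rat_rel_def)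
  have "inv\<^bsub>add_monoid (rat_span G)\<^esub> f = (\<lambda>a. - f a)"
    using rat_span_neg[OF c(1)] by (simp add: a_inv_def)
  then show "inv\<^bsub>add_monoid (rat_span G)\<^esub> f \<in> rat_rel G"
    using f rat_eval_uminus[OF c] fin_rat_comb[OF c(1,1), of "-1" 0] by (simp add: rat_rel_def)
qed (auto simp: rat_rel_def)

text \<open>Division by \<open>n\<close> is carried out on the rational coefficients and descends to
  classes.\<close>

lemma divisible_hull: "divisible_group (divisible_hull G)"
proof -
  interpret Q: additive_quotient "rat_span G" "rat_rel G" by (rule rat_rel_quotient)
  let ?D = "divisible_hull G"
  interpret D: abelian_group ?D unfolding divisible_hull_def by (rule Q.abelian_group_quot)
  have mult: "add_pow ?D (int n) (rat_rel G +>\<^bsub>rat_span G\<^esub> f) = rat_rel G +>\<^bsub>rat_span G\<^esub> (\<lambda>a. of_nat n * f a)"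
    if f: "f \<in> fin_rat G" for f n
  proof (induct n)
    case 0
    then show ?case using Q.coset_zero by (simp add: D.zmult_0) (simp add: divisible_hull_def)
  next
    case (Suc n)
    have "rat_rel G +>\<^bsub>rat_span G\<^esub> f \<in> carrier ?D" using Q.coset_in[of f] f by (simp add: divisible_hull_def)
    then have "add_pow ?D (int (Suc n)) (rat_rel G +>\<^bsub>rat_span G\<^esub> f) =
      (rat_rel G +>\<^bsub>rat_span G\<^esub> (\<lambda>a. of_nat n * f a)) \<oplus>\<^bsub>?D\<^esub> (rat_rel G +>\<^bsub>rat_span G\<^esub> f)"
      unfolding Suc[symmetric] by (rule D.zmult_Suc)
    also have "\<dots> = rat_rel G +>\<^bsub>rat_span G\<^esub> ((\<lambda>a. of_nat n * f a) \<oplus>\<^bsub>rat_span G\<^esub> f)"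
      using Q.coset_add[of "\<lambda>a. of_nat n * f a" f] fin_rat_comb[OF f f, of "of_nat n" 0] f
      by (simp add: divisible_hull_def)
    also have "(\<lambda>a. of_nat n * f a) \<oplus>\<^bsub>rat_span G\<^esub> f = (\<lambda>a. of_nat (Suc n) * f a)"
      by (simp add: algebra_simps)
    finally show ?case .
  qed
  show ?thesis unfolding divisible_group_def
  proof (intro conjI ballI allI impI D.abelian_group_axioms)
    fix d and n :: int assume d: "d \<in> carrier ?D" and n: "n > 0"
    then obtain f where f: "f \<in> fin_rat G" "d = rat_rel G +>\<^bsub>rat_span G\<^esub> f"
      by (auto simp: divisible_hull_def elim: Q.coset_cases)
    define g where "g = (\<lambda>a. f a / of_nat (nat n))"
    have g: "g \<in> fin_rat G" using fin_rat_comb[OF f(1) f(1), of "1 / of_nat (nat n)" 0] by (simp add: g_def)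
    have "add_pow ?D (int (nat n)) (rat_rel G +>\<^bsub>rat_span G\<^esub> g) = d"
      unfolding mult[OF g] f(2) using n by (simp add: g_def)
    then have "add_pow ?D n (rat_rel G +>\<^bsub>rat_span G\<^esub> g) = d" using n by simp
    moreover have "rat_rel G +>\<^bsub>rat_span G\<^esub> g \<in> carrier ?D" using Q.coset_in[of g] g by (simp add: divisible_hull_def)
    ultimately show "\<exists>e\<in>carrier ?D. add_pow ?D n e = d" by blast
  qed
qed

text \<open>An element is sent to the class of its basis element. Additivity and injectivity both
  come down to \<open>diff\<close>: integral combinations agree modulo the relations exactly if they
  evaluate to the same element.\<close>

lemma divisible_hull_embedding:
  obtains j where "\<And>a. a \<in> carrier G \<Longrightarrow> j a \<in> carrier (divisible_hull G)"
    "\<And>a b. a \<in> carrier G \<Longrightarrow> b \<in> carrier G \<Longrightarrow> j (a \<oplus> b) = j a \<oplus>\<^bsub>divisible_hull G\<^esub> j b"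
    "inj_on j (carrier G)"
proof -
  interpret Q: additive_quotient "rat_span G" "rat_rel G" by (rule rat_rel_quotient)
  define \<delta> :: "'a \<Rightarrow> 'a \<Rightarrow> rat" where "\<delta> a = (\<lambda>x. if x = a then 1 else 0)" for a
  have \<delta>: "\<delta> a \<in> fin_rat G" "\<And>x. \<delta> a x \<in> \<int>" "rat_eval G (\<delta> a) = a" if "a \<in> carrier G" for a
  proof -
    have s: "{x. \<delta> a x \<noteq> 0} = {a}" by (auto simp: \<delta>_def)
    then show "\<delta> a \<in> fin_rat G" "\<And>x. \<delta> a x \<in> \<int>" using that by (auto simp: fin_rat_def \<delta>_def)
    show "rat_eval G (\<delta> a) = a" unfolding rat_eval_def s using that by (simp add: \<delta>_def zmult_1)
  qed
  define j where "j a = rat_rel G +>\<^bsub>rat_span G\<^esub> \<delta> a" for a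
  have diff: "(\<lambda>x. f x - g x) \<in> rat_rel G \<longleftrightarrow> rat_eval G f = rat_eval G g"
    if fg: "f \<in> fin_rat G" "g \<in> fin_rat G" "\<And>x. f x \<in> \<int>" "\<And>x. g x \<in> \<int>" for f g
  proof -
    have n: "(\<lambda>x. - g x) \<in> fin_rat G" using fin_rat_comb[OF fg(2,2), of "-1" 0] by simp
    have e: "rat_eval G (\<lambda>x. f x - g x) = rat_eval G f \<oplus> \<ominus> rat_eval G g"
      using rat_eval_add[OF fg(1) n] rat_eval_uminus[OF fg(2)] fg by simp
    have "rat_eval G f \<oplus> \<ominus> rat_eval G g = \<zero> \<longleftrightarrow> rat_eval G f = rat_eval G g"
      using rat_eval_closed[OF fg(1)] rat_eval_closed[OF fg(2)]
      by (metis add.inv_closed add.inv_equality minus_minus r_neg)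
    then show ?thesis using fin_rat_comb[OF fg(1,2), of 1 "-1"] fg e by (simp add: rat_rel_def)
  qed
  show ?thesis
  proof (rule that[of j])
    show "j a \<in> carrier (divisible_hull G)" if "a \<in> carrier G" for a
      using Q.coset_in[of "\<delta> a"] \<delta>[OF that] by (simp add: j_def divisible_hull_def)
    show "j (a \<oplus> b) = j a \<oplus>\<^bsub>divisible_hull G\<^esub> j b" if ab: "a \<in> carrier G" "b \<in> carrier G" for a b
    proof -
      have c: "(\<lambda>x. \<delta> a x + \<delta> b x) \<in> fin_rat G"
        using fin_rat_comb[OF \<delta>(1)[OF ab(1)] \<delta>(1)[OF ab(2)], of 1 1] by simp
      have "rat_eval G (\<delta> (a \<oplus> b)) = rat_eval G (\<lambda>x. \<delta> a x + \<delta> b x)"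
        using rat_eval_add[OF \<delta>(1)[OF ab(1)] \<delta>(1)[OF ab(2)]] \<delta>(2,3) ab by simp
      then have "(\<lambda>x. \<delta> (a \<oplus> b) x - (\<delta> a x + \<delta> b x)) \<in> rat_rel G"
        using diff[OF \<delta>(1) c, of "a \<oplus> b"] \<delta>(2) ab by simp
      then have "rat_rel G +>\<^bsub>rat_span G\<^esub> \<delta> (a \<oplus> b) = rat_rel G +>\<^bsub>rat_span G\<^esub> (\<lambda>x. \<delta> a x + \<delta> b x)"
        using Q.coset_eq_iff[of "\<delta> (a \<oplus> b)" "\<lambda>x. \<delta> a x + \<delta> b x"] \<delta>(1)[of "a \<oplus> b"] ab c
        by (simp add: rat_span_minus)
      then show ?thesis using Q.coset_add[of "\<delta> a" "\<delta> b"] \<delta>(1) ab by (simp add: j_def divisible_hull_def)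
    qed
    show "inj_on j (carrier G)"
    proof (rule inj_onI)
      fix a b assume ab: "a \<in> carrier G" "b \<in> carrier G" "j a = j b"
      then have "(\<lambda>x. \<delta> a x - \<delta> b x) \<in> rat_rel G"
        using Q.coset_eq_iff[of "\<delta> a" "\<delta> b"] \<delta>(1) by (simp add: j_def rat_span_minus)
      then show "a = b" using diff[of "\<delta> a" "\<delta> b"] \<delta> ab by simp
    qed
  qed
qed

end

section \<open>Injective modules and injective resolutions\<close>

text \<open>The coinduced module of additive maps from \<open>R\<close> to \<open>D\<close>: a
  scalar acts by multiplication in the argument. Extensionality lets maps that agree on
  \<open>R\<close> be equal as elements.\<close>

definition add_hom_module :: "('r, 'k) ring_scheme \<Rightarrow> ('u, 'd) module \<Rightarrow> ('r, 'r \<Rightarrow> 'd) module" where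
  "add_hom_module R D = \<lparr>carrier = {h \<in> carrier R \<rightarrow>\<^sub>E carrier D.
       \<forall>r\<in>carrier R. \<forall>s\<in>carrier R. h (r \<oplus>\<^bsub>R\<^esub> s) = h r \<oplus>\<^bsub>D\<^esub> h s},
     monoid.mult = undefined, one = undefined, zero = (\<lambda>r\<in>carrier R. \<zero>\<^bsub>D\<^esub>),
     add = (\<lambda>f g. \<lambda>r\<in>carrier R. f r \<oplus>\<^bsub>D\<^esub> g r),
     smult = (\<lambda>c f. \<lambda>r\<in>carrier R. f (r \<otimes>\<^bsub>R\<^esub> c))\<rparr>"

lemma add_hom_module_simps:
  "h \<in> carrier (add_hom_module R D) \<longleftrightarrow> h \<in> carrier R \<rightarrow>\<^sub>E carrier D \<and>
    (\<forall>r\<in>carrier R. \<forall>s\<in>carrier R. h (r \<oplus>\<^bsub>R\<^esub> s) = h r \<oplus>\<^bsub>D\<^esub> h s)"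
  "zero (add_hom_module R D) = (\<lambda>r\<in>carrier R. \<zero>\<^bsub>D\<^esub>)"
  "add (add_hom_module R D) f g = (\<lambda>r\<in>carrier R. f r \<oplus>\<^bsub>D\<^esub> g r)"
  "smult (add_hom_module R D) c f = (\<lambda>r\<in>carrier R. f (r \<otimes>\<^bsub>R\<^esub> c))"
  by (simp_all add: add_hom_module_def)

context cring
begin

lemma add_hom_module:
  assumes "abelian_group (D :: ('u, 'd) module)"
  shows "module R (add_hom_module R D)"
proof (rule moduleI)
  interpret D: abelian_group D by fact
  show "abelian_group (add_hom_module R D)"
  proof (rule abelian_groupI)
    fix f assume f: "f \<in> carrier (add_hom_module R D)"
    define g where "g = (\<lambda>r\<in>carrier R. \<ominus>\<^bsub>D\<^esub> f r)"
    have "g \<in> carrier (add_hom_module R D)"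
      using f by (auto simp: add_hom_module_simps g_def PiE_iff D.minus_add)
    moreover have "g \<oplus>\<^bsub>add_hom_module R D\<^esub> f = \<zero>\<^bsub>add_hom_module R D\<^esub>"
      using f by (auto simp: add_hom_module_simps g_def PiE_iff D.l_neg intro!: restrict_ext)
    ultimately show "\<exists>g\<in>carrier (add_hom_module R D). g \<oplus>\<^bsub>add_hom_module R D\<^esub> f = \<zero>\<^bsub>add_hom_module R D\<^esub>"
      by blast
  next
    fix f g assume "f \<in> carrier (add_hom_module R D)" "g \<in> carrier (add_hom_module R D)"
    then show "f \<oplus>\<^bsub>add_hom_module R D\<^esub> g \<in> carrier (add_hom_module R D)"
      by (auto simp: add_hom_module_simps PiE_iff D.a_ac)
  next
    fix f g h assume "f \<in> carrier (add_hom_module R D)" "g \<in> carrier (add_hom_module R D)"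
      "h \<in> carrier (add_hom_module R D)"
    then show "(f \<oplus>\<^bsub>add_hom_module R D\<^esub> g) \<oplus>\<^bsub>add_hom_module R D\<^esub> h =
       f \<oplus>\<^bsub>add_hom_module R D\<^esub> (g \<oplus>\<^bsub>add_hom_module R D\<^esub> h)"
      by (auto simp: add_hom_module_simps PiE_iff D.a_ac intro!: restrict_ext)
  next
    fix f g assume "f \<in> carrier (add_hom_module R D)" "g \<in> carrier (add_hom_module R D)"
    then show "f \<oplus>\<^bsub>add_hom_module R D\<^esub> g = g \<oplus>\<^bsub>add_hom_module R D\<^esub> f"
      by (auto simp: add_hom_module_simps PiE_iff D.a_ac intro!: restrict_ext)
  next
    fix f assume "f \<in> carrier (add_hom_module R D)"
    then show "\<zero>\<^bsub>add_hom_module R D\<^esub> \<oplus>\<^bsub>add_hom_module R D\<^esub> f = f"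
      by (auto simp: add_hom_module_simps PiE_iff extensional_def)
  qed (auto simp: add_hom_module_simps)
  show "cring R" by (rule is_cring)
  fix a f assume a: "a \<in> carrier R" and f: "f \<in> carrier (add_hom_module R D)"
  show "a \<odot>\<^bsub>add_hom_module R D\<^esub> f \<in> carrier (add_hom_module R D)"
    using a f by (auto simp: add_hom_module_simps PiE_iff l_distr)
  fix b assume b: "b \<in> carrier R"
  show "(a \<oplus> b) \<odot>\<^bsub>add_hom_module R D\<^esub> f =
    a \<odot>\<^bsub>add_hom_module R D\<^esub> f \<oplus>\<^bsub>add_hom_module R D\<^esub> b \<odot>\<^bsub>add_hom_module R D\<^esub> f"
    using a b f by (auto simp: add_hom_module_simps PiE_iff r_distr intro!: restrict_ext)
  show "(a \<otimes> b) \<odot>\<^bsub>add_hom_module R D\<^esub> f = a \<odot>\<^bsub>add_hom_module R D\<^esub> (b \<odot>\<^bsub>add_hom_module R D\<^esub> f)"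
    using a b f by (auto simp: add_hom_module_simps PiE_iff m_assoc intro!: restrict_ext)
next
  fix f assume "f \<in> carrier (add_hom_module R D)"
  then show "\<one> \<odot>\<^bsub>add_hom_module R D\<^esub> f = f"
    by (auto simp: add_hom_module_simps PiE_iff extensional_def)
next
  fix a f g assume "a \<in> carrier R" "f \<in> carrier (add_hom_module R D)" "g \<in> carrier (add_hom_module R D)"
  then show "a \<odot>\<^bsub>add_hom_module R D\<^esub> (f \<oplus>\<^bsub>add_hom_module R D\<^esub> g) =
    a \<odot>\<^bsub>add_hom_module R D\<^esub> f \<oplus>\<^bsub>add_hom_module R D\<^esub> a \<odot>\<^bsub>add_hom_module R D\<^esub> g"
    by (auto simp: add_hom_module_simps PiE_iff intro!: restrict_ext)
qed

text \<open>A linear map into \<open>Hom(R, D)\<close> is determined by its composition with evaluation at \<open>1\<close>,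
  so extending it amounts to extending an additive map into \<open>D\<close>.\<close>

lemma add_hom_extension:
  fixes D :: "('u, 'd) module" and B :: "('a, 'e) module"
  assumes D: "divisible_group D" and B: "module R B" and A: "submodule A R B"
    and f: "f \<in> mod_hom R (B\<lparr>carrier := A\<rparr>) (add_hom_module R D)"
  obtains g where "g \<in> mod_hom R B (add_hom_module R D)" "\<And>x. x \<in> A \<Longrightarrow> g x = f x"
proof -
  interpret B: rmodule R B using B by (intro rmodule.intro)
  interpret D: abelian_group D using D by (simp add: divisible_group_def)
  note Acl = B.submodule_closed[OF A]
  have fc: "f x \<in> carrier (add_hom_module R D)" if "x \<in> A" for x
    using mod_homD(1)[OF f] that by simp
  have f1: "f x \<one> \<in> carrier D" if "x \<in> A" for x
    using fc[OF that] by (auto simp: add_hom_module_simps)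
  have fadd: "f (x \<oplus>\<^bsub>B\<^esub> y) \<one> = f x \<one> \<oplus>\<^bsub>D\<^esub> f y \<one>" if "x \<in> A" "y \<in> A" for x y
    using mod_homD(2)[OF f] that by (simp add: add_hom_module_simps)
  obtain \<psi> where \<psi>: "\<And>x. x \<in> carrier B \<Longrightarrow> \<psi> x \<in> carrier D"
    "\<And>x y. x \<in> carrier B \<Longrightarrow> y \<in> carrier B \<Longrightarrow> \<psi> (x \<oplus>\<^bsub>B\<^esub> y) = \<psi> x \<oplus>\<^bsub>D\<^esub> \<psi> y"
    "\<And>x. x \<in> A \<Longrightarrow> \<psi> x = f x \<one>"
    using divisible_extension[OF B.M.abelian_group_axioms D B.submodule_subgroup[OF A], of "\<lambda>x. f x \<one>", OF f1 fadd]
    by blast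
  define g where "g x = (\<lambda>r\<in>carrier R. \<psi> (r \<odot>\<^bsub>B\<^esub> x))" for x
  show ?thesis
  proof (rule that[of g])
    show "g \<in> mod_hom R B (add_hom_module R D)"
    proof (rule mod_homI)
      fix x assume x: "x \<in> carrier B"
      then show "g x \<in> carrier (add_hom_module R D)"
        by (auto simp: add_hom_module_simps g_def \<psi> B.smult_l_distr)
      show "g (x \<oplus>\<^bsub>B\<^esub> y) = g x \<oplus>\<^bsub>add_hom_module R D\<^esub> g y" if "y \<in> carrier B" for y
        using x that by (auto simp: add_hom_module_simps g_def \<psi> B.smult_r_distr intro!: restrict_ext)
      show "g (r \<odot>\<^bsub>B\<^esub> x) = r \<odot>\<^bsub>add_hom_module R D\<^esub> g x" if "r \<in> carrier R" for r
        using x that by (auto simp: add_hom_module_simps g_def B.smult_assoc1 intro!: restrict_ext)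
    qed
    fix x assume x: "x \<in> A"
    have "\<psi> (r \<odot>\<^bsub>B\<^esub> x) = f x r" if r: "r \<in> carrier R" for r
    proof -
      have "\<psi> (r \<odot>\<^bsub>B\<^esub> x) = f (r \<odot>\<^bsub>B\<^esub> x) \<one>" using \<psi>(3) Acl(6) r x by simp
      also have "\<dots> = f x r" using mod_homD(3)[OF f, of r x] r x by (simp add: add_hom_module_simps)
      finally show ?thesis .
    qed
    then show "g x = f x" using fc[OF x] unfolding g_def by (auto simp: add_hom_module_simps PiE_iff extensional_def)
  qed
qed

end

section \<open>Injections into the universe type\<close>

lemma ex_inj_fun_univ:
  "\<exists>\<theta> :: ('r \<Rightarrow> ('r, 'm) univ) \<Rightarrow> ('r, 'm) univ. inj \<theta>"
proof -
  let ?X = "UNIV :: ('r \<times> nat) set"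
  have inf: "infinite ?X" by (simp add: finite_prod)
  \<comment> \<open>By currying, functions from \<open>'r\<close> to the universe are functions on
    \<open>'r \<times> 'r \<times> nat\<close>. The factor \<open>nat\<close> makes
    \<open>'r \<times> nat\<close> infinite, so that it absorbs the extra factor
    \<open>'r\<close>.\<close>
  have "(card_of (UNIV :: ('r \<times> 'r \<times> nat) set), card_of ?X) \<in> ordLeq"
  proof -
    have "(card_of (UNIV :: 'r set), card_of ?X) \<in> ordLeq"
      unfolding card_of_ordLeq[symmetric] by (intro exI[of _ "\<lambda>r. (r, 0)"]) (auto simp: inj_on_def)
    then have "(card_of ((UNIV :: 'r set) \<times> ?X), card_of ?X) \<in> ordLeq"
      by (intro card_of_Times_ordLeq_infinite_Field card_of_Card_order)
        (simp_all add: Field_card_of inf card_of_mono1)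
    then show ?thesis by (simp add: UNIV_Times_UNIV)
  qed
  then obtain i :: "'r \<times> 'r \<times> nat \<Rightarrow> 'r \<times> nat" where i: "inj i"
    unfolding card_of_ordLeq[symmetric] by auto
  \<comment> \<open>Reindexing along a left inverse of \<open>i\<close> loses nothing, because this
    left inverse reaches every index triple.\<close>
  define \<theta> :: "('r \<Rightarrow> ('r, 'm) univ) \<Rightarrow> ('r, 'm) univ" where
    "\<theta> g = (\<lambda>z. g (fst (inv_into UNIV i z)) (snd (inv_into UNIV i z)))" for g
  have "inj \<theta>"
  proof (rule injI)
    fix g h assume "\<theta> g = \<theta> h"
    then have "\<theta> g (i (r, z)) = \<theta> h (i (r, z))" for r z by simp
    then show "g = h" by (simp add: \<theta>_def i fun_eq_iff)
  qed
  then show ?thesis by blast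
qed

text \<open>A sequence of functions is merged into a single one by decoding the \<open>nat\<close>
  component of the index as a pair.\<close>

lemma ex_inj_nat_univ:
  "\<exists>\<theta> :: (nat \<Rightarrow> ('r, 'm) univ) \<Rightarrow> ('r, 'm) univ. inj \<theta>"
proof -
  define \<theta> :: "(nat \<Rightarrow> ('r, 'm) univ) \<Rightarrow> ('r, 'm) univ" where
    "\<theta> g = (\<lambda>(r, n). g (fst (prod_decode n)) (r, snd (prod_decode n)))" for g
  have "inj \<theta>"
  proof (rule injI)
    fix g h assume "\<theta> g = \<theta> h"
    then have "\<theta> g (r, prod_encode (k, n)) = \<theta> h (r, prod_encode (k, n))" for r k n by simp
    then show "g = h" by (simp add: \<theta>_def fun_eq_iff)
  qed
  then show ?thesis by blast
qed

lemma ex_inj_self_univ: "\<exists>\<theta> :: 'r \<Rightarrow> ('r, 'm) univ. inj \<theta>"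
proof -
  define \<theta> :: "'r \<Rightarrow> ('r, 'm) univ" where "\<theta> r = (\<lambda>(s, n). (undefined, if s = r then 1 else 0))" for r
  have "inj \<theta>"
  proof (rule injI)
    fix r s assume "\<theta> r = \<theta> s"
    then have "\<theta> r (r, 0) = \<theta> s (r, 0)" by simp
    then show "r = s" by (simp add: \<theta>_def split: if_splits)
  qed
  then show ?thesis by blast
qed

text \<open>A finitely supported function amounts to a finite list of points with their values, and
  such a list is coded as a sequence whose entry 0 holds the length. The order of the list is an
  arbitrary choice, so in the end only the sets of entries are compared.\<close>

lemma ex_inj_fin_rat:
  fixes Q :: "('q, 'l) ring_scheme" and \<iota> :: "'q \<Rightarrow> ('r, 'm) univ"
  assumes "inj_on \<iota> (carrier Q)"
  shows "\<exists>\<theta> :: ('q \<Rightarrow> rat) \<Rightarrow> ('r, 'm) univ. inj_on \<theta> (fin_rat Q)"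
proof -
  obtain N :: "(nat \<Rightarrow> ('r, 'm) univ) \<Rightarrow> ('r, 'm) univ" where N: "inj N" using ex_inj_nat_univ by blast
  define code :: "nat \<Rightarrow> ('r, 'm) univ" where "code k = (\<lambda>_. (undefined, k))" for k
  have code: "code k = code l \<longleftrightarrow> k = l" for k l by (auto simp: code_def fun_eq_iff)
  define supp where "supp f = (SOME xs. set xs = {a. f a \<noteq> (0::rat)})" for f :: "'q \<Rightarrow> rat"
  have supp: "set (supp f) = {a. f a \<noteq> 0}" if "f \<in> fin_rat Q" for f
  proof -
    have "finite {a. f a \<noteq> 0}" using that by (simp add: fin_rat_def)
    then obtain xs where "set xs = {a. f a \<noteq> 0}" using finite_list by blast
    then show ?thesis unfolding supp_def by (rule someI)
  qed
  define enc where "enc p = N (\<lambda>i. if i = 0 then fst p else code (snd p))" for p :: "('r, 'm) univ \<times> nat"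
  have enc: "enc p = enc q \<longleftrightarrow> p = q" for p q
  proof
    assume "enc p = enc q"
    then have *: "(\<lambda>i::nat. if i = 0 then fst p else code (snd p)) = (\<lambda>i. if i = 0 then fst q else code (snd q))"
      unfolding enc_def by (rule injD[OF N])
    from fun_cong[OF *, of 0] fun_cong[OF *, of 1] show "p = q" by (simp add: code prod_eq_iff)
  qed auto
  define lst where "lst f = map (\<lambda>a. enc (\<iota> a, to_nat (f a))) (supp f)" for f :: "'q \<Rightarrow> rat"
  define \<theta> where "\<theta> f = N (\<lambda>i. if i = 0 then code (length (lst f)) else lst f ! (i - 1))" for f
  have "inj_on \<theta> (fin_rat Q)"
  proof (rule inj_onI)
    fix f g assume f: "f \<in> fin_rat Q" and g: "g \<in> fin_rat Q" and eq: "\<theta> f = \<theta> g"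
    from eq have *: "(\<lambda>i. if i = 0 then code (length (lst f)) else lst f ! (i - 1)) =
       (\<lambda>i. if i = 0 then code (length (lst g)) else lst g ! (i - 1))"
      unfolding \<theta>_def by (rule injD[OF N])
    have len: "length (lst f) = length (lst g)" using fun_cong[OF *, of 0] by (simp add: code)
    have "lst f ! i = lst g ! i" for i using fun_cong[OF *, of "Suc i"] by simp
    then have "lst f = lst g" using len by (intro nth_equalityI) auto
    then have "set (lst f) = set (lst g)" by simp
    then have s: "(\<lambda>a. enc (\<iota> a, to_nat (f a))) ` {a. f a \<noteq> 0} = (\<lambda>a. enc (\<iota> a, to_nat (g a))) ` {a. g a \<noteq> 0}"
      by (simp add: lst_def supp[OF f] supp[OF g])
    \<comment> \<open>One inclusion between the sets of entries settles all points at which the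
      first function is nonzero; used in both directions, it leaves only points at which both
      functions vanish.\<close>
    have half: "f' a = g' a"
      if sub: "(\<lambda>a. enc (\<iota> a, to_nat (f' a))) ` {a. f' a \<noteq> 0} \<subseteq> (\<lambda>a. enc (\<iota> a, to_nat (g' a))) ` {a. g' a \<noteq> 0}"
        and nz: "f' a \<noteq> 0" and fr: "f' \<in> fin_rat Q" "g' \<in> fin_rat Q" for f' g' :: "'q \<Rightarrow> rat" and a
    proof -
      obtain b where b: "g' b \<noteq> 0" "enc (\<iota> a, to_nat (f' a)) = enc (\<iota> b, to_nat (g' b))" using sub nz by blast
      then have "\<iota> a = \<iota> b" "f' a = g' b" by (auto simp: enc)
      moreover have "a \<in> carrier Q" "b \<in> carrier Q" using nz fr b by (auto simp: fin_rat_def)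
      ultimately show ?thesis using assms by (auto dest: inj_onD)
    qed
    show "f = g"
    proof
      fix a show "f a = g a"
        using half[OF equalityD1[OF s] _ f g] half[OF equalityD2[OF s] _ g f] by metis
    qed
  qed
  then show ?thesis by blast
qed

text \<open>Choosing representatives sends a partition back into the type that it partitions, so
  that forming quotients does not enlarge the types.\<close>

lemma inj_on_some_rep:
  assumes "\<And>X. X \<in> A \<Longrightarrow> X \<noteq> {}" "\<And>X Y. X \<in> A \<Longrightarrow> Y \<in> A \<Longrightarrow> X \<inter> Y \<noteq> {} \<Longrightarrow> X = Y"
  shows "inj_on (\<lambda>X. SOME x. x \<in> X) A"
proof (rule inj_onI)
  fix X Y assume XY: "X \<in> A" "Y \<in> A" "(SOME x. x \<in> X) = (SOME x. x \<in> Y)"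
  have "(SOME x. x \<in> X) \<in> X" "(SOME x. x \<in> Y) \<in> Y"
    using assms(1)[OF XY(1)] assms(1)[OF XY(2)] by (simp_all only: some_in_eq not_False_eq_True)
  then have "X \<inter> Y \<noteq> {}" using XY(3) by auto
  then show "X = Y" using assms(2) XY by blast
qed

lemma (in additive_quotient) inj_on_coset_rep: "inj_on (\<lambda>X. SOME x. x \<in> X) (a_rcosets\<^bsub>G\<^esub> N)"
proof (rule inj_on_some_rep)
  fix X assume "X \<in> a_rcosets\<^bsub>G\<^esub> N"
  then show "X \<noteq> {}" using N.a_rcos_self by (auto elim!: coset_cases)
next
  fix X Y assume "X \<in> a_rcosets\<^bsub>G\<^esub> N" "Y \<in> a_rcosets\<^bsub>G\<^esub> N" "X \<inter> Y \<noteq> {}"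
  then obtain x y z where z: "x \<in> carrier G" "X = N +>\<^bsub>G\<^esub> x" "y \<in> carrier G" "Y = N +>\<^bsub>G\<^esub> y" "z \<in> X" "z \<in> Y"
    by (auto elim!: coset_cases)
  then show "X = Y" using G.a_repr_independence[OF _ _ subgroup, of z x] G.a_repr_independence[OF _ _ subgroup, of z y] by auto
qed

text \<open>The extension property of \<open>E\<close> is required for test modules in the target
  type \<open>'e\<close>, although \<open>E\<close> lives in another type: this is the type in which
  injectivity of the copy is tested.\<close>

lemma injective_transport:
  fixes E :: "('r, 'd) module" and \<theta> :: "'d \<Rightarrow> 'e"
  assumes R: "module R E" and inj: "inj_on \<theta> (carrier E)"
    and ext: "\<And>(B :: ('r, 'e) module) A f. module R B \<Longrightarrow> submodule A R B \<Longrightarrow> f \<in> mod_hom R (B\<lparr>carrier := A\<rparr>) E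
      \<Longrightarrow> \<exists>g\<in>mod_hom R B E. \<forall>x\<in>A. g x = f x"
  shows "injective_module R (transport_module \<theta> E)"
proof -
  interpret E: rmodule R E using R by (intro rmodule.intro)
  show ?thesis unfolding injective_module_def
  proof (intro conjI allI impI ballI E.transport_module[OF inj])
    fix B :: "('r, 'e) module" and A f
    assume B: "module R B" and A: "submodule A R B" and f: "f \<in> mod_hom R (B\<lparr>carrier := A\<rparr>) (transport_module \<theta> E)"
    from ext[OF B A mod_hom_comp[OF f E.transport_inv_hom[OF inj]]]
    obtain g where g: "g \<in> mod_hom R B E" "\<And>x. x \<in> A \<Longrightarrow> g x = inv_into (carrier E) \<theta> (f x)" by auto
    have "f x \<in> \<theta> ` carrier E" if "x \<in> A" for x using mod_homD(1)[OF f] that by (simp add: E.transport_simps[OF inj])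
    then have "\<theta> (g x) = f x" if "x \<in> A" for x using g(2)[OF that] that by (simp add: f_inv_into_f)
    then show "\<exists>g\<in>mod_hom R B (transport_module \<theta> E). \<forall>x\<in>A. g x = f x"
      using mod_hom_comp[OF g(1) E.transport_hom[OF inj]] by (intro bexI[of _ "\<lambda>x. \<theta> (g x)"]) auto
  qed
qed

text \<open>With \<open>i\<close> an additive embedding of \<open>Q\<close> into a divisible group,
  \<open>q\<close> is sent to the map taking \<open>r\<close> to \<open>i (r q)\<close>; its value
  at \<open>1\<close> is \<open>i q\<close>, so nothing is lost. The remaining work is counting: an
  injection of \<open>Q\<close> into the universe yields one for finitely supported functions on
  \<open>Q\<close>, for their classes by representatives, and for functions from \<open>R\<close> to
  these classes.\<close>

lemma ex_injective_embedding:
  fixes R :: "('r, 'k) ring_scheme" and Q :: "('r, 'q) module" and \<iota> :: "'q \<Rightarrow> ('r, 'm) univ"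
  assumes Q: "module R Q" and \<iota>: "inj_on \<iota> (carrier Q)"
  obtains E :: "('r, ('r, 'm) univ) module" and j
  where "injective_module R E" "j \<in> mod_hom R Q E" "inj_on j (carrier Q)"
proof -
  interpret Q: rmodule R Q using Q by (intro rmodule.intro)
  let ?D = "divisible_hull Q"
  have D: "divisible_group ?D" by (rule Q.M.divisible_hull)
  then have Dab: "abelian_group ?D" by (simp add: divisible_group_def)
  interpret quot: additive_quotient "rat_span Q" "rat_rel Q" by (rule Q.M.rat_rel_quotient)
  let ?H = "add_hom_module R ?D"
  have H: "module R ?H" by (rule Q.R.add_hom_module[OF Dab])
  obtain i where i: "\<And>a. a \<in> carrier Q \<Longrightarrow> i a \<in> carrier ?D"
    "\<And>a b. a \<in> carrier Q \<Longrightarrow> b \<in> carrier Q \<Longrightarrow> i (a \<oplus>\<^bsub>Q\<^esub> b) = i a \<oplus>\<^bsub>?D\<^esub> i b" "inj_on i (carrier Q)"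
    using Q.M.divisible_hull_embedding by blast
  obtain c :: "('q \<Rightarrow> rat) \<Rightarrow> ('r, 'm) univ" where c: "inj_on c (fin_rat Q)" using ex_inj_fin_rat[OF \<iota>] by blast
  define rep where "rep X = (SOME f. f \<in> X)" for X :: "('q \<Rightarrow> rat) set"
  have rep: "inj_on rep (carrier ?D)" unfolding rep_def divisible_hull_def using quot.inj_on_coset_rep by simp
  have "rep X \<in> fin_rat Q" if X: "X \<in> carrier ?D" for X
  proof -
    obtain f where f: "f \<in> fin_rat Q" "X = rat_rel Q +>\<^bsub>rat_span Q\<^esub> f"
      using X by (auto simp: divisible_hull_def elim: quot.coset_cases)
    then have "f \<in> X" using quot.N.a_rcos_self[of f] by simp
    then have "rep X \<in> X" unfolding rep_def by (rule someI[of "\<lambda>f. f \<in> X"])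
    then show ?thesis using f quot.a_r_coset_subset_G[OF quot.N.a_subset, of f] by auto
  qed
  then have cr: "inj_on (c \<circ> rep) (carrier ?D)" by (intro comp_inj_on rep inj_on_subset[OF c]) auto
  obtain e :: "('r \<Rightarrow> ('r, 'm) univ) \<Rightarrow> ('r, 'm) univ" where e: "inj e" using ex_inj_fun_univ by blast
  define \<theta> where "\<theta> h = e (\<lambda>r. c (rep (h r)))" for h
  have \<theta>: "inj_on \<theta> (carrier ?H)"
  proof (rule inj_onI)
    fix g h assume g: "g \<in> carrier ?H" and h: "h \<in> carrier ?H" and eq: "\<theta> g = \<theta> h"
    from eq have "(\<lambda>r. c (rep (g r))) = (\<lambda>r. c (rep (h r)))" unfolding \<theta>_def by (rule injD[OF e])
    then have "(c \<circ> rep) (g r) = (c \<circ> rep) (h r)" for r by (simp add: fun_eq_iff)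
    then have gh: "g r = h r" if "r \<in> carrier R" for r
      using g h that by (intro inj_onD[OF cr]) (auto simp: add_hom_module_simps)
    show "g = h" using g h gh by (intro extensionalityI[of g "carrier R" h]) (auto simp: add_hom_module_simps PiE_iff)
  qed
  have inj: "injective_module R (transport_module \<theta> ?H)"
  proof (rule injective_transport[OF H \<theta>])
    fix B :: "('r, ('r, 'm) univ) module" and A f
    assume "module R B" "submodule A R B" "f \<in> mod_hom R (B\<lparr>carrier := A\<rparr>) ?H"
    then show "\<exists>g\<in>mod_hom R B ?H. \<forall>x\<in>A. g x = f x"
      by (elim Q.R.add_hom_extension[OF D]) blast+
  qed
  interpret H: rmodule R ?H using H by (intro rmodule.intro)
  define j where "j q = (\<lambda>r\<in>carrier R. i (r \<odot>\<^bsub>Q\<^esub> q))" for q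
  have j: "j \<in> mod_hom R Q ?H"
  proof (rule mod_homI)
    fix x assume x: "x \<in> carrier Q"
    then show "j x \<in> carrier ?H" by (auto simp: add_hom_module_simps j_def i Q.smult_l_distr)
    show "j (x \<oplus>\<^bsub>Q\<^esub> y) = j x \<oplus>\<^bsub>?H\<^esub> j y" if "y \<in> carrier Q" for y
      using x that by (auto simp: add_hom_module_simps j_def i Q.smult_r_distr intro!: restrict_ext)
    show "j (r \<odot>\<^bsub>Q\<^esub> x) = r \<odot>\<^bsub>?H\<^esub> j x" if "r \<in> carrier R" for r
      using x that by (auto simp: add_hom_module_simps j_def Q.smult_assoc1 intro!: restrict_ext)
  qed
  have "inj_on j (carrier Q)"
  proof (rule inj_onI)
    fix x y assume xy: "x \<in> carrier Q" "y \<in> carrier Q" "j x = j y"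
    then have "j x \<one>\<^bsub>R\<^esub> = j y \<one>\<^bsub>R\<^esub>" by simp
    then show "x = y" using xy i(3) by (simp add: j_def inj_on_eq_iff)
  qed
  then have "inj_on (\<theta> \<circ> j) (carrier Q)"
    using mod_homD(1)[OF j] by (intro comp_inj_on inj_on_subset[OF \<theta>]) auto
  then show ?thesis using that[OF inj mod_hom_comp[OF j H.transport_hom[OF \<theta>]]] by (simp add: comp_def)
qed

text \<open>The quotient of \<open>E\<close> by \<open>N\<close> is embedded into an injective
  module, and the composite with the projection has kernel \<open>N\<close>. Coset representatives
  inject the quotient back into the universe.\<close>

lemma ex_injective_step:
  fixes R :: "('r, 'k) ring_scheme" and E :: "('r, ('r, 'm) univ) module"
  assumes E: "module R E" and N: "submodule N R E"
  shows "\<exists>(E' :: ('r, ('r, 'm) univ) module) d. injective_module R E' \<and> d \<in> mod_hom R E E' \<and> a_kernel E E' d = N"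
proof -
  interpret E: module_quotient R E N
    using assms by (intro module_quotient.intro rmodule.intro module_quotient_axioms.intro)
  obtain E' :: "('r, ('r, 'm) univ) module" and j where j: "injective_module R E'"
    "j \<in> mod_hom R (quot_module E N) E'" "inj_on j (carrier (quot_module E N))"
    using ex_injective_embedding[OF E.module_quot, of "\<lambda>X. SOME x. x \<in> X"] E.inj_on_coset_rep by auto
  have E': "module R E'" using j(1) by (simp add: injective_module_def)
  define d where "d x = j (N +>\<^bsub>E\<^esub> x)" for x
  have "(\<lambda>x. N +>\<^bsub>E\<^esub> x) \<in> mod_hom R E (quot_module E N)"
    by (rule mod_homI) (auto simp: E.coset_in E.coset_add E.coset_smult)
  then have d: "d \<in> mod_hom R E E'" unfolding d_def by (rule mod_hom_comp) (rule j(2))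
  have iff: "d x = \<zero>\<^bsub>E'\<^esub> \<longleftrightarrow> x \<in> N" if x: "x \<in> carrier E" for x
  proof -
    have z: "j N = \<zero>\<^bsub>E'\<^esub>" using mod_hom_zero[OF j(2) E.module_quot E'] by simp
    have "N +>\<^bsub>E\<^esub> x \<in> carrier (quot_module E N)" "N \<in> carrier (quot_module E N)"
      using E.coset_in[OF x] E.coset_in[of "\<zero>\<^bsub>E\<^esub>"] by (simp_all add: E.coset_zero)
    then have "d x = j N \<longleftrightarrow> N +>\<^bsub>E\<^esub> x = N" unfolding d_def using j(3) by (auto dest: inj_onD)
    then show ?thesis using z E.coset_eq_iff_zero[OF x] by simp
  qed
  have "a_kernel E E' d = N" using iff E.submodule_closed(1)[OF N] by (auto simp: a_kernel_def')
  then show ?thesis using j(1) d by blast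
qed

text \<open>Dependent choice over pairs of an injective module and a submodule of it, the image of
  the previous map. Keeping the image in the state allows the next map to be chosen with that
  submodule as kernel, which is exactness.\<close>

theorem ex_injective_resolution:
  fixes R :: "('r, 'k) ring_scheme" and M :: "('r, 'm) module"
  assumes M: "module R M"
  shows "\<exists>(E :: nat \<Rightarrow> ('r, ('r, 'm) univ) module) d \<epsilon>. injective_resolution R M \<epsilon> E d"
proof -
  have "inj_on (\<lambda>x _. (x, 0)) (carrier M)" by (auto simp: inj_on_def fun_eq_iff)
  from ex_injective_embedding[OF M this]
  obtain E0 :: "('r, ('r, 'm) univ) module" and \<epsilon> where \<epsilon>: "injective_module R E0" "\<epsilon> \<in> mod_hom R M E0"
    "inj_on \<epsilon> (carrier M)" by blast
  have mod: "module R E" if "injective_module R E" for E :: "('r, ('r, 'm) univ) module"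
    using that by (simp add: injective_module_def)
  define P :: "nat \<Rightarrow> ('r, ('r, 'm) univ) module \<times> ('r, 'm) univ set \<Rightarrow> bool" where
    "P n s \<longleftrightarrow> injective_module R (fst s) \<and> submodule (snd s) R (fst s) \<and> (n = 0 \<longrightarrow> s = (E0, \<epsilon> ` carrier M))" for n s
  define Q :: "nat \<Rightarrow> ('r, ('r, 'm) univ) module \<times> ('r, 'm) univ set \<Rightarrow> ('r, ('r, 'm) univ) module \<times> ('r, 'm) univ set \<Rightarrow> bool" where
    "Q n s s' \<longleftrightarrow> (\<exists>d. d \<in> mod_hom R (fst s) (fst s') \<and> a_kernel (fst s) (fst s') d = snd s \<and> d ` carrier (fst s) = snd s')" for n s s'
  have "\<exists>f. \<forall>n. P n (f n) \<and> Q n (f n) (f (Suc n))"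
  proof (rule dependent_nat_choice)
    have "submodule (\<epsilon> ` carrier M) R E0"
      by (intro mod_hom_image_submodule[OF \<epsilon>(2)] M mod[OF \<epsilon>(1)] module.carrier_is_submodule)
    then show "\<exists>s. P 0 s" using \<epsilon>(1) by (auto simp: P_def)
    fix s n assume "P n s"
    then have s: "injective_module R (fst s)" "submodule (snd s) R (fst s)" by (auto simp: P_def)
    obtain E' :: "('r, ('r, 'm) univ) module" and d where d: "injective_module R E'" "d \<in> mod_hom R (fst s) E'"
      "a_kernel (fst s) E' d = snd s" using ex_injective_step[OF mod[OF s(1)] s(2)] by blast
    have "submodule (d ` carrier (fst s)) R E'"
      by (intro mod_hom_image_submodule[OF d(2)] mod s d module.carrier_is_submodule)
    then have "P (Suc n) (E', d ` carrier (fst s)) \<and> Q n s (E', d ` carrier (fst s))"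
      using d by (auto simp: P_def Q_def)
    then show "\<exists>s'. P (Suc n) s' \<and> Q n s s'" by blast
  qed
  then obtain f where f: "\<And>n. P n (f n)" "\<And>n. Q n (f n) (f (Suc n))" by blast
  define E where "E n = fst (f n)" for n
  have "\<forall>n. \<exists>d. d \<in> mod_hom R (E n) (E (Suc n)) \<and> a_kernel (E n) (E (Suc n)) d = snd (f n) \<and> d ` carrier (E n) = snd (f (Suc n))"
    using f(2) by (simp add: Q_def E_def)
  then obtain d where d: "\<And>n. d n \<in> mod_hom R (E n) (E (Suc n))" "\<And>n. a_kernel (E n) (E (Suc n)) (d n) = snd (f n)"
    "\<And>n. d n ` carrier (E n) = snd (f (Suc n))" by metis
  have f0: "f 0 = (E0, \<epsilon> ` carrier M)" using f(1)[of 0] by (simp add: P_def)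
  have "injective_resolution R M \<epsilon> E d"
    unfolding injective_resolution_def
    using f(1) \<epsilon> d d(2)[of 0] f0 by (auto simp: P_def E_def)
  then show ?thesis by blast
qed

section \<open>Localization\<close>

locale mult_set = cring R for R :: "('r, 'k) ring_scheme" (structure) +
  fixes S
  assumes S_carrier: "S \<subseteq> carrier R" and S_one: "\<one> \<in> S"
    and S_mult: "s \<in> S \<Longrightarrow> t \<in> S \<Longrightarrow> s \<otimes> t \<in> S"
begin

abbreviation "RS \<equiv> loc_ring R S"

lemma S_in [simp, intro]: "s \<in> S \<Longrightarrow> s \<in> carrier R"
  using S_carrier by auto

end

locale loc = rmodule R M + mult_set R S
  for R :: "('r, 'k) ring_scheme" (structure) and M :: "('r, 'm) module" (structure) and S
begin

abbreviation "MS \<equiv> loc_module R S M"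
abbreviation fr where "fr x s \<equiv> fract S M x s"
abbreviation rfr where "rfr r s \<equiv> fract S (self_module R) r s"

lemma smult_cong_mult:
  assumes "a \<odot>\<^bsub>M\<^esub> x = b \<odot>\<^bsub>M\<^esub> y" "a \<in> carrier R" "b \<in> carrier R" "c \<in> carrier R" "x \<in> carrier M" "y \<in> carrier M"
  shows "(c \<otimes> a) \<odot>\<^bsub>M\<^esub> x = (c \<otimes> b) \<odot>\<^bsub>M\<^esub> y"
  using assms by (simp add: smult_assoc1)

lemma fract_mem_iff:
  assumes "x \<in> carrier M" "s \<in> S"
  shows "(y, t) \<in> fr x s \<longleftrightarrow> y \<in> carrier M \<and> t \<in> S \<and> (\<exists>u\<in>S. (u \<otimes> t) \<odot>\<^bsub>M\<^esub> x = (u \<otimes> s) \<odot>\<^bsub>M\<^esub> y)"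
  using assms by (auto simp: fract_def smult_assoc1)

text \<open>This is the transitivity that makes fractions equivalence classes: from the two
  relations for \<open>x\<close> the element \<open>x\<close> is eliminated, at the price of the
  witness \<open>u \<otimes> v \<otimes> s\<close>. The hypotheses are symmetric, so one inclusion
  suffices.\<close>

lemma fract_eqI:
  assumes xy: "x \<in> carrier M" "y \<in> carrier M" "s \<in> S" "t \<in> S" "u \<in> S"
    and eq: "(u \<otimes> t) \<odot>\<^bsub>M\<^esub> x = (u \<otimes> s) \<odot>\<^bsub>M\<^esub> y"
  shows "fr x s = fr y t"
proof -
  have sub: "fr x s \<subseteq> fr y t"
    if xy: "x \<in> carrier M" "y \<in> carrier M" "s \<in> S" "t \<in> S" "u \<in> S"
      and eq: "(u \<otimes> t) \<odot>\<^bsub>M\<^esub> x = (u \<otimes> s) \<odot>\<^bsub>M\<^esub> y" for x y s t u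
  proof
    fix p assume p: "p \<in> fr x s"
    obtain z w where zw: "p = (z, w)" by (cases p)
    obtain v where v: "z \<in> carrier M" "w \<in> S" "v \<in> S" "(v \<otimes> w) \<odot>\<^bsub>M\<^esub> x = (v \<otimes> s) \<odot>\<^bsub>M\<^esub> z"
      using p xy unfolding zw fract_mem_iff[OF xy(1,3)] by auto
    have S: "u \<in> carrier R" "v \<in> carrier R" "w \<in> carrier R" "s \<in> carrier R" "t \<in> carrier R" using xy v by auto
    have 1: "((v \<otimes> w) \<otimes> (u \<otimes> t)) \<odot>\<^bsub>M\<^esub> x = ((v \<otimes> w) \<otimes> (u \<otimes> s)) \<odot>\<^bsub>M\<^esub> y"
      by (rule smult_cong_mult) (use eq xy v S in auto)
    have 2: "((u \<otimes> t) \<otimes> (v \<otimes> w)) \<odot>\<^bsub>M\<^esub> x = ((u \<otimes> t) \<otimes> (v \<otimes> s)) \<odot>\<^bsub>M\<^esub> z"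
      by (rule smult_cong_mult) (use v xy S in auto)
    have "((u \<otimes> v \<otimes> s) \<otimes> w) \<odot>\<^bsub>M\<^esub> y = ((u \<otimes> v \<otimes> s) \<otimes> t) \<odot>\<^bsub>M\<^esub> z"
      using 1 2 S by (simp add: R.m_ac)
    moreover have "u \<otimes> v \<otimes> s \<in> S" using xy v S_mult by blast
    ultimately show "p \<in> fr y t" unfolding zw fract_mem_iff[OF xy(2,4)] using v by blast
  qed
  show ?thesis using sub[OF xy eq] sub[OF xy(2,1,4,3,5) eq[symmetric]] by blast
qed

lemma fract_eq_iff:
  assumes xy: "x \<in> carrier M" "y \<in> carrier M" "s \<in> S" "t \<in> S"
  shows "fr x s = fr y t \<longleftrightarrow> (\<exists>u\<in>S. (u \<otimes> t) \<odot>\<^bsub>M\<^esub> x = (u \<otimes> s) \<odot>\<^bsub>M\<^esub> y)"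
proof
  assume "fr x s = fr y t"
  moreover have "(y, t) \<in> fr y t" unfolding fract_mem_iff[OF xy(2,4)] using xy S_one by auto
  ultimately show "\<exists>u\<in>S. (u \<otimes> t) \<odot>\<^bsub>M\<^esub> x = (u \<otimes> s) \<odot>\<^bsub>M\<^esub> y"
    using fract_mem_iff[OF xy(1,3)] by simp
qed (use fract_eqI[OF xy] in blast)

lemma fract_self: "x \<in> carrier M \<Longrightarrow> s \<in> S \<Longrightarrow> (x, s) \<in> fr x s"
  using fract_mem_iff[of x s x s] S_one by auto

lemma fract_cancel:
  assumes "x \<in> carrier M" "s \<in> S" "t \<in> S"
  shows "fr (t \<odot>\<^bsub>M\<^esub> x) (t \<otimes> s) = fr x s"
  using assms S_one S_mult by (intro fract_eqI[where u = \<one>]) (auto simp: smult_assoc1[symmetric] R.m_ac)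

lemma fract_zero: "s \<in> S \<Longrightarrow> t \<in> S \<Longrightarrow> fr \<zero>\<^bsub>M\<^esub> s = fr \<zero>\<^bsub>M\<^esub> t"
  using S_one by (intro fract_eqI[where u = \<one>]) auto

text \<open>The union over all representatives collapses, since any two choices yield the same
  fraction: if \<open>u\<close> and \<open>v\<close> witness the changes of representatives of the
  summands, then \<open>u \<otimes> v\<close> witnesses that of the sum.\<close>

lemma frac_add:
  assumes xy: "x \<in> carrier M" "y \<in> carrier M" "s \<in> S" "t \<in> S"
  shows "frac_add R S M (fr x s) (fr y t) = fr (t \<odot>\<^bsub>M\<^esub> x \<oplus>\<^bsub>M\<^esub> s \<odot>\<^bsub>M\<^esub> y) (s \<otimes> t)"
proof -
  have eq: "fr (t' \<odot>\<^bsub>M\<^esub> x' \<oplus>\<^bsub>M\<^esub> s' \<odot>\<^bsub>M\<^esub> y') (s' \<otimes> t') = fr (t \<odot>\<^bsub>M\<^esub> x \<oplus>\<^bsub>M\<^esub> s \<odot>\<^bsub>M\<^esub> y) (s \<otimes> t)"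
    if x': "(x', s') \<in> fr x s" and y': "(y', t') \<in> fr y t" for x' s' y' t'
  proof -
    obtain u where u: "x' \<in> carrier M" "s' \<in> S" "u \<in> S" "(u \<otimes> s') \<odot>\<^bsub>M\<^esub> x = (u \<otimes> s) \<odot>\<^bsub>M\<^esub> x'"
      using x' fract_mem_iff[OF xy(1,3)] by auto
    obtain v where v: "y' \<in> carrier M" "t' \<in> S" "v \<in> S" "(v \<otimes> t') \<odot>\<^bsub>M\<^esub> y = (v \<otimes> t) \<odot>\<^bsub>M\<^esub> y'"
      using y' fract_mem_iff[OF xy(2,4)] by auto
    have S: "u \<in> carrier R" "v \<in> carrier R" "s' \<in> carrier R" "t' \<in> carrier R" "s \<in> carrier R" "t \<in> carrier R"
      using u v xy by auto
    have 1: "((v \<otimes> t \<otimes> t') \<otimes> (u \<otimes> s')) \<odot>\<^bsub>M\<^esub> x = ((v \<otimes> t \<otimes> t') \<otimes> (u \<otimes> s)) \<odot>\<^bsub>M\<^esub> x'"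
      by (rule smult_cong_mult) (use u v xy S in auto)
    have 2: "((u \<otimes> s \<otimes> s') \<otimes> (v \<otimes> t')) \<odot>\<^bsub>M\<^esub> y = ((u \<otimes> s \<otimes> s') \<otimes> (v \<otimes> t)) \<odot>\<^bsub>M\<^esub> y'"
      by (rule smult_cong_mult) (use u v xy S in auto)
    have l: "(u \<otimes> v \<otimes> (s \<otimes> t)) \<odot>\<^bsub>M\<^esub> (t' \<odot>\<^bsub>M\<^esub> x' \<oplus>\<^bsub>M\<^esub> s' \<odot>\<^bsub>M\<^esub> y') =
      ((v \<otimes> t \<otimes> t') \<otimes> (u \<otimes> s)) \<odot>\<^bsub>M\<^esub> x' \<oplus>\<^bsub>M\<^esub> ((u \<otimes> s \<otimes> s') \<otimes> (v \<otimes> t)) \<odot>\<^bsub>M\<^esub> y'"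
      using S u v by (simp add: smult_r_distr smult_assoc1[symmetric] R.m_ac)
    have r: "(u \<otimes> v \<otimes> (s' \<otimes> t')) \<odot>\<^bsub>M\<^esub> (t \<odot>\<^bsub>M\<^esub> x \<oplus>\<^bsub>M\<^esub> s \<odot>\<^bsub>M\<^esub> y) =
      ((v \<otimes> t \<otimes> t') \<otimes> (u \<otimes> s')) \<odot>\<^bsub>M\<^esub> x \<oplus>\<^bsub>M\<^esub> ((u \<otimes> s \<otimes> s') \<otimes> (v \<otimes> t')) \<odot>\<^bsub>M\<^esub> y"
      using S xy by (simp add: smult_r_distr smult_assoc1[symmetric] R.m_ac)
    show ?thesis
      by (rule fract_eqI[where u = "u \<otimes> v"]) (use l r 1 2 u v xy S_mult in auto)
  qed
  show ?thesis unfolding frac_add_def using eq fract_self[OF xy(1,3)] fract_self[OF xy(2,4)] by blast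
qed

lemma frac_smult:
  assumes r: "r \<in> carrier R" "s \<in> S" and x: "x \<in> carrier M" "t \<in> S"
  shows "frac_smult R S M (rfr r s) (fr x t) = fr (r \<odot>\<^bsub>M\<^esub> x) (s \<otimes> t)"
proof -
  interpret SM: loc R "self_module R" S by (intro loc.intro rmodule.intro R.self_module mult_set_axioms)
  have eq: "fr (r' \<odot>\<^bsub>M\<^esub> x') (s' \<otimes> t') = fr (r \<odot>\<^bsub>M\<^esub> x) (s \<otimes> t)"
    if r': "(r', s') \<in> rfr r s" and x': "(x', t') \<in> fr x t" for r' s' x' t'
  proof -
    obtain u where u: "r' \<in> carrier R" "s' \<in> S" "u \<in> S" "(u \<otimes> s') \<otimes> r = (u \<otimes> s) \<otimes> r'"
      using r' SM.fract_mem_iff[of r s] r by auto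
    obtain v where v: "x' \<in> carrier M" "t' \<in> S" "v \<in> S" "(v \<otimes> t') \<odot>\<^bsub>M\<^esub> x = (v \<otimes> t) \<odot>\<^bsub>M\<^esub> x'"
      using x' fract_mem_iff[OF x] by auto
    have S: "u \<in> carrier R" "v \<in> carrier R" "s' \<in> carrier R" "t' \<in> carrier R" "s \<in> carrier R" "t \<in> carrier R"
      using u v r x by auto
    have 1: "(((u \<otimes> s') \<otimes> r) \<otimes> (v \<otimes> t')) \<odot>\<^bsub>M\<^esub> x = (((u \<otimes> s') \<otimes> r) \<otimes> (v \<otimes> t)) \<odot>\<^bsub>M\<^esub> x'"
      by (rule smult_cong_mult) (use u v x r S in auto)
    have "(u \<otimes> v \<otimes> (s \<otimes> t)) \<odot>\<^bsub>M\<^esub> (r' \<odot>\<^bsub>M\<^esub> x') = (((u \<otimes> s) \<otimes> r') \<otimes> (v \<otimes> t)) \<odot>\<^bsub>M\<^esub> x'"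
      using S u v by (simp add: smult_assoc1[symmetric] R.m_ac)
    also have "\<dots> = (((u \<otimes> s') \<otimes> r) \<otimes> (v \<otimes> t')) \<odot>\<^bsub>M\<^esub> x" using 1 u(4) by simp
    also have "\<dots> = (u \<otimes> v \<otimes> (s' \<otimes> t')) \<odot>\<^bsub>M\<^esub> (r \<odot>\<^bsub>M\<^esub> x)"
      using S x r by (simp add: smult_assoc1[symmetric] R.m_ac)
    finally show ?thesis
      by (intro fract_eqI[where u = "u \<otimes> v"]) (use u v x r S_mult in auto)
  qed
  have "(r, s) \<in> rfr r s" using SM.fract_self[of r s] r by simp
  then show ?thesis unfolding frac_smult_def using eq fract_self[OF x] by blast
qed

lemma loc_module_simps:
  "carrier MS = {fr x s |x s. x \<in> carrier M \<and> s \<in> S}"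
  "\<zero>\<^bsub>MS\<^esub> = fr \<zero>\<^bsub>M\<^esub> \<one>"
  "add MS = frac_add R S M"
  "smult MS = frac_smult R S M"
  by (simp_all add: loc_module_def)

lemma frac_in: "x \<in> carrier M \<Longrightarrow> s \<in> S \<Longrightarrow> fr x s \<in> carrier MS"
  by (auto simp: loc_module_simps)

lemma frac_cases:
  assumes "X \<in> carrier MS"
  obtains x s where "x \<in> carrier M" "s \<in> S" "X = fr x s"
  using assms by (auto simp: loc_module_simps)

lemma fract_add: "x \<in> carrier M \<Longrightarrow> y \<in> carrier M \<Longrightarrow> s \<in> S \<Longrightarrow> t \<in> S \<Longrightarrow>
  fr x s \<oplus>\<^bsub>MS\<^esub> fr y t = fr (t \<odot>\<^bsub>M\<^esub> x \<oplus>\<^bsub>M\<^esub> s \<odot>\<^bsub>M\<^esub> y) (s \<otimes> t)"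
  by (simp add: loc_module_simps frac_add)

lemma fract_smult: "r \<in> carrier R \<Longrightarrow> x \<in> carrier M \<Longrightarrow> s \<in> S \<Longrightarrow> t \<in> S \<Longrightarrow>
  rfr r s \<odot>\<^bsub>MS\<^esub> fr x t = fr (r \<odot>\<^bsub>M\<^esub> x) (s \<otimes> t)"
  by (simp add: loc_module_simps frac_smult)

lemma fract_add_same:
  assumes "x \<in> carrier M" "y \<in> carrier M" "s \<in> S"
  shows "fr x s \<oplus>\<^bsub>MS\<^esub> fr y s = fr (x \<oplus>\<^bsub>M\<^esub> y) s"
  using assms fract_cancel[of "x \<oplus>\<^bsub>M\<^esub> y" s s] by (simp add: fract_add smult_r_distr)

lemma loc_module_abelian: "abelian_group MS"
proof (rule abelian_groupI)
  fix X assume "X \<in> carrier MS"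
  then obtain x s where x: "x \<in> carrier M" "s \<in> S" "X = fr x s" by (rule frac_cases)
  show "\<zero>\<^bsub>MS\<^esub> \<oplus>\<^bsub>MS\<^esub> X = X"
    using x S_one by (simp add: loc_module_simps(2) fract_add)
  show "\<exists>Y\<in>carrier MS. Y \<oplus>\<^bsub>MS\<^esub> X = \<zero>\<^bsub>MS\<^esub>"
    using x S_one fract_zero[of s \<one>]
    by (intro bexI[of _ "fr (\<ominus>\<^bsub>M\<^esub> x) s"]) (auto simp: loc_module_simps(2) fract_add_same M.l_neg frac_in)
  fix Y assume "Y \<in> carrier MS"
  then obtain y t where y: "y \<in> carrier M" "t \<in> S" "Y = fr y t" by (rule frac_cases)
  show "X \<oplus>\<^bsub>MS\<^esub> Y \<in> carrier MS"
    using x y S_mult by (auto simp: fract_add intro!: frac_in)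
  show "X \<oplus>\<^bsub>MS\<^esub> Y = Y \<oplus>\<^bsub>MS\<^esub> X"
    using x y by (simp add: fract_add M.a_comm R.m_comm[of s t])
  fix Z assume "Z \<in> carrier MS"
  then obtain z u where z: "z \<in> carrier M" "u \<in> S" "Z = fr z u" by (rule frac_cases)
  show "X \<oplus>\<^bsub>MS\<^esub> Y \<oplus>\<^bsub>MS\<^esub> Z = X \<oplus>\<^bsub>MS\<^esub> (Y \<oplus>\<^bsub>MS\<^esub> Z)"
    using x y z S_mult by (simp add: fract_add smult_r_distr smult_assoc1[symmetric] R.m_ac M.a_ac)
qed (use S_one in \<open>auto simp: loc_module_simps(2) intro!: frac_in\<close>)

end

section \<open>The localized ring and its modules\<close>

lemma (in mult_set) loc_self: "loc R (self_module R) S"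
  by (intro loc.intro rmodule.intro self_module mult_set_axioms)

lemma (in mult_set) loc_ring_simps:
  "carrier RS = carrier (loc_module R S (self_module R))"
  "\<zero>\<^bsub>RS\<^esub> = fract S (self_module R) \<zero> \<one>"
  "\<one>\<^bsub>RS\<^esub> = fract S (self_module R) \<one> \<one>"
  "add RS = add (loc_module R S (self_module R))"
  "monoid.mult RS = smult (loc_module R S (self_module R))"
  by (simp_all add: loc_ring_def loc_module_def)

text \<open>\<open>RS\<close> is built from the fraction operations of \<open>self_module R\<close>,
  so the rules for fractions of modules specialize to its elements.\<close>

sublocale mult_set \<subseteq> SM: loc R "self_module R" S by (rule loc_self)

context mult_set
begin

abbreviation rf where "rf r s \<equiv> fract S (self_module R) r s"

lemma ring_cases:
  assumes "X \<in> carrier RS"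
  obtains x s where "x \<in> carrier R" "s \<in> S" "X = rf x s"
  using assms SM.frac_cases by (auto simp: loc_ring_simps)

lemma rf_in: "r \<in> carrier R \<Longrightarrow> s \<in> S \<Longrightarrow> rf r s \<in> carrier RS"
  using SM.frac_in by (simp add: loc_ring_simps)

lemma rf_add: "x \<in> carrier R \<Longrightarrow> y \<in> carrier R \<Longrightarrow> s \<in> S \<Longrightarrow> t \<in> S \<Longrightarrow>
  rf x s \<oplus>\<^bsub>RS\<^esub> rf y t = rf (t \<otimes> x \<oplus> s \<otimes> y) (s \<otimes> t)"
  using SM.fract_add[of x y s t] by (simp add: loc_ring_simps)

lemma rf_mult: "x \<in> carrier R \<Longrightarrow> y \<in> carrier R \<Longrightarrow> s \<in> S \<Longrightarrow> t \<in> S \<Longrightarrow>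
  rf x s \<otimes>\<^bsub>RS\<^esub> rf y t = rf (x \<otimes> y) (s \<otimes> t)"
  using SM.fract_smult[of x y s t] by (simp add: loc_ring_simps)

lemma rf_cancel: "x \<in> carrier R \<Longrightarrow> s \<in> S \<Longrightarrow> t \<in> S \<Longrightarrow> rf (t \<otimes> x) (t \<otimes> s) = rf x s"
  using SM.fract_cancel[of x s t] by simp

lemma rf_add_same: "x \<in> carrier R \<Longrightarrow> y \<in> carrier R \<Longrightarrow> s \<in> S \<Longrightarrow>
  rf x s \<oplus>\<^bsub>RS\<^esub> rf y s = rf (x \<oplus> y) s"
  using SM.fract_add_same[of x y s] by (simp add: loc_ring_simps)

lemma rf_distr:
  assumes "x \<in> carrier R" "y \<in> carrier R" "z \<in> carrier R" "s \<in> S" "t \<in> S" "u \<in> S"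
  shows "(rf x s \<oplus>\<^bsub>RS\<^esub> rf y t) \<otimes>\<^bsub>RS\<^esub> rf z u =
    rf x s \<otimes>\<^bsub>RS\<^esub> rf z u \<oplus>\<^bsub>RS\<^esub> rf y t \<otimes>\<^bsub>RS\<^esub> rf z u"
proof -
  have "rf x s \<otimes>\<^bsub>RS\<^esub> rf z u \<oplus>\<^bsub>RS\<^esub> rf y t \<otimes>\<^bsub>RS\<^esub> rf z u =
    rf (u \<otimes> ((t \<otimes> x \<oplus> s \<otimes> y) \<otimes> z)) (u \<otimes> (s \<otimes> t \<otimes> u))"
    using assms S_mult by (simp add: rf_add rf_mult l_distr r_distr m_ac)
  also have "\<dots> = rf ((t \<otimes> x \<oplus> s \<otimes> y) \<otimes> z) (s \<otimes> t \<otimes> u)"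
    by (rule rf_cancel) (use assms S_mult in auto)
  finally show ?thesis using assms S_mult by (simp add: rf_add rf_mult)
qed

lemma loc_ring_cring: "cring RS"
proof (rule cringI)
  interpret A: abelian_group "loc_module R S (self_module R)" by (rule SM.loc_module_abelian)
  have zero: "\<zero>\<^bsub>RS\<^esub> = \<zero>\<^bsub>loc_module R S (self_module R)\<^esub>"
    by (simp add: loc_ring_simps SM.loc_module_simps(2))
  show "abelian_group RS"
  proof (rule abelian_groupI)
    fix X assume "X \<in> carrier RS"
    then show "\<exists>Y\<in>carrier RS. Y \<oplus>\<^bsub>RS\<^esub> X = \<zero>\<^bsub>RS\<^esub>"
      unfolding loc_ring_simps(1,4) zero using A.l_neg[of X] A.a_inv_closed[of X] by blast
  qed (auto simp: loc_ring_simps(1,4) zero A.a_ac)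
  show "Group.comm_monoid RS"
  proof (rule comm_monoidI)
    show "\<one>\<^bsub>RS\<^esub> \<in> carrier RS" unfolding loc_ring_simps(3) using S_one by (intro rf_in) auto
    fix X assume "X \<in> carrier RS"
    then obtain x s where x: "x \<in> carrier R" "s \<in> S" "X = rf x s" by (rule ring_cases)
    show "\<one>\<^bsub>RS\<^esub> \<otimes>\<^bsub>RS\<^esub> X = X" unfolding loc_ring_simps(3) using x S_one by (simp add: rf_mult)
    fix Y assume "Y \<in> carrier RS"
    then obtain y t where y: "y \<in> carrier R" "t \<in> S" "Y = rf y t" by (rule ring_cases)
    show "X \<otimes>\<^bsub>RS\<^esub> Y \<in> carrier RS" using x y S_mult by (auto simp: rf_mult intro!: rf_in)
    show "X \<otimes>\<^bsub>RS\<^esub> Y = Y \<otimes>\<^bsub>RS\<^esub> X"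
      using x y by (simp add: rf_mult m_comm[of x y] m_comm[of s t])
    fix Z assume "Z \<in> carrier RS"
    then obtain z u where z: "z \<in> carrier R" "u \<in> S" "Z = rf z u" by (rule ring_cases)
    show "X \<otimes>\<^bsub>RS\<^esub> Y \<otimes>\<^bsub>RS\<^esub> Z = X \<otimes>\<^bsub>RS\<^esub> (Y \<otimes>\<^bsub>RS\<^esub> Z)"
      using x y z S_mult by (simp add: rf_mult m_assoc)
  qed
  fix X Y Z assume "X \<in> carrier RS" "Y \<in> carrier RS" "Z \<in> carrier RS"
  then show "(X \<oplus>\<^bsub>RS\<^esub> Y) \<otimes>\<^bsub>RS\<^esub> Z =
    X \<otimes>\<^bsub>RS\<^esub> Z \<oplus>\<^bsub>RS\<^esub> Y \<otimes>\<^bsub>RS\<^esub> Z"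
    by (elim ring_cases) (simp add: rf_distr)
qed

end

context loc
begin

lemma loc_module: "module RS MS"
proof (rule moduleI)
  show "cring RS" by (rule loc_ring_cring)
  show "abelian_group MS" by (rule loc_module_abelian)
  fix X assume "X \<in> carrier MS"
  then obtain x s where x: "x \<in> carrier M" "s \<in> S" "X = fr x s" by (rule frac_cases)
  show "\<one>\<^bsub>RS\<^esub> \<odot>\<^bsub>MS\<^esub> X = X"
    unfolding loc_ring_simps(3) using x S_one by (simp add: fract_smult)
  fix A assume "A \<in> carrier RS"
  then obtain a t where a: "a \<in> carrier R" "t \<in> S" "A = rf a t" by (rule ring_cases)
  show "A \<odot>\<^bsub>MS\<^esub> X \<in> carrier MS"
    using x a S_mult by (auto simp: fract_smult intro!: frac_in)
  fix B assume "B \<in> carrier RS"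
  then obtain b u where b: "b \<in> carrier R" "u \<in> S" "B = rf b u" by (rule ring_cases)
  show "(A \<otimes>\<^bsub>RS\<^esub> B) \<odot>\<^bsub>MS\<^esub> X = A \<odot>\<^bsub>MS\<^esub> (B \<odot>\<^bsub>MS\<^esub> X)"
    using x a b S_mult by (simp add: rf_mult fract_smult smult_assoc1 R.m_assoc)
  have "A \<odot>\<^bsub>MS\<^esub> X \<oplus>\<^bsub>MS\<^esub> B \<odot>\<^bsub>MS\<^esub> X =
    fr (s \<odot>\<^bsub>M\<^esub> ((u \<otimes> a \<oplus> t \<otimes> b) \<odot>\<^bsub>M\<^esub> x)) (s \<otimes> (t \<otimes> u \<otimes> s))"
    using x a b S_mult by (simp add: fract_smult fract_add smult_l_distr smult_r_distr smult_assoc1[symmetric] R.m_ac)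
  also have "\<dots> = fr ((u \<otimes> a \<oplus> t \<otimes> b) \<odot>\<^bsub>M\<^esub> x) (t \<otimes> u \<otimes> s)"
    by (rule fract_cancel) (use x a b S_mult in auto)
  finally show "(A \<oplus>\<^bsub>RS\<^esub> B) \<odot>\<^bsub>MS\<^esub> X =
    A \<odot>\<^bsub>MS\<^esub> X \<oplus>\<^bsub>MS\<^esub> B \<odot>\<^bsub>MS\<^esub> X"
    using x a b S_mult by (simp add: fract_smult rf_add)
next
  fix A X Y assume AXY: "A \<in> carrier RS" "X \<in> carrier MS" "Y \<in> carrier MS"
  obtain a t where a: "a \<in> carrier R" "t \<in> S" "A = rf a t" using AXY(1) by (rule ring_cases)
  obtain x s where x: "x \<in> carrier M" "s \<in> S" "X = fr x s" using AXY(2) by (rule frac_cases)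
  obtain y u where y: "y \<in> carrier M" "u \<in> S" "Y = fr y u" using AXY(3) by (rule frac_cases)
  have "A \<odot>\<^bsub>MS\<^esub> X \<oplus>\<^bsub>MS\<^esub> A \<odot>\<^bsub>MS\<^esub> Y =
    fr (t \<odot>\<^bsub>M\<^esub> (a \<odot>\<^bsub>M\<^esub> (u \<odot>\<^bsub>M\<^esub> x \<oplus>\<^bsub>M\<^esub> s \<odot>\<^bsub>M\<^esub> y))) (t \<otimes> (t \<otimes> (s \<otimes> u)))"
    using x a y S_mult by (simp add: fract_smult fract_add smult_r_distr smult_assoc1[symmetric] R.m_ac)
  also have "\<dots> = fr (a \<odot>\<^bsub>M\<^esub> (u \<odot>\<^bsub>M\<^esub> x \<oplus>\<^bsub>M\<^esub> s \<odot>\<^bsub>M\<^esub> y)) (t \<otimes> (s \<otimes> u))"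
    by (rule fract_cancel) (use x a y S_mult in auto)
  finally show "A \<odot>\<^bsub>MS\<^esub> (X \<oplus>\<^bsub>MS\<^esub> Y) =
    A \<odot>\<^bsub>MS\<^esub> X \<oplus>\<^bsub>MS\<^esub> A \<odot>\<^bsub>MS\<^esub> Y"
    using x a y S_mult by (simp add: fract_smult fract_add)
qed

lemma fract_eq_zero:
  assumes "x \<in> carrier M" "s \<in> S"
  shows "fr x s = \<zero>\<^bsub>MS\<^esub> \<longleftrightarrow> (\<exists>u\<in>S. u \<odot>\<^bsub>M\<^esub> x = \<zero>\<^bsub>M\<^esub>)"
  unfolding loc_module_simps using assms S_one by (subst fract_eq_iff) auto

text \<open>Denominators act invertibly, so a submodule of \<open>MS\<close> is determined by its
  preimage in \<open>M\<close>, and the images of generators of the preimage generate it.\<close>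

lemma noeth_loc_module:
  assumes "noeth_module R M"
  shows "noeth_module RS MS"
  unfolding noeth_module_def
proof (intro conjI allI impI loc_module)
  let ?L = "MS"
  interpret L: rmodule "RS" ?L by (intro rmodule.intro loc_module)
  have sub: "submodule {x \<in> carrier M. fr x \<one> \<in> N} R M" if "submodule N RS ?L" for N
  proof (rule submoduleI')
    note N = L.submodule_closed[OF that]
    show "\<zero>\<^bsub>M\<^esub> \<in> {x \<in> carrier M. fr x \<one> \<in> N}" using N(2) by (simp add: loc_module_simps)
    fix a b assume "a \<in> {x \<in> carrier M. fr x \<one> \<in> N}" "b \<in> {x \<in> carrier M. fr x \<one> \<in> N}"
    then show "a \<oplus>\<^bsub>M\<^esub> b \<in> {x \<in> carrier M. fr x \<one> \<in> N}"
      using N(3)[of "fr a \<one>" "fr b \<one>"] S_one by (simp add: fract_add_same)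
  next
    note N = L.submodule_closed[OF that]
    fix r a assume "r \<in> carrier R" "a \<in> {x \<in> carrier M. fr x \<one> \<in> N}"
    then show "r \<odot>\<^bsub>M\<^esub> a \<in> {x \<in> carrier M. fr x \<one> \<in> N}"
      using N(6)[of "rf r \<one>" "fr a \<one>"] S_one rf_in by (simp add: fract_smult)
  qed auto
  fix N assume N: "submodule N RS ?L"
  note Ncl = L.submodule_closed[OF N]
  obtain X where X: "finite X" "X \<subseteq> carrier M" "{x \<in> carrier M. fr x \<one> \<in> N} = gen_submodule R M X"
    using assms sub[OF N] unfolding noeth_module_def fg_submodule_def by blast
  let ?Y = "(\<lambda>x. fr x \<one>) ` X"
  have Y: "?Y \<subseteq> carrier ?L" using X(2) S_one by (auto intro!: frac_in)
  have GY: "submodule (gen_submodule RS ?L ?Y) RS ?L" by (rule L.gen_submodule[OF Y])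
  have "N = gen_submodule RS ?L ?Y"
  proof
    have "?Y \<subseteq> N" using X(3) gen_submodule_subset[of X] by auto
    then show "gen_submodule RS ?L ?Y \<subseteq> N" by (rule L.gen_submodule_minimal[OF N])
    have "X \<subseteq> {x \<in> carrier M. fr x \<one> \<in> gen_submodule RS ?L ?Y}"
      using X(2) L.gen_submodule_subset[of ?Y] by auto
    then have Xsub: "gen_submodule R M X \<subseteq> {x \<in> carrier M. fr x \<one> \<in> gen_submodule RS ?L ?Y}"
      by (rule gen_submodule_minimal[OF sub[OF GY]])
    show "N \<subseteq> gen_submodule RS ?L ?Y"
    proof
      fix n assume n: "n \<in> N"
      then have "n \<in> carrier ?L" using Ncl(1) by auto
      then obtain x s where x: "x \<in> carrier M" "s \<in> S" "n = fr x s" by (rule frac_cases)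
      have "fr x \<one> = rf s \<one> \<odot>\<^bsub>?L\<^esub> n"
        using x S_one fract_cancel[of x \<one> s] by (simp add: fract_smult)
      then have "fr x \<one> \<in> N" using Ncl(6)[of "rf s \<one>" n] n x S_one rf_in by simp
      then have "fr x \<one> \<in> gen_submodule RS ?L ?Y" using X(3) Xsub x by auto
      then have "rf \<one> s \<odot>\<^bsub>?L\<^esub> fr x \<one> \<in> gen_submodule RS ?L ?Y"
        using L.submodule_closed(6)[OF GY] x rf_in by auto
      then show "n \<in> gen_submodule RS ?L ?Y" using x S_one by (simp add: fract_smult)
    qed
  qed
  moreover have "finite ?Y" using X(1) by simp
  ultimately show "fg_submodule RS ?L N" unfolding fg_submodule_def using Y by blast
qed

end

subsection \<open>Ideals of the localized ring\<close>

context mult_set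
begin

text \<open>Extension of an ideal to the localization, given directly as a set of fractions;
  \<open>Idl_image\<close> identifies it with the ideal generated by the image.\<close>

definition ext :: "'r set \<Rightarrow> ('r \<times> 'r) set set" where
  "ext I = {rf r s |r s. r \<in> I \<and> s \<in> S}"

lemma ext_ideal:
  assumes "ideal I R" shows "ideal (ext I) RS"
proof -
  interpret L: cring "RS" by (rule loc_ring_cring)
  interpret I: ideal I R by fact
  show ?thesis
  proof (rule L.idealI')
    show "ext I \<subseteq> carrier RS" using I.ideal_closed(1) by (auto simp: ext_def intro!: rf_in)
    show "\<zero>\<^bsub>RS\<^esub> \<in> ext I" unfolding ext_def loc_ring_simps using I.ideal_closed(2) S_one by blast
    fix X Y assume "X \<in> ext I" "Y \<in> ext I"
    then obtain x s y t where *: "x \<in> I" "s \<in> S" "X = rf x s" "y \<in> I" "t \<in> S" "Y = rf y t" by (auto simp: ext_def)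
    have "t \<otimes> x \<oplus> s \<otimes> y \<in> I" "s \<otimes> t \<in> S" using * I.ideal_closed S_mult by auto
    then show "X \<oplus>\<^bsub>RS\<^esub> Y \<in> ext I" using * I.Icarr by (auto simp: ext_def rf_add)
  next
    fix X Y assume "X \<in> carrier RS" "Y \<in> ext I"
    then obtain x s y t where *: "x \<in> carrier R" "s \<in> S" "X = rf x s" "y \<in> I" "t \<in> S" "Y = rf y t"
      by (auto simp: ext_def elim: ring_cases)
    have "x \<otimes> y \<in> I" "s \<otimes> t \<in> S" using * I.ideal_closed S_mult by auto
    then show "X \<otimes>\<^bsub>RS\<^esub> Y \<in> ext I" using * I.Icarr by (auto simp: ext_def rf_mult)
  qed
qed

lemma Idl_image:
  assumes "ideal I R" shows "Idl\<^bsub>RS\<^esub> ((\<lambda>r. rf r \<one>) ` I) = ext I"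
proof
  interpret L: cring "RS" by (rule loc_ring_cring)
  interpret I: ideal I R by fact
  have im: "(\<lambda>r. rf r \<one>) ` I \<subseteq> ext I" using S_one by (auto simp: ext_def)
  then show "Idl\<^bsub>RS\<^esub> ((\<lambda>r. rf r \<one>) ` I) \<subseteq> ext I" by (rule L.genideal_minimal[OF ext_ideal[OF assms]])
  have "(\<lambda>r. rf r \<one>) ` I \<subseteq> carrier RS" using I.Icarr S_one by (auto intro!: rf_in)
  then have J: "ideal (Idl\<^bsub>RS\<^esub> ((\<lambda>r. rf r \<one>) ` I)) RS"
    and s: "(\<lambda>r. rf r \<one>) ` I \<subseteq> Idl\<^bsub>RS\<^esub> ((\<lambda>r. rf r \<one>) ` I)"
    by (simp_all add: L.genideal_ideal L.genideal_self)
  show "ext I \<subseteq> Idl\<^bsub>RS\<^esub> ((\<lambda>r. rf r \<one>) ` I)"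
  proof
    fix X assume "X \<in> ext I"
    then obtain x s where *: "x \<in> I" "s \<in> S" "X = rf x s" by (auto simp: ext_def)
    then have "X = rf \<one> s \<otimes>\<^bsub>RS\<^esub> rf x \<one>" using I.Icarr S_one by (simp add: rf_mult)
    moreover have "rf x \<one> \<in> Idl\<^bsub>RS\<^esub> ((\<lambda>r. rf r \<one>) ` I)" using s * by auto
    ultimately show "X \<in> Idl\<^bsub>RS\<^esub> ((\<lambda>r. rf r \<one>) ` I)"
      using ideal.ideal_closed(4)[OF J, of "rf \<one> s"] * rf_in by simp
  qed
qed

lemma ext_prod:
  assumes I: "ideal I R" and J: "ideal J R"
  shows "ideal_prod RS (ext I) (ext J) = ext (ideal_prod R I J)"
proof
  interpret L: cring "RS" by (rule loc_ring_cring)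
  interpret I: ideal I R by fact
  interpret J: ideal J R by fact
  have IJ: "ideal (ideal_prod R I J) R" by (rule ideal_prod_is_ideal[OF I J])
  show "ideal_prod RS (ext I) (ext J) \<subseteq> ext (ideal_prod R I J)"
  proof
    fix X assume "X \<in> ideal_prod RS (ext I) (ext J)"
    then show "X \<in> ext (ideal_prod R I J)"
    proof (induct X rule: ideal_prod.induct)
      case (prod X Y)
      then obtain x s y t where *: "x \<in> I" "s \<in> S" "X = rf x s" "y \<in> J" "t \<in> S" "Y = rf y t"
        by (auto simp: ext_def)
      then show ?case using I.Icarr J.Icarr S_mult by (auto simp: rf_mult ext_def intro: ideal_prod.prod)
    next
      case (sum X Y)
      then show ?case using ideal.ideal_closed(3)[OF ext_ideal[OF IJ]] by blast
    qed
  qed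
  have P: "ideal (ideal_prod RS (ext I) (ext J)) RS"
    by (intro L.ideal_prod_is_ideal ext_ideal I J)
  show "ext (ideal_prod R I J) \<subseteq> ideal_prod RS (ext I) (ext J)"
  proof
    fix X assume "X \<in> ext (ideal_prod R I J)"
    then obtain x s where x: "x \<in> ideal_prod R I J" "s \<in> S" "X = rf x s" by (auto simp: ext_def)
    have "x \<in> carrier R \<and> rf x s \<in> ideal_prod RS (ext I) (ext J)"
      using x(1)
    proof (induct x rule: ideal_prod.induct)
      case (prod i j)
      then have "rf (i \<otimes> j) s = rf i \<one> \<otimes>\<^bsub>RS\<^esub> rf j s"
        using x(2) S_one I.Icarr J.Icarr by (simp add: rf_mult)
      moreover have "rf i \<one> \<in> ext I" "rf j s \<in> ext J" using prod x(2) S_one by (auto simp: ext_def)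
      ultimately show ?case using ideal_prod.prod[of "rf i \<one>" "ext I" "rf j s" "ext J"] prod I.Icarr J.Icarr by simp
    next
      case (sum a b)
      then show ?case using rf_add_same[of a b s] x(2) ideal_prod.sum[of "rf a s" "RS" "ext I" "ext J" "rf b s"] by simp
    qed
    then show "X \<in> ideal_prod RS (ext I) (ext J)" using x by simp
  qed
qed

lemma ext_power:
  assumes I: "ideal I R"
  shows "ideal_power RS (ext I) t = ext (ideal_power R I t)"
proof -
  interpret L: cring "RS" by (rule loc_ring_cring)
  show ?thesis
  proof (induct t)
    case 0
    show ?case using SM.loc_module_simps(1) by (simp add: loc_ring_simps ext_def)
  next
    case (Suc t)
    then show ?case using ext_prod[OF ideal_power_ideal[OF I] I] by (simp add: L.ideal_power_Suc ideal_power_Suc)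
  qed
qed

definition con :: "('r \<times> 'r) set set \<Rightarrow> 'r set" where
  "con Q = {r \<in> carrier R. rf r \<one> \<in> Q}"

lemma rf_in_iff_con:
  assumes "ideal Q RS" "r \<in> carrier R" "s \<in> S"
  shows "rf r s \<in> Q \<longleftrightarrow> r \<in> con Q"
proof
  assume "rf r s \<in> Q"
  then have "rf s \<one> \<otimes>\<^bsub>RS\<^esub> rf r s \<in> Q"
    using ideal.ideal_closed(4)[OF assms(1)] assms S_one rf_in by auto
  moreover have "rf s \<one> \<otimes>\<^bsub>RS\<^esub> rf r s = rf r \<one>"
    using assms S_one rf_cancel[of r \<one> s] by (simp add: rf_mult)
  ultimately show "r \<in> con Q" using assms by (simp add: con_def)
next
  assume "r \<in> con Q"
  then have "rf \<one> s \<otimes>\<^bsub>RS\<^esub> rf r \<one> \<in> Q"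
    using ideal.ideal_closed(4)[OF assms(1)] assms rf_in by (auto simp: con_def)
  then show "rf r s \<in> Q" using assms S_one by (simp add: rf_mult)
qed

lemma con_prime:
  assumes "primeideal Q RS"
  shows "primeideal (con Q) R" "con Q \<inter> S = {}"
proof -
  interpret Q: primeideal Q "RS" by fact
  have Qi: "ideal Q RS" by (rule Q.is_ideal)
  have one: "rf s s = \<one>\<^bsub>RS\<^esub>" if "s \<in> S" for s
    using rf_cancel[of \<one> \<one> s] S_one that by (simp add: loc_ring_simps)
  have "\<one>\<^bsub>RS\<^esub> \<notin> Q" using Q.I_notcarr Q.one_imp_carrier by blast
  then show dis: "con Q \<inter> S = {}" using rf_in_iff_con[OF Qi] one S_in by fastforce
  show "primeideal (con Q) R"
  proof (rule primeidealI)
    show "cring R" by (rule is_cring)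
    show "ideal (con Q) R"
    proof (rule idealI')
      show "con Q \<subseteq> carrier R" by (auto simp: con_def)
      show "\<zero> \<in> con Q" using Q.ideal_closed(2) by (simp add: con_def loc_ring_simps)
      show "x \<oplus> y \<in> con Q" if "x \<in> con Q" "y \<in> con Q" for x y
        using that Q.ideal_closed(3)[of "rf x \<one>" "rf y \<one>"] S_one by (simp add: con_def rf_add_same)
      show "r \<otimes> x \<in> con Q" if "r \<in> carrier R" "x \<in> con Q" for r x
        using that Q.ideal_closed(4)[of "rf r \<one>" "rf x \<one>"] S_one rf_in by (simp add: con_def rf_mult)
    qed
    show "carrier R \<noteq> con Q" using dis S_one by auto
    fix a b assume "a \<in> carrier R" "b \<in> carrier R" "a \<otimes> b \<in> con Q"
    then show "a \<in> con Q \<or> b \<in> con Q"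
      using Q.I_prime[of "rf a \<one>" "rf b \<one>"] S_one rf_in by (simp add: con_def rf_mult)
  qed
qed

text \<open>Denominators are units in \<open>RS\<close>, so an ideal is recovered from its
  contraction and strictness is not lost.\<close>

lemma con_mono_strict:
  assumes "ideal Q RS" "ideal Q' RS" "Q \<subset> Q'"
  shows "con Q \<subset> con Q'"
proof -
  obtain X where X: "X \<in> Q'" "X \<notin> Q" using assms(3) by auto
  then have "X \<in> carrier RS" using ideal.ideal_closed(1)[OF assms(2)] by auto
  then obtain r s where r: "r \<in> carrier R" "s \<in> S" "X = rf r s" by (rule ring_cases)
  then have "r \<in> con Q'" "r \<notin> con Q" using X rf_in_iff_con[OF assms(1)] rf_in_iff_con[OF assms(2)] by auto
  moreover have "con Q \<subseteq> con Q'" using assms(3) by (auto simp: con_def)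
  ultimately show ?thesis by auto
qed

text \<open>If \<open>r/s = x/t\<close> with \<open>x\<close> in \<open>q\<close>, then a multiple
  of \<open>r\<close> by an element of \<open>S\<close> lies in \<open>q\<close>, and primality
  cancels the multiplier, which is outside \<open>q\<close>. Hence primes disjoint from
  \<open>S\<close> are recovered from their extensions.\<close>

lemma rf_in_ext_iff:
  assumes q: "primeideal q R" "q \<inter> S = {}" and r: "r \<in> carrier R" "s \<in> S"
  shows "rf r s \<in> ext q \<longleftrightarrow> r \<in> q"
proof
  interpret q: primeideal q R by fact
  assume "rf r s \<in> ext q"
  then obtain x t where x: "x \<in> q" "t \<in> S" "rf r s = rf x t" by (auto simp: ext_def)
  then obtain u where u: "u \<in> S" "(u \<otimes> t) \<otimes> r = (u \<otimes> s) \<otimes> x"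
    using SM.fract_eq_iff[of r x s t] r q.Icarr by auto
  have "(u \<otimes> s) \<otimes> x \<in> q" using q.ideal_closed(4) x u r by auto
  then have "(u \<otimes> t) \<otimes> r \<in> q" using u by simp
  moreover have "u \<otimes> t \<notin> q" using q(2) u x S_mult by auto
  ultimately show "r \<in> q" using q.I_prime[of "u \<otimes> t" r] u x r by auto
next
  assume "r \<in> q"
  then show "rf r s \<in> ext q" using r by (auto simp: ext_def)
qed

lemma ext_prime:
  assumes q: "primeideal q R" "q \<inter> S = {}"
  shows "primeideal (ext q) RS"
proof (rule primeidealI)
  interpret q: primeideal q R by fact
  show "ideal (ext q) RS" by (rule ext_ideal) (rule q.is_ideal)
  show "cring RS" by (rule loc_ring_cring)
  have "rf \<one> \<one> \<notin> ext q" using rf_in_ext_iff[OF q, of \<one> \<one>] S_one q(2) by auto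
  then show "carrier RS \<noteq> ext q" using rf_in[of \<one> \<one>] S_one by auto
  fix X Y assume XY: "X \<in> carrier RS" "Y \<in> carrier RS" "X \<otimes>\<^bsub>RS\<^esub> Y \<in> ext q"
  obtain x s where x: "x \<in> carrier R" "s \<in> S" "X = rf x s" using XY(1) by (rule ring_cases)
  obtain y t where y: "y \<in> carrier R" "t \<in> S" "Y = rf y t" using XY(2) by (rule ring_cases)
  show "X \<in> ext q \<or> Y \<in> ext q"
    using XY(3) x y S_mult q.I_prime[of x y] by (auto simp: rf_mult rf_in_ext_iff[OF q])
qed

lemma ext_mono_strict:
  assumes "primeideal q R" "primeideal q' R" "q \<inter> S = {}" "q' \<inter> S = {}" "q \<subset> q'"
  shows "ext q \<subset> ext q'"
proof -
  obtain r where r: "r \<in> q'" "r \<notin> q" using assms(5) by auto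
  interpret q': primeideal q' R by fact
  have "rf r \<one> \<in> ext q'" "rf r \<one> \<notin> ext q"
    using r rf_in_ext_iff[OF assms(1,3), of r \<one>] S_one q'.Icarr by (auto simp: ext_def)
  moreover have "ext q \<subseteq> ext q'" using assms(5) by (auto simp: ext_def)
  ultimately show ?thesis by auto
qed

end

section \<open>Localization at a prime and the support\<close>

lemma prime_mult_set:
  assumes "primeideal p R" shows "mult_set R (carrier R - p)"
proof -
  interpret p: primeideal p R by fact
  show ?thesis
    by (intro mult_set.intro mult_set_axioms.intro p.is_cring)
      (use p.I_prime p.I_notcarr p.one_imp_carrier in auto)
qed

text \<open>A fraction is zero exactly if something outside \<open>p\<close> kills its numerator.
  Supports can then be handled inside \<open>L\<close>, without the type of fractions.\<close>

lemma Supp_iff: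
  assumes "module R (L :: ('r, 'm) module)"
  shows "p \<in> Supp R L \<longleftrightarrow> primeideal p R \<and> (\<exists>x\<in>carrier L. \<forall>s\<in>carrier R - p. s \<odot>\<^bsub>L\<^esub> x \<noteq> \<zero>\<^bsub>L\<^esub>)"
proof (cases "primeideal p R")
  case True
  interpret loc R L "carrier R - p"
    using assms True by (intro loc.intro rmodule.intro prime_mult_set)
  interpret LL: abelian_group "loc_module R (carrier R - p) L" by (rule loc_module_abelian)
  have z: "\<zero>\<^bsub>loc_module R (carrier R - p) L\<^esub> \<in> carrier (loc_module R (carrier R - p) L)" by simp
  have "carrier (loc_module R (carrier R - p) L) \<noteq> {\<zero>\<^bsub>loc_module R (carrier R - p) L\<^esub>} \<longleftrightarrow>
    (\<exists>X\<in>carrier (loc_module R (carrier R - p) L). X \<noteq> \<zero>\<^bsub>loc_module R (carrier R - p) L\<^esub>)" using z by blast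
  also have "\<dots> \<longleftrightarrow> (\<exists>x\<in>carrier L. \<exists>s\<in>carrier R - p. fract (carrier R - p) L x s \<noteq> \<zero>\<^bsub>loc_module R (carrier R - p) L\<^esub>)"
    using frac_in by (auto elim!: frac_cases)
  also have "\<dots> \<longleftrightarrow> (\<exists>x\<in>carrier L. \<forall>s\<in>carrier R - p. s \<odot>\<^bsub>L\<^esub> x \<noteq> \<zero>\<^bsub>L\<^esub>)"
    using fract_eq_zero S_one by auto
  finally show ?thesis using True by (simp add: Supp_def Spec_def module_at_def)
qed (simp add: Supp_def Spec_def)

section \<open>Local cohomology in degrees 0 and 1\<close>

text \<open>Values outside the power of the ideal are unconstrained, so such maps are only ever
  compared on powers of \<open>I\<close>.\<close>

definition ideal_hom :: "('r, 'k) ring_scheme \<Rightarrow> 'r set \<Rightarrow> nat \<Rightarrow> ('r, 'm) module \<Rightarrow> ('r \<Rightarrow> 'm) set" where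
  "ideal_hom R I k M = mod_hom R ((self_module R)\<lparr>carrier := ideal_power R I k\<rparr>) M"

text \<open>In the direct limit of the maps from powers of \<open>I\<close> to \<open>M\<close>,
  modulo multiplications by elements of \<open>M\<close>, the class of \<open>f\<close> is zero: on
  some smaller power, \<open>f\<close> becomes such a multiplication.\<close>

definition inner_germ :: "('r, 'k) ring_scheme \<Rightarrow> 'r set \<Rightarrow> ('r, 'm) module \<Rightarrow> nat \<Rightarrow> ('r \<Rightarrow> 'm) \<Rightarrow> bool" where
  "inner_germ R I M k f \<longleftrightarrow>
    (\<exists>j\<ge>k. \<exists>m\<in>carrier M. \<forall>r\<in>ideal_power R I j. f r = r \<odot>\<^bsub>M\<^esub> m)"

text \<open>For a prime \<open>q\<close> this is \<open>dim (R/q) \<ge> n\<close>. Stated with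
  chains of primes, it also makes sense in infinite dimension and is easily carried along extension
  and contraction.\<close>

definition coheight_ge :: "('r, 'k) ring_scheme \<Rightarrow> nat \<Rightarrow> 'r set \<Rightarrow> bool" where
  "coheight_ge R n q \<longleftrightarrow>
    (\<exists>c :: nat \<Rightarrow> 'r set. c 0 = q \<and> (\<forall>i\<le>n. c i \<in> Spec R) \<and> (\<forall>i<n. c i \<subset> c (Suc i)))"

text \<open>
  \<open>H\<^sup>1\<close> is the direct limit over \<open>k\<close> of \<open>Hom(I\<^sup>k, M)\<close> modulo the maps \<open>r \<mapsto> r m\<close>, so the next
  definition says that \<open>J\<^sup>t\<close> annihilates the localization of \<open>H\<^sup>1\<close> at \<open>q\<close>.
\<close>

definition killed_at :: "('r, 'k) ring_scheme \<Rightarrow> 'r set \<Rightarrow> 'r set \<Rightarrow> ('r, 'm) module \<Rightarrow> nat \<Rightarrow> 'r set \<Rightarrow> bool" where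
  "killed_at R I J M t q \<longleftrightarrow> (\<forall>k. \<forall>f\<in>ideal_hom R I k M. \<forall>\<beta>\<in>ideal_power R J t.
     \<exists>s\<in>carrier R - q. inner_germ R I M k (\<lambda>r. (s \<otimes>\<^bsub>R\<^esub> \<beta>) \<odot>\<^bsub>M\<^esub> f r))"

section \<open>Maps on powers of an ideal, and torsion\<close>

lemma (in rmodule) ideal_homD:
  assumes "ideal I R" "f \<in> ideal_hom R I k M"
  shows "x \<in> ideal_power R I k \<Longrightarrow> f x \<in> carrier M"
    "x \<in> ideal_power R I k \<Longrightarrow> y \<in> ideal_power R I k \<Longrightarrow> f (x \<oplus> y) = f x \<oplus>\<^bsub>M\<^esub> f y"
    "r \<in> carrier R \<Longrightarrow> x \<in> ideal_power R I k \<Longrightarrow> f (r \<otimes> x) = r \<odot>\<^bsub>M\<^esub> f x"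
  using mod_homD[OF assms(2)[unfolded ideal_hom_def]] by auto

lemma (in rmodule) ideal_homI:
  assumes "\<And>x. x \<in> ideal_power R I k \<Longrightarrow> f x \<in> carrier M"
    "\<And>x y. x \<in> ideal_power R I k \<Longrightarrow> y \<in> ideal_power R I k \<Longrightarrow> f (x \<oplus> y) = f x \<oplus>\<^bsub>M\<^esub> f y"
    "\<And>r x. r \<in> carrier R \<Longrightarrow> x \<in> ideal_power R I k \<Longrightarrow> f (r \<otimes> x) = r \<odot>\<^bsub>M\<^esub> f x"
  shows "f \<in> ideal_hom R I k M"
  unfolding ideal_hom_def using assms by (intro mod_homI) auto

lemma (in rmodule) torsion_submodule:
  assumes I: "ideal I R" shows "submodule (torsion R I M) R M"
proof (rule submoduleI')
  note car = R.ideal_power_carrier[OF I]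
  show "torsion R I M \<subseteq> carrier M" by (auto simp: torsion_def)
  show "\<zero>\<^bsub>M\<^esub> \<in> torsion R I M" using car by (auto simp: torsion_def)
  fix x y assume "x \<in> torsion R I M" "y \<in> torsion R I M"
  then obtain s t where *: "x \<in> carrier M" "y \<in> carrier M" "\<And>r. r \<in> ideal_power R I s \<Longrightarrow> r \<odot>\<^bsub>M\<^esub> x = \<zero>\<^bsub>M\<^esub>"
    "\<And>r. r \<in> ideal_power R I t \<Longrightarrow> r \<odot>\<^bsub>M\<^esub> y = \<zero>\<^bsub>M\<^esub>" by (auto simp: torsion_def)
  have "r \<odot>\<^bsub>M\<^esub> (x \<oplus>\<^bsub>M\<^esub> y) = \<zero>\<^bsub>M\<^esub>" if r: "r \<in> ideal_power R I (max s t)" for r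
  proof -
    have "r \<in> ideal_power R I s" "r \<in> ideal_power R I t"
      using r R.ideal_power_antimono[OF I, of s "max s t"] R.ideal_power_antimono[OF I, of t "max s t"] by auto
    then show ?thesis using * car[OF r] by (simp add: smult_r_distr)
  qed
  then show "x \<oplus>\<^bsub>M\<^esub> y \<in> torsion R I M" using * by (auto simp: torsion_def)
next
  fix a x assume a: "a \<in> carrier R" and "x \<in> torsion R I M"
  then obtain t where *: "x \<in> carrier M" "\<And>r. r \<in> ideal_power R I t \<Longrightarrow> r \<odot>\<^bsub>M\<^esub> x = \<zero>\<^bsub>M\<^esub>"
    by (auto simp: torsion_def)
  have "r \<odot>\<^bsub>M\<^esub> (a \<odot>\<^bsub>M\<^esub> x) = \<zero>\<^bsub>M\<^esub>" if r: "r \<in> ideal_power R I t" for r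
    using smult_comm[OF R.ideal_power_carrier[OF I r] a *(1)] *(2)[OF r] a by simp
  then show "a \<odot>\<^bsub>M\<^esub> x \<in> torsion R I M" using * a by (auto simp: torsion_def)
qed

section \<open>Classes in degree 1 as germs of maps on powers of the ideal\<close>

lemma injective_moduleD:
  fixes E B :: "('r, 'e) module"
  assumes "injective_module R E" "module R B" "submodule A R B" "f \<in> mod_hom R (B\<lparr>carrier := A\<rparr>) E"
  shows "\<exists>g\<in>mod_hom R B E. \<forall>x\<in>A. g x = f x"
  using assms by (simp add: injective_module_def)

text \<open>The type of the resolution is arbitrary. Passing from classes to germs works in any
  type, whereas the way back needs an injection of the ring into that type, because the ring itself
  is then used as a test module for injectivity.\<close>

locale resolved = rmodule R M
  for R :: "('r, 'k) ring_scheme" (structure) and M :: "('r, 'm) module" (structure) +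
  fixes I :: "'r set" and \<epsilon> :: "'m \<Rightarrow> 'e" and E :: "nat \<Rightarrow> ('r, 'e) module" and d :: "nat \<Rightarrow> 'e \<Rightarrow> 'e"
  assumes I: "ideal I R" and res: "injective_resolution R M \<epsilon> E d"
begin

lemma E_inj: "injective_module R (E i)" and E_module: "module R (E i)"
  and eps_hom: "\<epsilon> \<in> mod_hom R M (E 0)" and eps_inj: "inj_on \<epsilon> (carrier M)"
  and d_hom: "d i \<in> mod_hom R (E i) (E (Suc i))"
  and ker_0: "a_kernel (E 0) (E (Suc 0)) (d 0) = \<epsilon> ` carrier M"
  and ker_Suc: "a_kernel (E (Suc i)) (E (Suc (Suc i))) (d (Suc i)) = d i ` carrier (E i)"
  using res by (auto simp: injective_resolution_def injective_module_def)

lemma E_rmodule: "rmodule R (E i)"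
  by (intro rmodule.intro E_module)

lemma kernel_submodule: "submodule (a_kernel (E i) (E (Suc i)) (d i)) R (E i)"
  by (rule a_kernel_submodule[OF d_hom E_module E_module])

definition cocycles :: "nat \<Rightarrow> 'e set" where
  "cocycles i = torsion R I (E i) \<inter> a_kernel (E i) (E (Suc i)) (d i)"

lemma cocycles_submodule: "submodule (cocycles i) R (E i)"
proof -
  interpret Ei: rmodule R "E i" by (rule E_rmodule)
  show ?thesis unfolding cocycles_def
    using Ei.submodule_closed[OF Ei.torsion_submodule[OF I]] Ei.submodule_closed[OF kernel_submodule]
    by (intro Ei.submoduleI') auto
qed

lemma cocycles_module: "module R ((E i)\<lparr>carrier := cocycles i\<rparr>)"
  by (rule submodule.submodule_is_module[OF cocycles_submodule E_module])

lemma torsion_image: "d i ` torsion R I (E i) \<subseteq> cocycles (Suc i)"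
proof
  fix y assume "y \<in> d i ` torsion R I (E i)"
  then obtain x where x: "x \<in> torsion R I (E i)" "y = d i x" by auto
  interpret Ei: rmodule R "E i" by (rule E_rmodule)
  interpret Es: rmodule R "E (Suc i)" by (rule E_rmodule)
  obtain t where t: "x \<in> carrier (E i)" "\<And>r. r \<in> ideal_power R I t \<Longrightarrow> r \<odot>\<^bsub>E i\<^esub> x = \<zero>\<^bsub>E i\<^esub>"
    using x(1) by (auto simp: torsion_def)
  have "r \<odot>\<^bsub>E (Suc i)\<^esub> y = \<zero>\<^bsub>E (Suc i)\<^esub>" if r: "r \<in> ideal_power R I t" for r
    using mod_homD(3)[OF d_hom R.ideal_power_carrier[OF I r] t(1)] t(2)[OF r] x(2)
      mod_hom_zero[OF d_hom E_module E_module] by simp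
  then have "y \<in> torsion R I (E (Suc i))"
    using x(2) mod_homD(1)[OF d_hom t(1)] by (auto simp: torsion_def)
  moreover have "y \<in> a_kernel (E (Suc i)) (E (Suc (Suc i))) (d (Suc i))"
    unfolding ker_Suc using x(2) t(1) by auto
  ultimately show "y \<in> cocycles (Suc i)" by (simp add: cocycles_def)
qed

lemma coboundaries_submodule:
  "submodule (d i ` torsion R I (E i)) R ((E (Suc i))\<lparr>carrier := cocycles (Suc i)\<rparr>)"
proof -
  interpret Ei: rmodule R "E i" by (rule E_rmodule)
  interpret Es: rmodule R "E (Suc i)" by (rule E_rmodule)
  show ?thesis
    unfolding Es.submodule_restrict[OF cocycles_submodule]
    using mod_hom_image_submodule[OF d_hom E_module E_module Ei.torsion_submodule[OF I]] torsion_image by blast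
qed

abbreviation "H0 \<equiv> torsion_cohomology R I E d 0"
abbreviation "H1 \<equiv> torsion_cohomology R I E d (Suc 0)"
abbreviation "W \<equiv> (E (Suc 0))\<lparr>carrier := cocycles (Suc 0)\<rparr>"
abbreviation "B \<equiv> d 0 ` torsion R I (E 0)"

lemma H1_eq: "H1 = quot_module W B"
  by (simp add: torsion_cohomology_def cocycles_def)

sublocale H1: module_quotient R W B
  by (intro module_quotient.intro module_quotient_axioms.intro rmodule.intro cocycles_module
      coboundaries_submodule)

lemma H1_module: "module R H1"
  unfolding H1_eq by (rule H1.module_quot)

text \<open>If \<open>r e\<close> and a torsion element \<open>y\<close> have the same image under
  \<open>d 0\<close>, their difference is \<open>\<epsilon> m\<close> for some \<open>m\<close>. On
  a power of \<open>I\<close> that kills \<open>y\<close>, multiplying \<open>r e\<close> or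
  \<open>\<epsilon> m\<close> gives the same result, so \<open>r f\<close> is multiplication by
  \<open>m\<close> there. The argument reverses with \<open>y = r e - \<epsilon> m\<close>.\<close>

lemma germ_iff:
  assumes e: "e \<in> carrier (E 0)" and f: "f \<in> ideal_hom R I k M"
    and ef: "\<And>r. r \<in> ideal_power R I k \<Longrightarrow> \<epsilon> (f r) = r \<odot>\<^bsub>E 0\<^esub> e" and r: "r \<in> carrier R"
  shows "r \<odot>\<^bsub>E (Suc 0)\<^esub> d 0 e \<in> B \<longleftrightarrow> inner_germ R I M k (\<lambda>\<rho>. r \<odot>\<^bsub>M\<^esub> f \<rho>)"
proof
  interpret E0: rmodule R "E 0" by (rule E_rmodule)
  interpret E1: rmodule R "E (Suc 0)" by (rule E_rmodule)
  note dh = mod_homD[OF d_hom[of 0]] and eh = mod_homD[OF eps_hom] and fh = ideal_homD[OF I f]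
  have rde: "r \<odot>\<^bsub>E (Suc 0)\<^esub> d 0 e = d 0 (r \<odot>\<^bsub>E 0\<^esub> e)" using dh(3)[OF r e] by simp
  assume "r \<odot>\<^bsub>E (Suc 0)\<^esub> d 0 e \<in> B"
  then obtain y where y: "y \<in> torsion R I (E 0)" "d 0 (r \<odot>\<^bsub>E 0\<^esub> e) = d 0 y" using rde by auto
  then obtain t where t: "y \<in> carrier (E 0)" "\<And>r. r \<in> ideal_power R I t \<Longrightarrow> r \<odot>\<^bsub>E 0\<^esub> y = \<zero>\<^bsub>E 0\<^esub>"
    by (auto simp: torsion_def)
  have re: "r \<odot>\<^bsub>E 0\<^esub> e \<in> carrier (E 0)" using r e by simp
  have "d 0 (r \<odot>\<^bsub>E 0\<^esub> e \<ominus>\<^bsub>E 0\<^esub> y) = \<zero>\<^bsub>E (Suc 0)\<^esub>"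
    using mod_hom_minus[OF d_hom E_module E_module re t(1)] y(2) dh(1)[OF t(1)]
    by (simp add: E1.minus_eq_zero)
  then have "r \<odot>\<^bsub>E 0\<^esub> e \<ominus>\<^bsub>E 0\<^esub> y \<in> \<epsilon> ` carrier M"
    using re t(1) unfolding ker_0[symmetric] by (simp add: a_kernel_def')
  then obtain m where m: "m \<in> carrier M" "r \<odot>\<^bsub>E 0\<^esub> e \<ominus>\<^bsub>E 0\<^esub> y = \<epsilon> m" by auto
  have eq: "r \<odot>\<^bsub>M\<^esub> f \<rho> = \<rho> \<odot>\<^bsub>M\<^esub> m" if \<rho>: "\<rho> \<in> ideal_power R I (max k t)" for \<rho>
  proof -
    have \<rho>kt: "\<rho> \<in> ideal_power R I k" "\<rho> \<in> ideal_power R I t" and \<rho>R: "\<rho> \<in> carrier R"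
      using \<rho> R.ideal_power_antimono[OF I, of k "max k t"] R.ideal_power_antimono[OF I, of t "max k t"]
        R.ideal_power_carrier[OF I] by auto
    have "\<epsilon> (r \<odot>\<^bsub>M\<^esub> f \<rho>) = \<rho> \<odot>\<^bsub>E 0\<^esub> (r \<odot>\<^bsub>E 0\<^esub> e)"
      using eh(3)[OF r fh(1)[OF \<rho>kt(1)]] ef[OF \<rho>kt(1)] E0.smult_comm[OF r \<rho>R e] by simp
    also have "r \<odot>\<^bsub>E 0\<^esub> e = (r \<odot>\<^bsub>E 0\<^esub> e \<ominus>\<^bsub>E 0\<^esub> y) \<oplus>\<^bsub>E 0\<^esub> y" using E0.diff_add[OF re t(1)] by simp
    also have "\<rho> \<odot>\<^bsub>E 0\<^esub> \<dots> = \<epsilon> (\<rho> \<odot>\<^bsub>M\<^esub> m)"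
      unfolding m(2) using E0.smult_r_distr[OF \<rho>R eh(1)[OF m(1)] t(1)] t(2)[OF \<rho>kt(2)] eh(3)[OF \<rho>R m(1)] eh(1)[OF m(1)] \<rho>R
      by simp
    finally show ?thesis using eps_inj fh(1)[OF \<rho>kt(1)] r \<rho>R m(1) by (auto dest: inj_onD)
  qed
  show "inner_germ R I M k (\<lambda>\<rho>. r \<odot>\<^bsub>M\<^esub> f \<rho>)"
    unfolding inner_germ_def by (intro exI[of _ "max k t"] conjI bexI[OF _ m(1)] ballI eq) auto
next
  interpret E0: rmodule R "E 0" by (rule E_rmodule)
  interpret E1: rmodule R "E (Suc 0)" by (rule E_rmodule)
  note dh = mod_homD[OF d_hom[of 0]] and eh = mod_homD[OF eps_hom] and fh = ideal_homD[OF I f]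
  assume "inner_germ R I M k (\<lambda>\<rho>. r \<odot>\<^bsub>M\<^esub> f \<rho>)"
  then obtain j m where j: "j \<ge> k" "m \<in> carrier M" "\<And>\<rho>. \<rho> \<in> ideal_power R I j \<Longrightarrow> r \<odot>\<^bsub>M\<^esub> f \<rho> = \<rho> \<odot>\<^bsub>M\<^esub> m"
    by (auto simp: inner_germ_def)
  let ?y = "r \<odot>\<^bsub>E 0\<^esub> e \<ominus>\<^bsub>E 0\<^esub> \<epsilon> m"
  have re: "r \<odot>\<^bsub>E 0\<^esub> e \<in> carrier (E 0)" using r e by simp
  have em: "\<epsilon> m \<in> carrier (E 0)" using eh(1) j by simp
  have "\<rho> \<odot>\<^bsub>E 0\<^esub> ?y = \<zero>\<^bsub>E 0\<^esub>" if \<rho>: "\<rho> \<in> ideal_power R I j" for \<rho>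
  proof -
    have \<rho>k: "\<rho> \<in> ideal_power R I k" and \<rho>R: "\<rho> \<in> carrier R"
      using \<rho> R.ideal_power_antimono[OF I j(1)] R.ideal_power_carrier[OF I] by auto
    have "\<rho> \<odot>\<^bsub>E 0\<^esub> (r \<odot>\<^bsub>E 0\<^esub> e) = \<epsilon> (r \<odot>\<^bsub>M\<^esub> f \<rho>)"
      using eh(3)[OF r fh(1)[OF \<rho>k]] ef[OF \<rho>k] E0.smult_comm[OF r \<rho>R e] by simp
    also have "\<dots> = \<rho> \<odot>\<^bsub>E 0\<^esub> \<epsilon> m" using j(3)[OF \<rho>] eh(3)[OF \<rho>R j(2)] by simp
    finally show ?thesis using E0.smult_minus[OF \<rho>R re em] \<rho>R em by (simp add: E0.minus_eq_zero)
  qed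
  then have y: "?y \<in> torsion R I (E 0)" using re em by (auto simp: torsion_def)
  have "\<epsilon> m \<in> a_kernel (E 0) (E (Suc 0)) (d 0)" unfolding ker_0 using j by simp
  then have "d 0 (\<epsilon> m) = \<zero>\<^bsub>E (Suc 0)\<^esub>" by (simp add: a_kernel_def')
  then have "d 0 ?y = d 0 (r \<odot>\<^bsub>E 0\<^esub> e)"
    using mod_hom_minus[OF d_hom E_module E_module re em] dh(1)[OF re] by (simp add: E1.M.minus_eq)
  then have "r \<odot>\<^bsub>E (Suc 0)\<^esub> d 0 e = d 0 ?y" using dh(3)[OF r e] by simp
  then show "r \<odot>\<^bsub>E (Suc 0)\<^esub> d 0 e \<in> B" using y by blast
qed

lemma H1_zero_iff:
  assumes "w \<in> cocycles (Suc 0)" "r \<in> carrier R"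
  shows "r \<odot>\<^bsub>H1\<^esub> (B +>\<^bsub>W\<^esub> w) = \<zero>\<^bsub>H1\<^esub> \<longleftrightarrow> r \<odot>\<^bsub>E (Suc 0)\<^esub> w \<in> B"
proof -
  interpret E1: rmodule R "E (Suc 0)" by (rule E_rmodule)
  have "r \<odot>\<^bsub>E (Suc 0)\<^esub> w \<in> cocycles (Suc 0)" using E1.submodule_closed(6)[OF cocycles_submodule] assms by simp
  then show ?thesis
    unfolding H1_eq using H1.coset_smult[OF assms(2), of w] H1.coset_eq_iff_zero[of "r \<odot>\<^bsub>E (Suc 0)\<^esub> w"] assms by simp
qed

text \<open>By exactness a cocycle is \<open>d 0 e\<close> for some \<open>e\<close>. A power of
  \<open>I\<close> that kills the cocycle moves \<open>e\<close> into the kernel of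
  \<open>d 0\<close>, which is the image of \<open>\<epsilon>\<close>; the germ is multiplication by
  \<open>e\<close> on that power, read back in \<open>M\<close>.\<close>

lemma germ_of_class:
  assumes z: "z \<in> carrier H1"
  shows "\<exists>k. \<exists>f\<in>ideal_hom R I k M. \<forall>r\<in>carrier R.
    r \<odot>\<^bsub>H1\<^esub> z = \<zero>\<^bsub>H1\<^esub> \<longleftrightarrow> inner_germ R I M k (\<lambda>\<rho>. r \<odot>\<^bsub>M\<^esub> f \<rho>)"
proof -
  interpret E0: rmodule R "E 0" by (rule E_rmodule)
  interpret E1: rmodule R "E (Suc 0)" by (rule E_rmodule)
  note dh = mod_homD[OF d_hom[of 0]] and eh = mod_homD[OF eps_hom]
  obtain w where w: "w \<in> cocycles (Suc 0)" "z = B +>\<^bsub>W\<^esub> w"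
    using z unfolding H1_eq by (auto elim: H1.coset_cases)
  then obtain e where e: "e \<in> carrier (E 0)" "w = d 0 e" unfolding cocycles_def ker_Suc by auto
  obtain k where k: "\<And>r. r \<in> ideal_power R I k \<Longrightarrow> r \<odot>\<^bsub>E (Suc 0)\<^esub> w = \<zero>\<^bsub>E (Suc 0)\<^esub>"
    using w(1) by (auto simp: cocycles_def torsion_def)
  have im: "r \<odot>\<^bsub>E 0\<^esub> e \<in> \<epsilon> ` carrier M" if r: "r \<in> ideal_power R I k" for r
    using k[OF r] dh(3)[OF R.ideal_power_carrier[OF I r] e(1)] e R.ideal_power_carrier[OF I r]
    unfolding ker_0[symmetric] by (simp add: a_kernel_def')
  define f where "f r = inv_into (carrier M) \<epsilon> (r \<odot>\<^bsub>E 0\<^esub> e)" for r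
  have ef: "\<epsilon> (f r) = r \<odot>\<^bsub>E 0\<^esub> e" and fM: "f r \<in> carrier M" if "r \<in> ideal_power R I k" for r
    using f_inv_into_f[OF im[OF that]] inv_into_into[OF im[OF that]] by (simp_all add: f_def)
  note pk = ideal.ideal_closed[OF R.ideal_power_ideal[OF I]] and car = R.ideal_power_carrier[OF I]
  have fI: "f \<in> ideal_hom R I k M"
  proof (rule ideal_homI)
    fix x y assume x: "x \<in> ideal_power R I k" and y: "y \<in> ideal_power R I k"
    have "\<epsilon> (f (x \<oplus> y)) = \<epsilon> (f x \<oplus>\<^bsub>M\<^esub> f y)"
      using ef[OF pk(3)[OF x y]] eh(2)[OF fM[OF x] fM[OF y]] ef[OF x] ef[OF y] E0.smult_l_distr[OF car[OF x] car[OF y] e(1)]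
      by simp
    then show "f (x \<oplus> y) = f x \<oplus>\<^bsub>M\<^esub> f y"
      using inj_onD[OF eps_inj] fM[OF x] fM[OF y] fM[OF pk(3)[OF x y]] by simp
  next
    fix r x assume r: "r \<in> carrier R" and x: "x \<in> ideal_power R I k"
    have "\<epsilon> (f (r \<otimes> x)) = \<epsilon> (r \<odot>\<^bsub>M\<^esub> f x)"
      using ef[OF pk(4)[OF r x]] eh(3)[OF r fM[OF x]] ef[OF x] E0.smult_assoc1[OF r car[OF x] e(1)] by simp
    then show "f (r \<otimes> x) = r \<odot>\<^bsub>M\<^esub> f x"
      using inj_onD[OF eps_inj] fM[OF x] fM[OF pk(4)[OF r x]] r by simp
  qed (rule fM)
  have "r \<odot>\<^bsub>H1\<^esub> z = \<zero>\<^bsub>H1\<^esub> \<longleftrightarrow> inner_germ R I M k (\<lambda>\<rho>. r \<odot>\<^bsub>M\<^esub> f \<rho>)" if "r \<in> carrier R" for r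
    unfolding w(2) H1_zero_iff[OF w(1) that] unfolding e(2) by (rule germ_iff[OF e(1) fI ef that])
  then show ?thesis using fI by (intro exI[of _ k] bexI[of _ f]) simp_all
qed

text \<open>Injectivity of \<open>E 0\<close> is used only for the extension of a map from an ideal; the module \<open>R\<close>
  is first copied into the type of the elements of \<open>E 0\<close>.\<close>

lemma class_of_germ:
  assumes \<iota>: "inj (\<iota> :: 'r \<Rightarrow> 'e)" and f: "f \<in> ideal_hom R I k M"
  shows "\<exists>z\<in>carrier H1. \<forall>r\<in>carrier R.
    r \<odot>\<^bsub>H1\<^esub> z = \<zero>\<^bsub>H1\<^esub> \<longleftrightarrow> inner_germ R I M k (\<lambda>\<rho>. r \<odot>\<^bsub>M\<^esub> f \<rho>)"
proof -
  interpret E0: rmodule R "E 0" by (rule E_rmodule)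
  interpret E1: rmodule R "E (Suc 0)" by (rule E_rmodule)
  interpret SR: rmodule R "self_module R" by (intro rmodule.intro R.self_module)
  note dh = mod_homD[OF d_hom[of 0]] and eh = mod_homD[OF eps_hom] and fh = ideal_homD[OF I f]
  note car = R.ideal_power_carrier[OF I]
  let ?T = "transport_module \<iota> (self_module R)"
  have inj: "inj_on \<iota> (carrier (self_module R))" using \<iota> by (rule inj_on_subset) simp
  note T = SR.transport_simps[OF inj, simplified]
  have A: "submodule (\<iota> ` ideal_power R I k) R ?T"
    by (intro mod_hom_image_submodule[OF SR.transport_hom[OF inj] R.self_module SR.transport_module[OF inj]])
      (simp add: R.submodule_self R.ideal_power_ideal[OF I])
  define h where "h x = \<epsilon> (f (inv_into UNIV \<iota> x))" for x
  have h: "h (\<iota> r) = \<epsilon> (f r)" for r using \<iota> by (simp add: h_def)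
  have hh: "h \<in> mod_hom R (?T\<lparr>carrier := \<iota> ` ideal_power R I k\<rparr>) (E 0)"
    by (rule mod_homI) (auto simp: h T fh eh car)
  obtain g where g: "g \<in> mod_hom R ?T (E 0)" "\<forall>x\<in>\<iota> ` ideal_power R I k. g x = h x"
    using injective_moduleD[OF E_inj SR.transport_module[OF inj] A hh] by (elim bexE)
  \<comment> \<open>A linear map on the copy of \<open>R\<close> is determined by its value at
    \<open>1\<close>, so the extended map is multiplication by \<open>e\<close>.\<close>
  define e where "e = g (\<iota> \<one>)"
  have e: "e \<in> carrier (E 0)" unfolding e_def using mod_homD(1)[OF g(1)] by (simp add: T)
  have ef: "\<epsilon> (f r) = r \<odot>\<^bsub>E 0\<^esub> e" if r: "r \<in> ideal_power R I k" for r
  proof -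
    have "r \<odot>\<^bsub>E 0\<^esub> e = g (\<iota> (r \<otimes> \<one>))"
      unfolding e_def using mod_homD(3)[OF g(1) car[OF r], of "\<iota> \<one>"] T(4)[of \<one> r] car[OF r] T(1) by simp
    then show ?thesis using g(2) r car[OF r] h by simp
  qed
  have k: "r \<odot>\<^bsub>E (Suc 0)\<^esub> d 0 e = \<zero>\<^bsub>E (Suc 0)\<^esub>" if r: "r \<in> ideal_power R I k" for r
  proof -
    have "\<epsilon> (f r) \<in> a_kernel (E 0) (E (Suc 0)) (d 0)" unfolding ker_0 using fh(1)[OF r] by simp
    then show ?thesis using dh(3)[OF car[OF r] e] ef[OF r] by (simp add: a_kernel_def')
  qed
  have w: "d 0 e \<in> cocycles (Suc 0)"
    unfolding cocycles_def ker_Suc using k e dh(1)[OF e] by (auto simp: torsion_def)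
  have "B +>\<^bsub>W\<^esub> d 0 e \<in> carrier H1" unfolding H1_eq using H1.coset_in[of "d 0 e"] w by simp
  then show ?thesis
    by (intro bexI[of _ "B +>\<^bsub>W\<^esub> d 0 e"] ballI) (simp_all add: germ_iff[OF e f ef] H1_zero_iff[OF w])
qed

text \<open>For \<open>f\<close> linear on the \<open>k\<close>-th power and \<open>r\<close>,
  \<open>\<rho>\<close> in it, \<open>r f(\<rho>) = f(r \<rho>) = \<rho> f(r)\<close>, so
  \<open>r f\<close> is multiplication by the element \<open>f r\<close>.\<close>

lemma H1_torsion:
  assumes z: "z \<in> carrier H1"
  shows "\<exists>k. \<forall>r\<in>ideal_power R I k. r \<odot>\<^bsub>H1\<^esub> z = \<zero>\<^bsub>H1\<^esub>"
proof -
  obtain k f where f: "f \<in> ideal_hom R I k M" and iff: "\<And>r. r \<in> carrier R \<Longrightarrow>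
    r \<odot>\<^bsub>H1\<^esub> z = \<zero>\<^bsub>H1\<^esub> \<longleftrightarrow> inner_germ R I M k (\<lambda>\<rho>. r \<odot>\<^bsub>M\<^esub> f \<rho>)"
    using germ_of_class[OF z] by blast
  note fh = ideal_homD[OF I f] and car = R.ideal_power_carrier[OF I]
  have "r \<odot>\<^bsub>H1\<^esub> z = \<zero>\<^bsub>H1\<^esub>" if r: "r \<in> ideal_power R I k" for r
  proof -
    have "r \<odot>\<^bsub>M\<^esub> f \<rho> = \<rho> \<odot>\<^bsub>M\<^esub> f r" if \<rho>: "\<rho> \<in> ideal_power R I k" for \<rho>
      using fh(3)[OF car[OF r] \<rho>] fh(3)[OF car[OF \<rho>] r] R.m_comm[OF car[OF r] car[OF \<rho>]] by simp
    then have "inner_germ R I M k (\<lambda>\<rho>. r \<odot>\<^bsub>M\<^esub> f \<rho>)"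
      unfolding inner_germ_def using fh(1)[OF r] by blast
    then show ?thesis using iff[OF car[OF r]] by simp
  qed
  then show ?thesis by blast
qed

end

section \<open>Noetherian submodules and images, and cohomology in degree 0\<close>

lemma noeth_submodule:
  assumes "noeth_module R (M :: ('r, 'm) module)" "submodule N R M"
  shows "noeth_module R (M\<lparr>carrier := N\<rparr>)"
proof -
  interpret rmodule R M using assms(1) by (intro rmodule.intro) (simp add: noeth_module_def)
  show ?thesis
    using assms submodule.submodule_is_module[OF assms(2) module_axioms]
    by (auto simp: noeth_module_def submodule_restrict[OF assms(2)] fg_submodule_restrict[OF assms(2)])
qed

lemma noeth_image:
  assumes L: "noeth_module R (L :: ('r, 'l) module)" and M: "module R (M :: ('r, 'm) module)"
    and f: "f \<in> mod_hom R L M" and surj: "f ` carrier L = carrier M"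
  shows "noeth_module R M"
  unfolding noeth_module_def
proof (intro conjI allI impI M)
  interpret L: rmodule R L using L by (intro rmodule.intro) (simp add: noeth_module_def)
  interpret M: rmodule R M using M by (intro rmodule.intro)
  note fh = mod_homD[OF f]
  fix N assume N: "submodule N R M"
  note Ncl = M.submodule_closed[OF N]
  have pre: "submodule {x \<in> carrier L. f x \<in> K} R L" if K: "submodule K R M" for K
    using M.submodule_closed[OF K] fh mod_hom_zero[OF f L.module_axioms M]
    by (intro L.submoduleI') auto
  obtain X where X: "finite X" "X \<subseteq> carrier L" "{x \<in> carrier L. f x \<in> N} = gen_submodule R L X"
    using L pre[OF N] unfolding noeth_module_def fg_submodule_def by blast
  have fX: "f ` X \<subseteq> carrier M" using X(2) fh(1) by auto
  have "N = gen_submodule R M (f ` X)"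
  proof
    have "f ` X \<subseteq> N" using X(3) L.gen_submodule_subset[of X] by auto
    then show "gen_submodule R M (f ` X) \<subseteq> N" by (rule M.gen_submodule_minimal[OF N])
    have "X \<subseteq> {x \<in> carrier L. f x \<in> gen_submodule R M (f ` X)}"
      using X(2) M.gen_submodule_subset[of "f ` X"] by auto
    then have "gen_submodule R L X \<subseteq> {x \<in> carrier L. f x \<in> gen_submodule R M (f ` X)}"
      by (rule L.gen_submodule_minimal[OF pre[OF M.gen_submodule[OF fX]]])
    then have sub: "{x \<in> carrier L. f x \<in> N} \<subseteq> {x \<in> carrier L. f x \<in> gen_submodule R M (f ` X)}"
      unfolding X(3) .
    show "N \<subseteq> gen_submodule R M (f ` X)"
    proof
      fix y assume y: "y \<in> N"
      then have "y \<in> f ` carrier L" using Ncl(1) surj by auto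
      then obtain x where "x \<in> carrier L" "y = f x" by auto
      then show "y \<in> gen_submodule R M (f ` X)" using sub y by auto
    qed
  qed
  then show "fg_submodule R M N" unfolding fg_submodule_def using X(1) fX by blast
qed

text \<open>The kernel of \<open>d 0\<close> is the image of \<open>\<epsilon>\<close>, so the
  cocycles in degree 0 are the image of a submodule of \<open>M\<close>; dividing by zero merely
  replaces elements by cosets.\<close>

lemma (in resolved) noeth_H0:
  assumes "noeth_module R M"
  shows "noeth_module R H0"
proof -
  interpret E0: rmodule R "E 0" by (rule E_rmodule)
  let ?C = "(E 0)\<lparr>carrier := cocycles 0\<rparr>"
  interpret C: rmodule R ?C by (intro rmodule.intro cocycles_module)
  have z: "submodule {\<zero>\<^bsub>E 0\<^esub>} R ?C"
    using C.M.zero_closed by (intro C.submoduleI') auto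
  interpret Q: module_quotient R ?C "{\<zero>\<^bsub>E 0\<^esub>}"
    by (intro module_quotient.intro module_quotient_axioms.intro rmodule.intro cocycles_module z)
  have H0: "H0 = quot_module ?C {\<zero>\<^bsub>E 0\<^esub>}" by (simp add: torsion_cohomology_def cocycles_def)
  note eh = mod_homD[OF eps_hom] and Ccl = E0.submodule_closed[OF cocycles_submodule]
  let ?A = "{m \<in> carrier M. \<epsilon> m \<in> cocycles 0}"
  have A: "submodule ?A R M"
    using eh Ccl mod_hom_zero[OF eps_hom module_axioms E_module] by (intro submoduleI') auto
  show ?thesis unfolding H0
  proof (rule noeth_image[OF noeth_submodule[OF assms A] Q.module_quot])
    show "(\<lambda>m. {\<zero>\<^bsub>E 0\<^esub>} +>\<^bsub>?C\<^esub> \<epsilon> m) \<in> mod_hom R (M\<lparr>carrier := ?A\<rparr>) (quot_module ?C {\<zero>\<^bsub>E 0\<^esub>})"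
    proof (rule mod_homI)
      show "{\<zero>\<^bsub>E 0\<^esub>} +>\<^bsub>?C\<^esub> \<epsilon> x \<in> carrier (quot_module ?C {\<zero>\<^bsub>E 0\<^esub>})" if "x \<in> carrier (M\<lparr>carrier := ?A\<rparr>)" for x
        using that Q.coset_in[of "\<epsilon> x"] by simp
      show "{\<zero>\<^bsub>E 0\<^esub>} +>\<^bsub>?C\<^esub> \<epsilon> (x \<oplus>\<^bsub>M\<lparr>carrier := ?A\<rparr>\<^esub> y) =
        ({\<zero>\<^bsub>E 0\<^esub>} +>\<^bsub>?C\<^esub> \<epsilon> x) \<oplus>\<^bsub>quot_module ?C {\<zero>\<^bsub>E 0\<^esub>}\<^esub> ({\<zero>\<^bsub>E 0\<^esub>} +>\<^bsub>?C\<^esub> \<epsilon> y)"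
        if "x \<in> carrier (M\<lparr>carrier := ?A\<rparr>)" "y \<in> carrier (M\<lparr>carrier := ?A\<rparr>)" for x y
        using that Q.coset_add[of "\<epsilon> x" "\<epsilon> y"] eh(2) by simp
      show "{\<zero>\<^bsub>E 0\<^esub>} +>\<^bsub>?C\<^esub> \<epsilon> (r \<odot>\<^bsub>M\<lparr>carrier := ?A\<rparr>\<^esub> x) =
        r \<odot>\<^bsub>quot_module ?C {\<zero>\<^bsub>E 0\<^esub>}\<^esub> ({\<zero>\<^bsub>E 0\<^esub>} +>\<^bsub>?C\<^esub> \<epsilon> x)"
        if "r \<in> carrier R" "x \<in> carrier (M\<lparr>carrier := ?A\<rparr>)" for r x
        using that Q.coset_smult[of r "\<epsilon> x"] eh(3) by simp
    qed
    have "\<epsilon> ` ?A = cocycles 0" unfolding cocycles_def ker_0 by auto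
    then show "(\<lambda>m. {\<zero>\<^bsub>E 0\<^esub>} +>\<^bsub>?C\<^esub> \<epsilon> m) ` carrier (M\<lparr>carrier := ?A\<rparr>) = carrier (quot_module ?C {\<zero>\<^bsub>E 0\<^esub>})"
      unfolding Q.carrier_quot by (simp add: image_image[symmetric])
  qed
qed

section \<open>Modules in dimension less than n\<close>

text \<open>As \<open>V\<close> is closed under specialization, a chain of primes that starts in
  \<open>V\<close> stays in \<open>V\<close>; conversely, a chain in \<open>V\<close> of length at
  least \<open>n\<close> can be cut off after \<open>n\<close> steps.\<close>

lemma dim_primes_less_iff:
  assumes "V \<subseteq> Spec R" "\<And>p q. p \<in> V \<Longrightarrow> q \<in> Spec R \<Longrightarrow> p \<subseteq> q \<Longrightarrow> q \<in> V"
  shows "dim_primes V < ereal (real n) \<longleftrightarrow> (\<forall>q\<in>V. \<not> coheight_ge R n q)"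
proof
  let ?K = "{k. \<exists>c :: nat \<Rightarrow> 'a set. (\<forall>i\<le>k. c i \<in> V) \<and> (\<forall>i<k. c i \<subset> c (Suc i))}"
  assume d: "dim_primes V < ereal (real n)"
  show "\<forall>q\<in>V. \<not> coheight_ge R n q"
  proof (intro ballI notI)
    fix q assume q: "q \<in> V" and "coheight_ge R n q"
    then obtain c where c: "c 0 = q" "\<And>i. i \<le> n \<Longrightarrow> c i \<in> Spec R" "\<And>i. i < n \<Longrightarrow> c i \<subset> c (Suc i)"
      by (auto simp: coheight_ge_def)
    have "q \<subseteq> c i" if "i \<le> n" for i
      using that
    proof (induct i)
      case (Suc i)
      then have "q \<subseteq> c i" by simp
      also have "c i \<subseteq> c (Suc i)" using c(3)[of i] Suc(2) by (simp add: psubset_eq)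
      finally show ?case .
    qed (simp add: c)
    then have "c i \<in> V" if "i \<le> n" for i using assms(2)[OF q c(2)] that by blast
    then have "n \<in> ?K" using c(3) by blast
    then have "ereal (real n) \<le> dim_primes V" unfolding dim_primes_def by (rule SUP_upper)
    then show False using d by simp
  qed
next
  let ?K = "{k. \<exists>c :: nat \<Rightarrow> 'a set. (\<forall>i\<le>k. c i \<in> V) \<and> (\<forall>i<k. c i \<subset> c (Suc i))}"
  assume *: "\<forall>q\<in>V. \<not> coheight_ge R n q"
  have less: "k < n" if kK: "k \<in> ?K" for k
  proof (rule ccontr)
    assume "\<not> k < n"
    obtain c where c: "\<forall>i\<le>k. c i \<in> V" "\<forall>i<k. c i \<subset> c (Suc i)" using kK by blast
    then have "coheight_ge R n (c 0)" unfolding coheight_ge_def using \<open>\<not> k < n\<close> assms(1)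
      by (intro exI[of _ c]) auto
    then show False using * c by blast
  qed
  \<comment> \<open>Each length being below \<open>n\<close> would not make the supremum strictly
    smaller; integrality of the lengths gives the uniform bound \<open>n - 1\<close>. For
    \<open>n = 0\<close> there are no chains, and the bound is \<open>-1\<close>.\<close>
  have "dim_primes V \<le> ereal (real n - 1)" unfolding dim_primes_def
  proof (rule SUP_least)
    fix k assume "k \<in> ?K"
    then have "k + 1 \<le> n" using less[of k] by simp
    then have "real (k + 1) \<le> real n" by (simp only: of_nat_le_iff)
    then show "ereal (real k) \<le> ereal (real n - 1)" by simp
  qed
  also have "\<dots> < ereal (real n)" by simp
  finally show "dim_primes V < ereal (real n)" .
qed

lemma Supp_specialization:
  assumes "module R (L :: ('r, 'm) module)" "p \<in> Supp R L" "q \<in> Spec R" "p \<subseteq> q"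
  shows "q \<in> Supp R L"
proof -
  obtain x where "x \<in> carrier L" "\<And>s. s \<in> carrier R - p \<Longrightarrow> s \<odot>\<^bsub>L\<^esub> x \<noteq> \<zero>\<^bsub>L\<^esub>"
    using assms(2) unfolding Supp_iff[OF assms(1)] by blast
  then show ?thesis using assms(3,4) unfolding Supp_iff[OF assms(1)] Spec_def by blast
qed

lemma (in rmodule) Supp_quot_iff:
  assumes N: "submodule N R M"
  shows "p \<in> Supp R (quot_module M N) \<longleftrightarrow>
    primeideal p R \<and> (\<exists>x\<in>carrier M. \<forall>s\<in>carrier R - p. s \<odot>\<^bsub>M\<^esub> x \<notin> N)"
proof -
  interpret Q: module_quotient R M N
    by (intro module_quotient.intro module_quotient_axioms.intro rmodule_axioms N)
  have "(\<exists>X\<in>carrier (quot_module M N). \<forall>s\<in>carrier R - p. s \<odot>\<^bsub>quot_module M N\<^esub> X \<noteq> \<zero>\<^bsub>quot_module M N\<^esub>) \<longleftrightarrow>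
    (\<exists>x\<in>carrier M. \<forall>s\<in>carrier R - p. s \<odot>\<^bsub>M\<^esub> x \<notin> N)"
    unfolding Q.carrier_quot by (simp add: Q.coset_smult Q.coset_eq_iff_zero)
  then show ?thesis by (simp add: Supp_iff[OF Q.module_quot])
qed

text \<open>Support and dimension are traded for the vanishing of \<open>M/N\<close> at all primes
  of coheight at least \<open>n\<close>, where \<open>x\<close> vanishes at \<open>q\<close> if some
  \<open>s\<close> outside \<open>q\<close> takes it into \<open>N\<close>.\<close>

lemma (in rmodule) in_dim_less_iff:
  "in_dim_less R M n \<longleftrightarrow> (\<exists>N. fg_submodule R M N \<and>
     (\<forall>q\<in>Spec R. coheight_ge R n q \<longrightarrow> (\<forall>x\<in>carrier M. \<exists>s\<in>carrier R - q. s \<odot>\<^bsub>M\<^esub> x \<in> N)))"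
proof -
  have "dim_primes (Supp R (quot_module M N)) < ereal (real n) \<longleftrightarrow>
    (\<forall>q\<in>Spec R. coheight_ge R n q \<longrightarrow> (\<forall>x\<in>carrier M. \<exists>s\<in>carrier R - q. s \<odot>\<^bsub>M\<^esub> x \<in> N))"
    if "fg_submodule R M N" for N
  proof -
    have N: "submodule N R M" using that gen_submodule by (auto simp: fg_submodule_def)
    interpret Q: module_quotient R M N
      by (intro module_quotient.intro module_quotient_axioms.intro rmodule_axioms N)
    have "dim_primes (Supp R (quot_module M N)) < ereal (real n) \<longleftrightarrow>
      (\<forall>q\<in>Supp R (quot_module M N). \<not> coheight_ge R n q)"
    proof (rule dim_primes_less_iff)
      show "Supp R (quot_module M N) \<subseteq> Spec R" by (auto simp: Supp_def)
    qed (rule Supp_specialization[OF Q.module_quot])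
    then show ?thesis unfolding Supp_quot_iff[OF N] Ball_def Spec_def by blast
  qed
  then show ?thesis by (auto simp: in_dim_less_def)
qed

section \<open>From dimension to annihilation\<close>

lemma (in rmodule) ideal_smult_eq:
  assumes I: "ideal I R"
  defines "G \<equiv> gen_submodule R M {r \<odot>\<^bsub>M\<^esub> x |r x. r \<in> I \<and> x \<in> carrier M}"
  shows "ideal_smult R I M = M\<lparr>carrier := G\<rparr>" "submodule G R M"
    "r \<in> I \<Longrightarrow> x \<in> carrier M \<Longrightarrow> r \<odot>\<^bsub>M\<^esub> x \<in> G"
    "submodule N R M \<Longrightarrow> (\<And>r x. r \<in> I \<Longrightarrow> x \<in> carrier M \<Longrightarrow> r \<odot>\<^bsub>M\<^esub> x \<in> N) \<Longrightarrow> G \<subseteq> N"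
proof -
  have sub: "{r \<odot>\<^bsub>M\<^esub> x |r x. r \<in> I \<and> x \<in> carrier M} \<subseteq> carrier M"
    using ideal.Icarr[OF I] by auto
  show "ideal_smult R I M = M\<lparr>carrier := G\<rparr>" by (simp add: ideal_smult_def G_def)
  show "submodule G R M" unfolding G_def by (rule gen_submodule[OF sub])
  show "r \<in> I \<Longrightarrow> x \<in> carrier M \<Longrightarrow> r \<odot>\<^bsub>M\<^esub> x \<in> G"
    unfolding G_def by (rule subsetD[OF gen_submodule_subset]) blast
  show "submodule N R M \<Longrightarrow> (\<And>r x. r \<in> I \<Longrightarrow> x \<in> carrier M \<Longrightarrow> r \<odot>\<^bsub>M\<^esub> x \<in> N) \<Longrightarrow> G \<subseteq> N"
    unfolding G_def by (rule gen_submodule_minimal) auto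
qed

text \<open>The whole module can serve as the finitely generated submodule. The quotient then has
  empty support, so even \<open>n = 0\<close> is allowed.\<close>

lemma in_dim_less_noeth:
  assumes "noeth_module R (L :: ('r, 'm) module)" "ideal J R"
  shows "in_dim_less R (ideal_smult R J L) n"
proof -
  interpret rmodule R L using assms(1) by (intro rmodule.intro) (simp add: noeth_module_def)
  define G where "G = gen_submodule R L {r \<odot>\<^bsub>L\<^esub> x |r x. r \<in> J \<and> x \<in> carrier L}"
  note G = ideal_smult_eq[OF assms(2), folded G_def]
  interpret G: rmodule R "L\<lparr>carrier := G\<rparr>"
    by (intro rmodule.intro submodule.submodule_is_module[OF G(2)] module_axioms)
  have "fg_submodule R (L\<lparr>carrier := G\<rparr>) G"
    using assms(1) G(2) by (simp add: fg_submodule_restrict[OF G(2)] noeth_module_def)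
  moreover have "\<exists>s\<in>carrier R - q. s \<odot>\<^bsub>L\<^esub> x \<in> G" if "q \<in> Spec R" "x \<in> G" for q x
  proof -
    interpret q: primeideal q R using that by (simp add: Spec_def)
    have "\<one>\<^bsub>R\<^esub> \<in> carrier R - q" using q.I_notcarr q.one_imp_carrier by auto
    moreover have "\<one>\<^bsub>R\<^esub> \<odot>\<^bsub>L\<^esub> x \<in> G" using that submodule_closed(1)[OF G(2)] by auto
    ultimately show ?thesis by blast
  qed
  ultimately show ?thesis unfolding G(1) G.in_dim_less_iff by (intro exI[of _ G]) auto
qed

lemma inner_germ_cong:
  assumes "cring R" "ideal I R" "\<And>r. r \<in> ideal_power R I k \<Longrightarrow> f r = g r"
  shows "inner_germ R I M k f \<longleftrightarrow> inner_germ R I M k g"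
  using assms(3) cring.ideal_power_antimono[OF assms(1,2)] unfolding inner_germ_def by (metis subsetD)

lemma (in resolved) in_dim_less_H1_iff:
  assumes \<iota>: "inj (\<iota> :: 'r \<Rightarrow> 'e)" and J: "ideal J R" and JI: "J \<subseteq> I"
  shows "(\<exists>t\<ge>1. in_dim_less R (ideal_smult R (ideal_power R J t) H1) n) \<longleftrightarrow>
    (\<exists>t. \<forall>q\<in>Spec R. coheight_ge R n q \<longrightarrow> killed_at R I J M t q)"
proof
  interpret H: rmodule R H1 by (intro rmodule.intro H1_module)
  note Jt = R.ideal_power_ideal[OF J] and Jcar = R.ideal_power_carrier[OF J]
  assume "\<exists>t\<ge>1. in_dim_less R (ideal_smult R (ideal_power R J t) H1) n"
  then obtain t where t: "in_dim_less R (ideal_smult R (ideal_power R J t) H1) n" by blast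
  define G where "G = gen_submodule R H1 {r \<odot>\<^bsub>H1\<^esub> x |r x. r \<in> ideal_power R J t \<and> x \<in> carrier H1}"
  note G = H.ideal_smult_eq[OF Jt[of t], folded G_def]
  interpret G: rmodule R "H1\<lparr>carrier := G\<rparr>"
    by (intro rmodule.intro submodule.submodule_is_module[OF G(2)] H1_module)
  obtain N where N: "fg_submodule R H1 N" "N \<subseteq> G" and
    NG: "\<And>q x. q \<in> Spec R \<Longrightarrow> coheight_ge R n q \<Longrightarrow> x \<in> G \<Longrightarrow> \<exists>s\<in>carrier R - q. s \<odot>\<^bsub>H1\<^esub> x \<in> N"
    using t unfolding G(1) G.in_dim_less_iff by (auto simp: H.fg_submodule_restrict[OF G(2)])
  obtain X where X: "finite X" "X \<subseteq> carrier H1" "N = gen_submodule R H1 X"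
    using N(1) by (auto simp: fg_submodule_def)
  have "\<forall>x\<in>X. \<exists>k. \<forall>r\<in>ideal_power R I k. r \<odot>\<^bsub>H1\<^esub> x = \<zero>\<^bsub>H1\<^esub>" using H1_torsion X(2) by blast
  then obtain k where k: "\<And>x r. x \<in> X \<Longrightarrow> r \<in> ideal_power R I (k x) \<Longrightarrow> r \<odot>\<^bsub>H1\<^esub> x = \<zero>\<^bsub>H1\<^esub>" by metis
  \<comment> \<open>With this exponent, the power of \<open>J\<close> kills all generators of
    \<open>N\<close>, hence \<open>N\<close>.\<close>
  define K where "K = Max (insert 0 (k ` X))"
  let ?A = "{y \<in> carrier H1. \<forall>r\<in>ideal_power R J K. r \<odot>\<^bsub>H1\<^esub> y = \<zero>\<^bsub>H1\<^esub>}"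
  have "submodule ?A R H1"
    using Jcar[of _ K] H.smult_comm by (intro H.submoduleI') (auto simp: H.smult_r_distr)
  moreover have "X \<subseteq> ?A"
  proof
    fix x assume x: "x \<in> X"
    have "k x \<le> K" using X(1) x by (simp add: K_def)
    then have "ideal_power R J K \<subseteq> ideal_power R I (k x)"
      using R.ideal_power_mono[OF JI, of K] R.ideal_power_antimono[OF I, of "k x" K] by blast
    then show "x \<in> ?A" using k[OF x] X(2) x by auto
  qed
  ultimately have NA: "N \<subseteq> ?A" unfolding X(3) by (rule H.gen_submodule_minimal)
  have "killed_at R I J M (t + K) q" if q: "q \<in> Spec R" "coheight_ge R n q" for q
    unfolding killed_at_def
  proof (intro allI ballI)
    interpret q: primeideal q R using q by (simp add: Spec_def)
    fix m f \<beta> assume f: "f \<in> ideal_hom R I m M" and \<beta>: "\<beta> \<in> ideal_power R J (t + K)"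
    obtain z where z: "z \<in> carrier H1" and iff: "\<And>r. r \<in> carrier R \<Longrightarrow>
      r \<odot>\<^bsub>H1\<^esub> z = \<zero>\<^bsub>H1\<^esub> \<longleftrightarrow> inner_germ R I M m (\<lambda>\<rho>. r \<odot>\<^bsub>M\<^esub> f \<rho>)"
      using class_of_germ[OF \<iota> f] by blast
    \<comment> \<open>For a product, \<open>a\<close> takes \<open>z\<close> into \<open>G\<close>,
      some \<open>s\<close> outside \<open>q\<close> takes the result into \<open>N\<close>, and
      \<open>b\<close> kills \<open>N\<close>. For a sum, the two multipliers are multiplied
      together and stay outside \<open>q\<close> by primality.\<close>
    from J \<beta> have "\<exists>s\<in>carrier R - q. (s \<otimes> \<beta>) \<odot>\<^bsub>H1\<^esub> z = \<zero>\<^bsub>H1\<^esub>"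
    proof (rule R.ideal_power_add_induct)
      fix a b assume a: "a \<in> ideal_power R J t" and b: "b \<in> ideal_power R J K"
      obtain s where s: "s \<in> carrier R - q" "s \<odot>\<^bsub>H1\<^esub> (a \<odot>\<^bsub>H1\<^esub> z) \<in> N" using NG[OF q G(3)[OF a z]] by blast
      have "b \<odot>\<^bsub>H1\<^esub> (s \<odot>\<^bsub>H1\<^esub> (a \<odot>\<^bsub>H1\<^esub> z)) = \<zero>\<^bsub>H1\<^esub>" using NA s b by auto
      moreover have "(s \<otimes> (a \<otimes> b)) \<odot>\<^bsub>H1\<^esub> z = b \<odot>\<^bsub>H1\<^esub> (s \<odot>\<^bsub>H1\<^esub> (a \<odot>\<^bsub>H1\<^esub> z))"
        using s Jcar[OF a] Jcar[OF b] z by (simp add: H.smult_assoc1[symmetric] R.m_ac)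
      ultimately show "\<exists>s\<in>carrier R - q. (s \<otimes> (a \<otimes> b)) \<odot>\<^bsub>H1\<^esub> z = \<zero>\<^bsub>H1\<^esub>" using s by auto
    next
      fix a b assume ab: "a \<in> carrier R" "b \<in> carrier R"
        and "\<exists>s\<in>carrier R - q. (s \<otimes> a) \<odot>\<^bsub>H1\<^esub> z = \<zero>\<^bsub>H1\<^esub>" "\<exists>s\<in>carrier R - q. (s \<otimes> b) \<odot>\<^bsub>H1\<^esub> z = \<zero>\<^bsub>H1\<^esub>"
      then obtain s u where su: "s \<in> carrier R" "u \<in> carrier R" "s \<notin> q" "u \<notin> q"
        "(s \<otimes> a) \<odot>\<^bsub>H1\<^esub> z = \<zero>\<^bsub>H1\<^esub>" "(u \<otimes> b) \<odot>\<^bsub>H1\<^esub> z = \<zero>\<^bsub>H1\<^esub>" by auto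
      have "((s \<otimes> u) \<otimes> (a \<oplus> b)) \<odot>\<^bsub>H1\<^esub> z = u \<odot>\<^bsub>H1\<^esub> ((s \<otimes> a) \<odot>\<^bsub>H1\<^esub> z) \<oplus>\<^bsub>H1\<^esub> s \<odot>\<^bsub>H1\<^esub> ((u \<otimes> b) \<odot>\<^bsub>H1\<^esub> z)"
        using su(1,2) ab z by (simp add: H.smult_assoc1[symmetric] H.smult_l_distr[symmetric] R.r_distr R.m_ac)
      then have "((s \<otimes> u) \<otimes> (a \<oplus> b)) \<odot>\<^bsub>H1\<^esub> z = \<zero>\<^bsub>H1\<^esub>" using su by simp
      moreover have "s \<otimes> u \<in> carrier R - q" using su q.I_prime by auto
      ultimately show "\<exists>s\<in>carrier R - q. (s \<otimes> (a \<oplus> b)) \<odot>\<^bsub>H1\<^esub> z = \<zero>\<^bsub>H1\<^esub>" by blast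
    qed
    then show "\<exists>s\<in>carrier R - q. inner_germ R I M m (\<lambda>r. (s \<otimes> \<beta>) \<odot>\<^bsub>M\<^esub> f r)"
      using iff Jcar[OF \<beta>] by auto
  qed
  then show "\<exists>t. \<forall>q\<in>Spec R. coheight_ge R n q \<longrightarrow> killed_at R I J M t q" by blast
next
  interpret H: rmodule R H1 by (intro rmodule.intro H1_module)
  note Jt = R.ideal_power_ideal[OF J] and Jcar = R.ideal_power_carrier[OF J]
  assume "\<exists>t. \<forall>q\<in>Spec R. coheight_ge R n q \<longrightarrow> killed_at R I J M t q"
  then obtain t where t: "\<And>q. q \<in> Spec R \<Longrightarrow> coheight_ge R n q \<Longrightarrow> killed_at R I J M t q" by blast
  \<comment> \<open>\<open>Suc t\<close> instead of \<open>t\<close>, because the exponent has to be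
    at least 1.\<close>
  define G where "G = gen_submodule R H1 {r \<odot>\<^bsub>H1\<^esub> x |r x. r \<in> ideal_power R J (Suc t) \<and> x \<in> carrier H1}"
  note G = H.ideal_smult_eq[OF Jt[of "Suc t"], folded G_def]
  interpret G: rmodule R "H1\<lparr>carrier := G\<rparr>"
    by (intro rmodule.intro submodule.submodule_is_module[OF G(2)] H1_module)
  have "\<exists>s\<in>carrier R - q. s \<odot>\<^bsub>H1\<^esub> x = \<zero>\<^bsub>H1\<^esub>" if q: "q \<in> Spec R" "coheight_ge R n q" and x: "x \<in> G" for q x
  proof -
    interpret q: primeideal q R using q by (simp add: Spec_def)
    let ?A = "{y \<in> carrier H1. \<exists>s\<in>carrier R - q. s \<odot>\<^bsub>H1\<^esub> y = \<zero>\<^bsub>H1\<^esub>}"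
    have "submodule ?A R H1"
    proof (rule H.submoduleI')
      have "\<one> \<in> carrier R - q" using q.I_notcarr q.one_imp_carrier by auto
      then show "\<zero>\<^bsub>H1\<^esub> \<in> ?A" by auto
      fix x y assume "x \<in> ?A" "y \<in> ?A"
      then obtain s u where su: "x \<in> carrier H1" "y \<in> carrier H1" "s \<in> carrier R" "u \<in> carrier R" "s \<notin> q" "u \<notin> q"
        "s \<odot>\<^bsub>H1\<^esub> x = \<zero>\<^bsub>H1\<^esub>" "u \<odot>\<^bsub>H1\<^esub> y = \<zero>\<^bsub>H1\<^esub>" by auto
      have "(s \<otimes> u) \<odot>\<^bsub>H1\<^esub> (x \<oplus>\<^bsub>H1\<^esub> y) = u \<odot>\<^bsub>H1\<^esub> (s \<odot>\<^bsub>H1\<^esub> x) \<oplus>\<^bsub>H1\<^esub> s \<odot>\<^bsub>H1\<^esub> (u \<odot>\<^bsub>H1\<^esub> y)"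
        using su(1-4) by (simp add: H.smult_assoc1[symmetric] H.smult_r_distr R.m_comm)
      then have "(s \<otimes> u) \<odot>\<^bsub>H1\<^esub> (x \<oplus>\<^bsub>H1\<^esub> y) = \<zero>\<^bsub>H1\<^esub>" using su by simp
      moreover have "s \<otimes> u \<in> carrier R - q" using su q.I_prime by auto
      ultimately show "x \<oplus>\<^bsub>H1\<^esub> y \<in> ?A" using su by blast
    next
      fix r x assume "r \<in> carrier R" "x \<in> ?A"
      then obtain s where s: "x \<in> carrier H1" "s \<in> carrier R - q" "s \<odot>\<^bsub>H1\<^esub> x = \<zero>\<^bsub>H1\<^esub>" by auto
      then have "s \<odot>\<^bsub>H1\<^esub> (r \<odot>\<^bsub>H1\<^esub> x) = \<zero>\<^bsub>H1\<^esub>" using H.smult_comm[of s r x] \<open>r \<in> carrier R\<close> by simp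
      then show "r \<odot>\<^bsub>H1\<^esub> x \<in> ?A" using s \<open>r \<in> carrier R\<close> by blast
    qed auto
    moreover have "\<beta> \<odot>\<^bsub>H1\<^esub> z \<in> ?A" if \<beta>: "\<beta> \<in> ideal_power R J (Suc t)" and z: "z \<in> carrier H1" for \<beta> z
    proof -
      obtain k f where f: "f \<in> ideal_hom R I k M" and iff: "\<And>r. r \<in> carrier R \<Longrightarrow>
        r \<odot>\<^bsub>H1\<^esub> z = \<zero>\<^bsub>H1\<^esub> \<longleftrightarrow> inner_germ R I M k (\<lambda>\<rho>. r \<odot>\<^bsub>M\<^esub> f \<rho>)"
        using germ_of_class[OF z] by blast
      have \<beta>t: "\<beta> \<in> ideal_power R J t" using \<beta> R.ideal_power_antimono[OF J, of t "Suc t"] by auto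
      obtain s where s: "s \<in> carrier R - q" "inner_germ R I M k (\<lambda>r. (s \<otimes> \<beta>) \<odot>\<^bsub>M\<^esub> f r)"
        using t[OF q] f \<beta>t unfolding killed_at_def by blast
      then have "(s \<otimes> \<beta>) \<odot>\<^bsub>H1\<^esub> z = \<zero>\<^bsub>H1\<^esub>" using iff[of "s \<otimes> \<beta>"] Jcar[OF \<beta>] by simp
      then have "s \<odot>\<^bsub>H1\<^esub> (\<beta> \<odot>\<^bsub>H1\<^esub> z) = \<zero>\<^bsub>H1\<^esub>" using s Jcar[OF \<beta>] z by (simp add: H.smult_assoc1)
      then show ?thesis using s Jcar[OF \<beta>] z by auto
    qed
    ultimately have "G \<subseteq> ?A" by (rule G(4))
    then show ?thesis using x by auto
  qed
  \<comment> \<open>Zero suffices as finitely generated submodule, since \<open>G\<close> vanishes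
    at every prime of coheight at least \<open>n\<close>.\<close>
  then have "in_dim_less R (ideal_smult R (ideal_power R J (Suc t)) H1) n"
    unfolding G(1) G.in_dim_less_iff using G.fg_zero by (intro exI[of _ "{\<zero>\<^bsub>H1\<^esub>}"]) auto
  then show "\<exists>t\<ge>1. in_dim_less R (ideal_smult R (ideal_power R J t) H1) n" by (intro exI[of _ "Suc t"]) simp
qed

text \<open>Degree 0 never obstructs, because \<open>H\<^sup>0\<close> is Noetherian, so the infimum
  exceeds 1 exactly if degree 1 does not obstruct. Existence of a resolution in the universe type is
  what makes the one selected by \<open>SOME\<close> a resolution.\<close>

lemma h_dim_greater_one_iff:
  fixes R :: "('r, 'k) ring_scheme" and M :: "('r, 'm) module"
  assumes M: "noeth_module R M" and I: "ideal I R" and J: "ideal J R" and JI: "J \<subseteq> I"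
  shows "h_dim R I J M n > 1 \<longleftrightarrow>
    (\<exists>t. \<forall>q\<in>Spec R. coheight_ge R n q \<longrightarrow> killed_at R I J M t q)"
proof -
  have mod: "module R M" using M by (simp add: noeth_module_def)
  interpret rmodule R M by (intro rmodule.intro mod)
  let ?P = "\<lambda>s. case s of (E :: nat \<Rightarrow> ('r, ('r, 'm) univ) module, d) \<Rightarrow> \<exists>\<epsilon>. injective_resolution R M \<epsilon> E d"
  have "\<exists>s. ?P s" using ex_injective_resolution[OF mod] by auto
  then have "?P (inj_res R M)" unfolding inj_res_def by (rule someI_ex)
  moreover obtain E d where Ed: "inj_res R M = (E, d)" by (cases "inj_res R M")
  ultimately obtain \<epsilon> where res: "injective_resolution R M \<epsilon> E d" by auto
  interpret resolved R M I \<epsilon> E d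
    by (intro resolved.intro resolved_axioms.intro rmodule_axioms I res)
  obtain \<iota> :: "'r \<Rightarrow> ('r, 'm) univ" where \<iota>: "inj \<iota>" using ex_inj_self_univ by blast
  define A where "A = {i. \<forall>t\<ge>1. \<not> in_dim_less R (ideal_smult R (ideal_power R J t) (local_cohomology R I i M)) n}"
  have lc: "local_cohomology R I i M = torsion_cohomology R I E d i" for i
    by (simp add: local_cohomology_def Ed)
  have 0: "0 \<notin> A"
    unfolding A_def lc using in_dim_less_noeth[OF noeth_H0[OF M] R.ideal_power_ideal[OF J], of 1 n] by auto
  have 1: "Suc 0 \<notin> A \<longleftrightarrow> (\<exists>t. \<forall>q\<in>Spec R. coheight_ge R n q \<longrightarrow> killed_at R I J M t q)"
    unfolding A_def lc in_dim_less_H1_iff[OF \<iota> J JI, symmetric] by auto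
  have "h_dim R I J M n = Inf (enat ` A)" by (simp add: h_dim_def A_def)
  moreover have "1 < Inf (enat ` A) \<longleftrightarrow> Suc 0 \<notin> A"
  proof
    assume *: "1 < Inf (enat ` A)"
    show "Suc 0 \<notin> A"
    proof
      assume "Suc 0 \<in> A"
      then have "Inf (enat ` A) \<le> enat (Suc 0)" by (intro Inf_lower) auto
      then show False using * by (simp add: one_enat_def)
    qed
  next
    assume *: "Suc 0 \<notin> A"
    \<comment> \<open>This bound also covers an empty set of obstructions, whose infimum is
      infinite.\<close>
    have "enat 2 \<le> Inf (enat ` A)"
    proof (rule Inf_greatest)
      fix x assume "x \<in> enat ` A"
      then obtain i where i: "i \<in> A" "x = enat i" by auto
      then have "i \<noteq> 0" "i \<noteq> Suc 0" using 0 * by metis+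
      then show "enat 2 \<le> x" using i by simp
    qed
    moreover have "(1 :: enat) < enat 2" by (simp add: one_enat_def)
    ultimately show "1 < Inf (enat ` A)" by (rule less_le_trans[rotated])
  qed
  ultimately show ?thesis using 1 by simp
qed

section \<open>Uniform annihilation\<close>

text \<open>The associated primes of \<open>M/N\<close>, expressed inside \<open>M\<close> so that
  \<open>N\<close> can vary without a change of type.\<close>

definition colon_primes :: "('r, 'k) ring_scheme \<Rightarrow> ('r, 'm) module \<Rightarrow> 'm set \<Rightarrow> 'r set set" where
  "colon_primes R M N = {p. primeideal p R \<and> (\<exists>v\<in>carrier M. p = {r \<in> carrier R. r \<odot>\<^bsub>M\<^esub> v \<in> N})}"

text \<open>Noetherian induction from larger to smaller \<open>N\<close>. An associated prime
  \<open>p\<close> realized by \<open>w\<close> gives \<open>N' = N + R w\<close> with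
  \<open>N'/N\<close> isomorphic to \<open>R/p\<close>, and every associated prime of
  \<open>M/N\<close> is \<open>p\<close> or an associated prime of \<open>M/N'\<close>.\<close>

lemma finite_colon_primes:
  fixes M :: "('r, 'm) module"
  assumes M: "noeth_module R M" and N: "submodule N R M"
  shows "finite (colon_primes R M N)"
  using wf_submodules[OF M] N
proof (induct N rule: wf_induct_rule)
  case (less N)
  interpret rmodule R M using M by (intro rmodule.intro) (simp add: noeth_module_def)
  note Ncl = submodule_closed[OF less(2)]
  show ?case
  proof (cases "colon_primes R M N = {}")
    case False
    then obtain p w where p: "primeideal p R" and w: "w \<in> carrier M" and pw: "p = {r \<in> carrier R. r \<odot>\<^bsub>M\<^esub> w \<in> N}"
      by (auto simp: colon_primes_def)
    interpret p: primeideal p R by fact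
    define N' where "N' = gen_submodule R M (insert w N)"
    have iN: "insert w N \<subseteq> carrier M" using w Ncl(1) by auto
    have N': "submodule N' R M" unfolding N'_def by (rule gen_submodule[OF iN])
    have "w \<notin> N"
    proof
      assume "w \<in> N"
      then have "\<one>\<^bsub>R\<^esub> \<in> p" using w unfolding pw by simp
      then show False using p.I_notcarr p.one_imp_carrier by blast
    qed
    moreover have "insert w N \<subseteq> N'" unfolding N'_def by (rule gen_submodule_subset)
    ultimately have "N \<subset> N'" by blast
    then have fin: "finite (colon_primes R M N')" using less(1)[of N'] less(2) N' by blast
    have N'E: "\<exists>s\<in>carrier R. \<exists>n\<in>N. z = s \<odot>\<^bsub>M\<^esub> w \<oplus>\<^bsub>M\<^esub> n" if "z \<in> N'" for z
    proof -
      have "gen_submodule R M N \<subseteq> N" by (rule gen_submodule_minimal[OF less(2)]) simp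
      then show ?thesis using gen_submodule_insert[OF Ncl(1) w that[unfolded N'_def]] by blast
    qed
    have "colon_primes R M N \<subseteq> insert p (colon_primes R M N')"
    proof
      fix p' assume "p' \<in> colon_primes R M N"
      then obtain v where p': "primeideal p' R" and v: "v \<in> carrier M" and pv: "p' = {r \<in> carrier R. r \<odot>\<^bsub>M\<^esub> v \<in> N}"
        by (auto simp: colon_primes_def)
      interpret p': primeideal p' R by fact
      show "p' \<in> insert p (colon_primes R M N')"
      \<comment> \<open>Either all multiples of \<open>v\<close> in \<open>N'\<close> already lie in
        \<open>N\<close>, and \<open>v\<close> realizes the same prime for \<open>N'\<close>; or
        some multiple of \<open>v\<close> is nonzero in \<open>N'/N\<close>. In that case its
        annihilator is \<open>p'\<close> as a multiple of \<open>v\<close> and \<open>p\<close> as a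
        nonzero element of a copy of \<open>R/p\<close>.\<close>
      proof (cases "\<forall>r\<in>carrier R. r \<odot>\<^bsub>M\<^esub> v \<in> N' \<longrightarrow> r \<odot>\<^bsub>M\<^esub> v \<in> N")
        case True
        then have "p' = {r \<in> carrier R. r \<odot>\<^bsub>M\<^esub> v \<in> N'}" unfolding pv
          using psubset_imp_subset[OF \<open>N \<subset> N'\<close>] by (intro Collect_cong) auto
        then have "p' \<in> colon_primes R M N'"
          using p' v unfolding colon_primes_def mem_Collect_eq by (intro conjI bexI[of _ v])
        then show ?thesis by simp
      next
        case False
        then obtain r where r: "r \<in> carrier R" "r \<odot>\<^bsub>M\<^esub> v \<in> N'" "r \<odot>\<^bsub>M\<^esub> v \<notin> N" by blast
        obtain s n where sn: "s \<in> carrier R" "n \<in> N" "r \<odot>\<^bsub>M\<^esub> v = s \<odot>\<^bsub>M\<^esub> w \<oplus>\<^bsub>M\<^esub> n" using N'E[OF r(2)] by blast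
        have nM: "n \<in> carrier M" using sn Ncl(1) by auto
        have key: "(c \<otimes>\<^bsub>R\<^esub> r) \<odot>\<^bsub>M\<^esub> v \<in> N \<longleftrightarrow> (c \<otimes>\<^bsub>R\<^esub> s) \<odot>\<^bsub>M\<^esub> w \<in> N" if c: "c \<in> carrier R" for c
        proof -
          have e: "(c \<otimes>\<^bsub>R\<^esub> r) \<odot>\<^bsub>M\<^esub> v = (c \<otimes>\<^bsub>R\<^esub> s) \<odot>\<^bsub>M\<^esub> w \<oplus>\<^bsub>M\<^esub> c \<odot>\<^bsub>M\<^esub> n"
            using c r sn v w nM by (simp add: smult_assoc1 smult_r_distr)
          have cn: "c \<odot>\<^bsub>M\<^esub> n \<in> N" using Ncl(6)[OF c sn(2)] .
          have l: "(c \<otimes>\<^bsub>R\<^esub> s) \<odot>\<^bsub>M\<^esub> w = (c \<otimes>\<^bsub>R\<^esub> r) \<odot>\<^bsub>M\<^esub> v \<ominus>\<^bsub>M\<^esub> c \<odot>\<^bsub>M\<^esub> n"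
            unfolding e using c sn w nM by (simp add: M.minus_eq M.a_assoc M.r_neg)
          show ?thesis
          proof
            assume "(c \<otimes>\<^bsub>R\<^esub> r) \<odot>\<^bsub>M\<^esub> v \<in> N"
            then show "(c \<otimes>\<^bsub>R\<^esub> s) \<odot>\<^bsub>M\<^esub> w \<in> N" unfolding l by (rule Ncl(5)[OF _ cn])
          next
            assume "(c \<otimes>\<^bsub>R\<^esub> s) \<odot>\<^bsub>M\<^esub> w \<in> N"
            then show "(c \<otimes>\<^bsub>R\<^esub> r) \<odot>\<^bsub>M\<^esub> v \<in> N" unfolding e by (rule Ncl(3)[OF _ cn])
          qed
        qed
        have sp: "s \<notin> p" using r(3) sn Ncl(3) unfolding pw by auto
        have rp': "r \<notin> p'" using r(3) unfolding pv by simp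
        have "c \<in> p' \<longleftrightarrow> c \<in> p" if c: "c \<in> carrier R" for c
        proof -
          have "c \<in> p' \<longleftrightarrow> c \<otimes>\<^bsub>R\<^esub> r \<in> p'" using p'.I_prime[OF c r(1)] p'.ideal_closed(5)[OF r(1)] rp' by blast
          also have "\<dots> \<longleftrightarrow> c \<otimes>\<^bsub>R\<^esub> s \<in> p" using key[OF c] c r(1) sn(1) unfolding pv pw by simp
          also have "\<dots> \<longleftrightarrow> c \<in> p" using p.I_prime[OF c sn(1)] p.ideal_closed(5)[OF sn(1)] sp by blast
          finally show ?thesis .
        qed
        then have "p' = p" using p.ideal_closed(1) p'.ideal_closed(1) by blast
        then show ?thesis by simp
      qed
    qed
    then show ?thesis using fin finite_subset by blast
  qed simp
qed

text \<open>A maximal one among the colon ideals of \<open>\<aa>\<close> contained in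
  \<open>q\<close> is prime. Bounding them by \<open>q\<close> refines the usual existence proof for
  associated primes: it produces one below a prescribed prime.\<close>

lemma (in noetherian_ring) ex_prime_colon:
  assumes R: "cring R" and a: "ideal \<aa> R" and q: "primeideal q R" and aq: "\<aa> \<subseteq> q"
  shows "\<exists>c\<in>carrier R. primeideal {r \<in> carrier R. r \<otimes> c \<in> \<aa>} R \<and> {r \<in> carrier R. r \<otimes> c \<in> \<aa>} \<subseteq> q"
proof -
  interpret cring R by fact
  interpret a: ideal \<aa> R by fact
  interpret q: primeideal q R by fact
  define col where "col c = {r \<in> carrier R. r \<otimes> c \<in> \<aa>}" for c
  have col_ideal: "ideal (col c) R" if "c \<in> carrier R" for c
    using that a.ideal_closed by (intro idealI') (auto simp: col_def l_distr m_assoc)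
  have col_mono: "col c \<subseteq> col (u \<otimes> c)" if "c \<in> carrier R" "u \<in> carrier R" for c u
  proof
    fix r assume r: "r \<in> col c"
    then have "u \<otimes> (r \<otimes> c) \<in> \<aa>" using a.ideal_closed(4) that by (simp add: col_def)
    then show "r \<in> col (u \<otimes> c)" using r that by (simp add: col_def m_lcomm)
  qed
  let ?F = "{col c | c. c \<in> carrier R \<and> col c \<subseteq> q}"
  have "col \<one> = \<aa>" using a.ideal_closed(1) by (auto simp: col_def)
  then have aF: "\<aa> \<in> ?F" using aq by blast
  let ?r = "{(B, A). submodule A R (self_module R) \<and> submodule B R (self_module R) \<and> A \<subset> B}"
  \<comment> \<open>Minimality for the order of \<open>wf_submodules\<close> is maximality for
    inclusion.\<close>
  have "\<exists>p\<in>?F. \<forall>y. (y, p) \<in> ?r \<longrightarrow> y \<notin> ?F"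
    by (rule wf_submodules[OF noeth_self[OF R], unfolded wf_eq_minimal, rule_format, OF aF])
  then obtain p where p: "p \<in> ?F" and max: "\<forall>y. (y, p) \<in> ?r \<longrightarrow> y \<notin> ?F" by (elim bexE)
  from p obtain c where c: "c \<in> carrier R" "p = col c" "col c \<subseteq> q" by blast
  have maxc: "col (u \<otimes> c) = col c" if "u \<in> carrier R" "col (u \<otimes> c) \<subseteq> q" for u
  proof (rule ccontr)
    assume "col (u \<otimes> c) \<noteq> col c"
    then have "col c \<subset> col (u \<otimes> c)" using col_mono[OF c(1) that(1)] by blast
    then have "(col (u \<otimes> c), p) \<in> {(B, A). submodule A R (self_module R) \<and> submodule B R (self_module R) \<and> A \<subset> B}"
      using col_ideal c that by (simp add: submodule_self)
    then have "col (u \<otimes> c) \<notin> ?F" by (rule max[rule_format])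
    moreover have "u \<otimes> c \<in> carrier R" using that c by simp
    ultimately show False using that(2) by blast
  qed
  have "primeideal (col c) R"
  proof (rule primeidealI)
    show "ideal (col c) R" by (rule col_ideal[OF c(1)])
    show "cring R" by fact
    show "carrier R \<noteq> col c" using c(3) q.I_notcarr q.ideal_closed(1) by blast
    fix u v assume u: "u \<in> carrier R" and v: "v \<in> carrier R" and uv: "u \<otimes> v \<in> col c"
    show "u \<in> col c \<or> v \<in> col c"
    proof (cases "col (u \<otimes> c) \<subseteq> q")
      case True
      have "v \<in> col (u \<otimes> c)" using uv u v c by (simp add: col_def m_ac)
      then show ?thesis using maxc[OF u True] by simp
    next
      case False
      \<comment> \<open>Here \<open>s u c\<close> lies in \<open>\<aa>\<close> while
        \<open>s\<close> is outside \<open>q\<close>. As \<open>q\<close> is prime, replacing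
        \<open>c\<close> by \<open>s c\<close> keeps the colon ideal inside \<open>q\<close>; by
        maximality it does not grow, and it contains \<open>u\<close>.\<close>
      then obtain s where s: "s \<in> col (u \<otimes> c)" "s \<notin> q" by blast
      then have sR: "s \<in> carrier R" by (simp add: col_def)
      have "col (s \<otimes> c) \<subseteq> q"
      proof
        fix r assume r: "r \<in> col (s \<otimes> c)"
        then have "r \<in> carrier R" "r \<otimes> s \<in> col c" using sR c by (auto simp: col_def m_assoc)
        then show "r \<in> q" using c(3) q.I_prime[of r s] sR s by blast
      qed
      then have "col (s \<otimes> c) = col c" by (rule maxc[OF sR])
      moreover have "u \<in> col (s \<otimes> c)" using s u sR c by (simp add: col_def m_lcomm)
      ultimately show ?thesis by simp
    qed
  qed
  then show ?thesis using c unfolding col_def by blast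
qed

section \<open>Annihilators of germs and the socle in degree 1\<close>

context rmodule
begin

lemma ideal_hom_smult:
  assumes I: "ideal I R" and h: "h \<in> ideal_hom R I k M" and c: "c \<in> carrier R"
  shows "(\<lambda>\<rho>. c \<odot>\<^bsub>M\<^esub> h \<rho>) \<in> ideal_hom R I k M"
  using ideal_homD[OF I h] c smult_comm[OF c]
  by (intro ideal_homI) (auto simp: smult_r_distr)

lemma inner_germ_smult:
  assumes I: "ideal I R" and h: "h \<in> ideal_hom R I k M" and c: "c \<in> carrier R"
    and g: "inner_germ R I M k h"
  shows "inner_germ R I M k (\<lambda>\<rho>. c \<odot>\<^bsub>M\<^esub> h \<rho>)"
proof -
  obtain j m where j: "j \<ge> k" "m \<in> carrier M" "\<And>r. r \<in> ideal_power R I j \<Longrightarrow> h r = r \<odot>\<^bsub>M\<^esub> m"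
    using g by (auto simp: inner_germ_def)
  have "c \<odot>\<^bsub>M\<^esub> h r = r \<odot>\<^bsub>M\<^esub> (c \<odot>\<^bsub>M\<^esub> m)" if "r \<in> ideal_power R I j" for r
    using j(3)[OF that] smult_comm[OF c R.ideal_power_carrier[OF I that] j(2)] by simp
  then show ?thesis unfolding inner_germ_def using j c by blast
qed

text \<open>This is the annihilator of the class of \<open>h\<close> in \<open>H\<^sup>1\<close>,
  obtained without reference to a resolution.\<close>

lemma inner_germ_ideal:
  assumes I: "ideal I R" and h: "h \<in> ideal_hom R I k M"
  shows "ideal {r \<in> carrier R. inner_germ R I M k (\<lambda>\<rho>. r \<odot>\<^bsub>M\<^esub> h \<rho>)} R"
proof (rule R.idealI')
  note hh = ideal_homD[OF I h] and car = R.ideal_power_carrier[OF I]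
  have sub: "\<rho> \<in> ideal_power R I k" if "\<rho> \<in> ideal_power R I j" "j \<ge> k" for \<rho> j
    using R.ideal_power_antimono[OF I that(2)] that(1) by auto
  have "\<zero> \<odot>\<^bsub>M\<^esub> h \<rho> = \<rho> \<odot>\<^bsub>M\<^esub> \<zero>\<^bsub>M\<^esub>" if "\<rho> \<in> ideal_power R I k" for \<rho>
    using hh(1)[OF that] car[OF that] by simp
  then show "\<zero> \<in> {r \<in> carrier R. inner_germ R I M k (\<lambda>\<rho>. r \<odot>\<^bsub>M\<^esub> h \<rho>)}"
    unfolding inner_germ_def by blast
  fix x y assume "x \<in> {r \<in> carrier R. inner_germ R I M k (\<lambda>\<rho>. r \<odot>\<^bsub>M\<^esub> h \<rho>)}"
    "y \<in> {r \<in> carrier R. inner_germ R I M k (\<lambda>\<rho>. r \<odot>\<^bsub>M\<^esub> h \<rho>)}"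
  then obtain i m j m' where *: "x \<in> carrier R" "y \<in> carrier R" "i \<ge> k" "j \<ge> k" "m \<in> carrier M" "m' \<in> carrier M"
    "\<And>\<rho>. \<rho> \<in> ideal_power R I i \<Longrightarrow> x \<odot>\<^bsub>M\<^esub> h \<rho> = \<rho> \<odot>\<^bsub>M\<^esub> m"
    "\<And>\<rho>. \<rho> \<in> ideal_power R I j \<Longrightarrow> y \<odot>\<^bsub>M\<^esub> h \<rho> = \<rho> \<odot>\<^bsub>M\<^esub> m'" by (auto simp: inner_germ_def)
  have "(x \<oplus> y) \<odot>\<^bsub>M\<^esub> h \<rho> = \<rho> \<odot>\<^bsub>M\<^esub> (m \<oplus>\<^bsub>M\<^esub> m')" if \<rho>: "\<rho> \<in> ideal_power R I (max i j)" for \<rho>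
  proof -
    have "\<rho> \<in> ideal_power R I i" "\<rho> \<in> ideal_power R I j"
      using \<rho> R.ideal_power_antimono[OF I, of i "max i j"] R.ideal_power_antimono[OF I, of j "max i j"] by auto
    then show ?thesis using * hh(1)[OF sub[of \<rho> i]] car[OF \<rho>] by (simp add: smult_l_distr smult_r_distr)
  qed
  then have "inner_germ R I M k (\<lambda>\<rho>. (x \<oplus> y) \<odot>\<^bsub>M\<^esub> h \<rho>)"
    unfolding inner_germ_def using *(3-6) by (intro exI[of _ "max i j"] conjI bexI[of _ "m \<oplus>\<^bsub>M\<^esub> m'"]) auto
  then show "x \<oplus> y \<in> {r \<in> carrier R. inner_germ R I M k (\<lambda>\<rho>. r \<odot>\<^bsub>M\<^esub> h \<rho>)}" using * by simp
next
  note hh = ideal_homD[OF I h]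
  fix r x assume r: "r \<in> carrier R" and x: "x \<in> {r \<in> carrier R. inner_germ R I M k (\<lambda>\<rho>. r \<odot>\<^bsub>M\<^esub> h \<rho>)}"
  then have "inner_germ R I M k (\<lambda>\<rho>. r \<odot>\<^bsub>M\<^esub> (x \<odot>\<^bsub>M\<^esub> h \<rho>))"
    by (intro inner_germ_smult[OF I ideal_hom_smult[OF I h]]) auto
  moreover have "inner_germ R I M k (\<lambda>\<rho>. r \<odot>\<^bsub>M\<^esub> (x \<odot>\<^bsub>M\<^esub> h \<rho>)) \<longleftrightarrow> inner_germ R I M k (\<lambda>\<rho>. (r \<otimes> x) \<odot>\<^bsub>M\<^esub> h \<rho>)"
    using hh(1) r x by (intro inner_germ_cong[OF R.is_cring I]) (simp add: smult_assoc1)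
  ultimately show "r \<otimes> x \<in> {r \<in> carrier R. inner_germ R I M k (\<lambda>\<rho>. r \<odot>\<^bsub>M\<^esub> h \<rho>)}" using r x by simp
qed auto

text \<open>If \<open>a\<close> runs through generators of \<open>I\<close> and \<open>a h\<close> is multiplication by \<open>m\<^sub>a\<close>, then \<open>h\<close> is determined up
  to torsion by the tuple of the \<open>m\<^sub>a\<close>, and \<open>h\<close> is itself a multiplication by \<open>m\<close> iff \<open>m\<^sub>a = a m\<close> up to torsion.
  This embeds the socle of \<open>H\<^sup>1\<close> into a quotient of a power of \<open>M\<close>.\<close>

definition tuple_rel :: "'r set \<Rightarrow> 'r set \<Rightarrow> ('r \<Rightarrow> 'm) set" where
  "tuple_rel I A = {x \<in> A \<rightarrow>\<^sub>E carrier M. \<exists>m\<in>carrier M. \<exists>j. \<forall>a\<in>A. \<forall>\<rho>\<in>ideal_power R I j.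
     \<rho> \<odot>\<^bsub>M\<^esub> x a = \<rho> \<odot>\<^bsub>M\<^esub> (a \<odot>\<^bsub>M\<^esub> m)}"

lemma tuple_rel_submodule:
  assumes I: "ideal I R" and A: "A \<subseteq> carrier R"
  shows "submodule (tuple_rel I A) R (pow_module M A)"
proof -
  interpret P: rmodule R "pow_module M A" by (intro rmodule.intro pow_module)
  note car = R.ideal_power_carrier[OF I]
  show ?thesis
  proof (rule P.submoduleI')
    show "tuple_rel I A \<subseteq> carrier (pow_module M A)" by (auto simp: tuple_rel_def)
    have "\<rho> \<odot>\<^bsub>M\<^esub> \<zero>\<^bsub>pow_module M A\<^esub> a = \<rho> \<odot>\<^bsub>M\<^esub> (a \<odot>\<^bsub>M\<^esub> \<zero>\<^bsub>M\<^esub>)" if "a \<in> A" for a \<rho>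
      using subsetD[OF A that] that by simp
    moreover have "\<zero>\<^bsub>pow_module M A\<^esub> \<in> A \<rightarrow>\<^sub>E carrier M" by auto
    ultimately show "\<zero>\<^bsub>pow_module M A\<^esub> \<in> tuple_rel I A"
      unfolding tuple_rel_def by blast
    fix x y assume "x \<in> tuple_rel I A" "y \<in> tuple_rel I A"
    then obtain m i m' j where *: "x \<in> A \<rightarrow>\<^sub>E carrier M" "y \<in> A \<rightarrow>\<^sub>E carrier M" "m \<in> carrier M" "m' \<in> carrier M"
      "\<forall>a\<in>A. \<forall>\<rho>\<in>ideal_power R I i. \<rho> \<odot>\<^bsub>M\<^esub> x a = \<rho> \<odot>\<^bsub>M\<^esub> (a \<odot>\<^bsub>M\<^esub> m)"
      "\<forall>a\<in>A. \<forall>\<rho>\<in>ideal_power R I j. \<rho> \<odot>\<^bsub>M\<^esub> y a = \<rho> \<odot>\<^bsub>M\<^esub> (a \<odot>\<^bsub>M\<^esub> m')"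
      unfolding tuple_rel_def mem_Collect_eq by (elim conjE bexE exE) blast
    have "\<rho> \<odot>\<^bsub>M\<^esub> (x \<oplus>\<^bsub>pow_module M A\<^esub> y) a = \<rho> \<odot>\<^bsub>M\<^esub> (a \<odot>\<^bsub>M\<^esub> (m \<oplus>\<^bsub>M\<^esub> m'))"
      if a: "a \<in> A" and \<rho>: "\<rho> \<in> ideal_power R I (max i j)" for a \<rho>
    proof -
      have "\<rho> \<in> ideal_power R I i" "\<rho> \<in> ideal_power R I j"
        using \<rho> R.ideal_power_antimono[OF I, of i "max i j"] R.ideal_power_antimono[OF I, of j "max i j"] by auto
      moreover have "a \<in> carrier R" "x a \<in> carrier M" "y a \<in> carrier M" using a A *(1,2) by auto
      ultimately show ?thesis using a *(3-6) car[OF \<rho>] by (simp add: smult_r_distr)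
    qed
    moreover have "x \<oplus>\<^bsub>pow_module M A\<^esub> y \<in> A \<rightarrow>\<^sub>E carrier M"
      using *(1,2) by auto
    moreover have "m \<oplus>\<^bsub>M\<^esub> m' \<in> carrier M" using *(3,4) by simp
    ultimately show "x \<oplus>\<^bsub>pow_module M A\<^esub> y \<in> tuple_rel I A" unfolding tuple_rel_def by blast
  next
    fix r x assume r: "r \<in> carrier R" and "x \<in> tuple_rel I A"
    then obtain m j where *: "x \<in> A \<rightarrow>\<^sub>E carrier M" "m \<in> carrier M"
      "\<And>a \<rho>. a \<in> A \<Longrightarrow> \<rho> \<in> ideal_power R I j \<Longrightarrow> \<rho> \<odot>\<^bsub>M\<^esub> x a = \<rho> \<odot>\<^bsub>M\<^esub> (a \<odot>\<^bsub>M\<^esub> m)"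
      unfolding tuple_rel_def by blast
    have "\<rho> \<odot>\<^bsub>M\<^esub> (r \<odot>\<^bsub>pow_module M A\<^esub> x) a = \<rho> \<odot>\<^bsub>M\<^esub> (a \<odot>\<^bsub>M\<^esub> (r \<odot>\<^bsub>M\<^esub> m))"
      if a: "a \<in> A" and \<rho>: "\<rho> \<in> ideal_power R I j" for a \<rho>
    proof -
      have aR: "a \<in> carrier R" "x a \<in> carrier M" using a A *(1) by auto
      have "\<rho> \<odot>\<^bsub>M\<^esub> (r \<odot>\<^bsub>M\<^esub> x a) = r \<odot>\<^bsub>M\<^esub> (\<rho> \<odot>\<^bsub>M\<^esub> (a \<odot>\<^bsub>M\<^esub> m))"
        using smult_comm[OF car[OF \<rho>] r aR(2)] *(3)[OF a \<rho>] by simp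
      also have "\<dots> = \<rho> \<odot>\<^bsub>M\<^esub> (a \<odot>\<^bsub>M\<^esub> (r \<odot>\<^bsub>M\<^esub> m))"
        using smult_comm[OF r car[OF \<rho>]] smult_comm[OF r aR(1) *(2)] aR *(2) by simp
      finally show ?thesis using a by simp
    qed
    moreover have "r \<odot>\<^bsub>pow_module M A\<^esub> x \<in> A \<rightarrow>\<^sub>E carrier M" using *(1) r by auto
    moreover have "r \<odot>\<^bsub>M\<^esub> m \<in> carrier M" using *(2) r by simp
    ultimately show "r \<odot>\<^bsub>pow_module M A\<^esub> x \<in> tuple_rel I A" unfolding tuple_rel_def by blast
  qed
qed

text \<open>The annihilator of a class contains a power of \<open>I\<close>; being prime, it
  contains \<open>I\<close>, so the class lies in the socle and is recorded by a tuple
  \<open>v\<close> in a finite power of \<open>M\<close>. The class of \<open>h\<close> and the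
  class of \<open>v\<close> modulo \<open>tuple_rel\<close> turn out to have the same
  annihilator.\<close>

lemma inner_germ_colon_prime:
  assumes I: "ideal I R" and A: "finite A" "A \<subseteq> carrier R" "I = Idl A"
    and h: "h \<in> ideal_hom R I k M"
    and p: "primeideal {r \<in> carrier R. inner_germ R I M k (\<lambda>\<rho>. r \<odot>\<^bsub>M\<^esub> h \<rho>)} R" (is "primeideal ?p R")
  shows "?p \<in> colon_primes R (pow_module M A) (tuple_rel I A)"
proof -
  note hh = ideal_homD[OF I h] and car = R.ideal_power_carrier[OF I]
  have mono: "\<rho> \<in> ideal_power R I i" if "\<rho> \<in> ideal_power R I j" "j \<ge> i" for \<rho> i j
    using R.ideal_power_antimono[OF I that(2)] that(1) by auto
  have "ideal_power R I k \<subseteq> ?p"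
  proof
    fix r assume r: "r \<in> ideal_power R I k"
    have "r \<odot>\<^bsub>M\<^esub> h \<rho> = \<rho> \<odot>\<^bsub>M\<^esub> h r" if \<rho>: "\<rho> \<in> ideal_power R I k" for \<rho>
      using hh(3)[OF car[OF r] \<rho>] hh(3)[OF car[OF \<rho>] r] R.m_comm[OF car[OF r] car[OF \<rho>]] by simp
    then have "inner_germ R I M k (\<lambda>\<rho>. r \<odot>\<^bsub>M\<^esub> h \<rho>)" unfolding inner_germ_def using hh(1)[OF r] by blast
    then show "r \<in> ?p" using car[OF r] by simp
  qed
  then have "I \<subseteq> ?p" by (rule R.prime_contains_power[OF I p])
  moreover have AI: "A \<subseteq> I" unfolding A(3) by (rule R.genideal_self[OF A(2)])
  ultimately have "\<forall>a\<in>A. \<exists>m j. m \<in> carrier M \<and> j \<ge> k \<and> (\<forall>\<rho>\<in>ideal_power R I j. a \<odot>\<^bsub>M\<^esub> h \<rho> = \<rho> \<odot>\<^bsub>M\<^esub> m)"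
    unfolding inner_germ_def by blast
  then obtain m j where m: "\<And>a. a \<in> A \<Longrightarrow> m a \<in> carrier M" and jk: "\<And>a. a \<in> A \<Longrightarrow> j a \<ge> k"
    and mj: "\<And>a \<rho>. a \<in> A \<Longrightarrow> \<rho> \<in> ideal_power R I (j a) \<Longrightarrow> a \<odot>\<^bsub>M\<^esub> h \<rho> = \<rho> \<odot>\<^bsub>M\<^esub> m a" by metis
  \<comment> \<open>One power of \<open>I\<close> on which all the maps \<open>a h\<close>, for
    \<open>a\<close> in the finite set \<open>A\<close>, are multiplications.\<close>
  define J0 where "J0 = Max (insert k (j ` A))"
  have J0k: "k \<le> J0" and J0: "\<And>a. a \<in> A \<Longrightarrow> j a \<le> J0" using A(1) by (auto simp: J0_def)
  define v where "v = (\<lambda>a\<in>A. m a)"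
  have v: "v \<in> carrier (pow_module M A)" using m by (auto simp: v_def)
  have "?p = {r \<in> carrier R. r \<odot>\<^bsub>pow_module M A\<^esub> v \<in> tuple_rel I A}"
  proof (rule Set.set_eqI, rule iffI)
    fix r assume "r \<in> ?p"
    then obtain i m' where r: "r \<in> carrier R" and i: "i \<ge> k" "m' \<in> carrier M"
      "\<And>\<rho>. \<rho> \<in> ideal_power R I i \<Longrightarrow> r \<odot>\<^bsub>M\<^esub> h \<rho> = \<rho> \<odot>\<^bsub>M\<^esub> m'" by (auto simp: inner_germ_def)
    have "\<rho> \<odot>\<^bsub>M\<^esub> (r \<odot>\<^bsub>pow_module M A\<^esub> v) a = \<rho> \<odot>\<^bsub>M\<^esub> (a \<odot>\<^bsub>M\<^esub> m')"
      if a: "a \<in> A" and \<rho>: "\<rho> \<in> ideal_power R I (max i J0)" for a \<rho>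
    proof -
      have \<rho>i: "\<rho> \<in> ideal_power R I i" "\<rho> \<in> ideal_power R I (j a)" "\<rho> \<in> ideal_power R I k"
        using \<rho> J0[OF a] J0k by (auto intro: mono)
      have aR: "a \<in> carrier R" using a A(2) by auto
      have "\<rho> \<odot>\<^bsub>M\<^esub> (r \<odot>\<^bsub>M\<^esub> m a) = r \<odot>\<^bsub>M\<^esub> (a \<odot>\<^bsub>M\<^esub> h \<rho>)"
        using smult_comm[OF car[OF \<rho>] r m[OF a]] mj[OF a \<rho>i(2)] by simp
      also have "\<dots> = a \<odot>\<^bsub>M\<^esub> (\<rho> \<odot>\<^bsub>M\<^esub> m')" using smult_comm[OF r aR hh(1)[OF \<rho>i(3)]] i(3)[OF \<rho>i(1)] by simp
      also have "\<dots> = \<rho> \<odot>\<^bsub>M\<^esub> (a \<odot>\<^bsub>M\<^esub> m')" by (rule smult_comm[OF aR car[OF \<rho>] i(2)])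
      finally show ?thesis using a by (simp add: v_def)
    qed
    moreover have "r \<odot>\<^bsub>pow_module M A\<^esub> v \<in> A \<rightarrow>\<^sub>E carrier M" using m r by (auto simp: v_def)
    ultimately have "r \<odot>\<^bsub>pow_module M A\<^esub> v \<in> tuple_rel I A" unfolding tuple_rel_def using i(2) by blast
    then show "r \<in> {r \<in> carrier R. r \<odot>\<^bsub>pow_module M A\<^esub> v \<in> tuple_rel I A}" using r by simp
  next
    fix r assume "r \<in> {r \<in> carrier R. r \<odot>\<^bsub>pow_module M A\<^esub> v \<in> tuple_rel I A}"
    then obtain m' i where r: "r \<in> carrier R" and m': "m' \<in> carrier M" and
      eq: "\<And>a \<rho>. a \<in> A \<Longrightarrow> \<rho> \<in> ideal_power R I i \<Longrightarrow> \<rho> \<odot>\<^bsub>M\<^esub> (r \<odot>\<^bsub>pow_module M A\<^esub> v) a = \<rho> \<odot>\<^bsub>M\<^esub> (a \<odot>\<^bsub>M\<^esub> m')"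
      unfolding tuple_rel_def by blast
    let ?J = "max i J0"
    \<comment> \<open>From the generators to all of \<open>I\<close>: for fixed
      \<open>\<rho>\<close>, the \<open>\<sigma>\<close> that satisfy the equation form an
      ideal.\<close>
    have gen: "\<sigma> \<odot>\<^bsub>M\<^esub> (r \<odot>\<^bsub>M\<^esub> h \<rho>) = \<sigma> \<odot>\<^bsub>M\<^esub> (\<rho> \<odot>\<^bsub>M\<^esub> m')"
      if \<rho>: "\<rho> \<in> ideal_power R I ?J" and \<sigma>: "\<sigma> \<in> I" for \<rho> \<sigma>
    proof -
      have \<rho>k: "\<rho> \<in> ideal_power R I k" and \<rho>i: "\<rho> \<in> ideal_power R I i" using \<rho> J0k by (auto intro: mono)
      let ?S = "{\<sigma> \<in> carrier R. \<sigma> \<odot>\<^bsub>M\<^esub> (r \<odot>\<^bsub>M\<^esub> h \<rho>) = \<sigma> \<odot>\<^bsub>M\<^esub> (\<rho> \<odot>\<^bsub>M\<^esub> m')}"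
      have 1: "r \<odot>\<^bsub>M\<^esub> h \<rho> \<in> carrier M" "\<rho> \<odot>\<^bsub>M\<^esub> m' \<in> carrier M" using r hh(1)[OF \<rho>k] car[OF \<rho>] m' by auto
      have "ideal ?S R" using 1 by (intro R.idealI') (auto simp: smult_l_distr smult_assoc1)
      moreover have "A \<subseteq> ?S"
      proof
        fix a assume a: "a \<in> A"
        then have aR: "a \<in> carrier R" using A(2) by auto
        have "a \<odot>\<^bsub>M\<^esub> (r \<odot>\<^bsub>M\<^esub> h \<rho>) = r \<odot>\<^bsub>M\<^esub> (\<rho> \<odot>\<^bsub>M\<^esub> m a)"
          using smult_comm[OF aR r hh(1)[OF \<rho>k]] mj[OF a, of \<rho>] mono[OF \<rho>, of "j a"] J0[OF a] by simp
        also have "\<dots> = \<rho> \<odot>\<^bsub>M\<^esub> (r \<odot>\<^bsub>M\<^esub> m a)" by (rule smult_comm[OF r car[OF \<rho>] m[OF a]])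
        also have "\<dots> = \<rho> \<odot>\<^bsub>M\<^esub> (a \<odot>\<^bsub>M\<^esub> m')" using eq[OF a \<rho>i] a by (simp add: v_def)
        also have "\<dots> = a \<odot>\<^bsub>M\<^esub> (\<rho> \<odot>\<^bsub>M\<^esub> m')" by (rule smult_comm[OF car[OF \<rho>] aR m'])
        finally show "a \<in> ?S" using aR by simp
      qed
      ultimately have "I \<subseteq> ?S" unfolding A(3) by (rule R.genideal_minimal)
      then show ?thesis using \<sigma> by auto
    qed
    \<comment> \<open>The factor \<open>\<sigma>\<close> cannot be cancelled, but it can be
      absorbed: elements of the next power are sums of products of some \<open>\<rho>\<close> and
      \<open>\<sigma>\<close>, and \<open>r h\<close> takes such a product to
      \<open>\<sigma>\<close> times its value at \<open>\<rho>\<close>. Hence the exponent grows by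
      one.\<close>
    have "\<tau> \<in> ideal_power R I k \<and> r \<odot>\<^bsub>M\<^esub> h \<tau> = \<tau> \<odot>\<^bsub>M\<^esub> m'" if \<tau>: "\<tau> \<in> ideal_power R I (?J + Suc 0)" for \<tau>
      using I \<tau>
    proof (rule R.ideal_power_add_induct)
      fix \<rho> \<sigma> assume \<rho>: "\<rho> \<in> ideal_power R I ?J" and "\<sigma> \<in> ideal_power R I (Suc 0)"
      then have \<sigma>: "\<sigma> \<in> I" by (simp add: R.ideal_power_1[OF I])
      then have \<sigma>R: "\<sigma> \<in> carrier R" using ideal.Icarr[OF I] by simp
      have \<rho>k: "\<rho> \<in> ideal_power R I k" using \<rho> J0k by (auto intro: mono)
      have "r \<odot>\<^bsub>M\<^esub> h (\<rho> \<otimes> \<sigma>) = \<sigma> \<odot>\<^bsub>M\<^esub> (r \<odot>\<^bsub>M\<^esub> h \<rho>)"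
        using hh(3)[OF \<sigma>R \<rho>k] R.m_comm[OF \<sigma>R car[OF \<rho>]] smult_comm[OF r \<sigma>R hh(1)[OF \<rho>k]] by simp
      also have "\<dots> = (\<rho> \<otimes> \<sigma>) \<odot>\<^bsub>M\<^esub> m'"
        using gen[OF \<rho> \<sigma>] R.m_comm[OF \<sigma>R car[OF \<rho>]] smult_assoc1[OF \<sigma>R car[OF \<rho>] m'] by simp
      finally show "\<rho> \<otimes> \<sigma> \<in> ideal_power R I k \<and> r \<odot>\<^bsub>M\<^esub> h (\<rho> \<otimes> \<sigma>) = (\<rho> \<otimes> \<sigma>) \<odot>\<^bsub>M\<^esub> m'"
        using ideal.ideal_closed(5)[OF R.ideal_power_ideal[OF I] \<sigma>R \<rho>k] by simp
    next
      fix a b assume "a \<in> carrier R" "b \<in> carrier R" "a \<in> ideal_power R I k \<and> r \<odot>\<^bsub>M\<^esub> h a = a \<odot>\<^bsub>M\<^esub> m'"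
        "b \<in> ideal_power R I k \<and> r \<odot>\<^bsub>M\<^esub> h b = b \<odot>\<^bsub>M\<^esub> m'"
      then show "a \<oplus> b \<in> ideal_power R I k \<and> r \<odot>\<^bsub>M\<^esub> h (a \<oplus> b) = (a \<oplus> b) \<odot>\<^bsub>M\<^esub> m'"
        using ideal.ideal_closed(3)[OF R.ideal_power_ideal[OF I], of a k b] hh(1,2) m' r
        by (simp add: smult_r_distr smult_l_distr)
    qed
    moreover have "?J + Suc 0 \<ge> k" using J0k by simp
    ultimately have "inner_germ R I M k (\<lambda>\<rho>. r \<odot>\<^bsub>M\<^esub> h \<rho>)" unfolding inner_germ_def using m' by blast
    then show "r \<in> ?p" using r by simp
  qed
  then show ?thesis unfolding colon_primes_def using p v by blast
qed

end

section \<open>One exponent for all primes\<close>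

lemma killed_at_mono:
  assumes "cring R" "ideal J R" "t \<le> t'" "killed_at R I J M t q"
  shows "killed_at R I J M t' q"
  using assms(4) cring.ideal_power_antimono[OF assms(1-3)] unfolding killed_at_def by blast

text \<open>Replacing the first member of the chain by \<open>p\<close> keeps the inclusions strict;
  for \<open>n = 0\<close> the chain is \<open>p\<close> alone.\<close>

lemma coheight_ge_subset:
  assumes "coheight_ge R n q" "p \<in> Spec R" "p \<subseteq> q"
  shows "coheight_ge R n p"
proof -
  obtain c where c: "c 0 = q" "\<And>i. i \<le> n \<Longrightarrow> c i \<in> Spec R" "\<And>i. i < n \<Longrightarrow> c i \<subset> c (Suc i)"
    using assms(1) by (auto simp: coheight_ge_def)
  let ?c = "\<lambda>i. if i = 0 then p else c i"
  have "?c i \<subset> ?c (Suc i)" if "i < n" for i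
  proof (cases i)
    case 0
    then show ?thesis using c(3)[OF that] c(1) assms(3) by auto
  next
    case (Suc k)
    then show ?thesis using c(3)[OF that] by simp
  qed
  then show ?thesis unfolding coheight_ge_def using c assms(2) by (intro exI[of _ ?c]) auto
qed

text \<open>Let \<open>T\<close> work at the finitely many associated primes of coheight at least
  \<open>n\<close>. If \<open>\<beta> f\<close> survived at \<open>q\<close>, some multiple
  \<open>h = c \<beta> f\<close> would have a prime annihilator inside \<open>q\<close>, which is
  one of these primes. There, some \<open>s\<close> outside the annihilator of \<open>h\<close>
  makes the class of \<open>s \<beta> f\<close> zero, hence also that of \<open>s h\<close>, a
  contradiction.\<close>

lemma uniform_killed_at:
  fixes R :: "('r, 'k) ring_scheme" and M :: "('r, 'm) module"
  assumes R: "cring R" "noetherian_ring R" and M: "noeth_module R M" and I: "ideal I R" and J: "ideal J R"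
    and loc: "\<And>q. q \<in> Spec R \<Longrightarrow> coheight_ge R n q \<Longrightarrow> \<exists>t. killed_at R I J M t q"
  shows "\<exists>t. \<forall>q\<in>Spec R. coheight_ge R n q \<longrightarrow> killed_at R I J M t q"
proof -
  interpret rmodule R M using M by (intro rmodule.intro) (simp add: noeth_module_def)
  interpret NR: noetherian_ring R by fact
  obtain A where A: "A \<subseteq> carrier R" "finite A" "I = Idl\<^bsub>R\<^esub> A" using NR.finetely_gen[OF I] by blast
  \<comment> \<open>Associated primes of smaller coheight are left out, as the hypothesis provides
    no exponent for them.\<close>
  define P where "P = colon_primes R (pow_module M A) (tuple_rel I A) \<inter> {q. coheight_ge R n q}"
  have P: "finite P" unfolding P_def
    using finite_colon_primes[OF noeth_pow[OF M A(2)] tuple_rel_submodule[OF I A(1)]] by simp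
  have "\<forall>p\<in>P. \<exists>t. killed_at R I J M t p" using loc by (auto simp: P_def colon_primes_def Spec_def)
  then obtain t where t: "\<And>p. p \<in> P \<Longrightarrow> killed_at R I J M (t p) p" by metis
  define T where "T = Max (insert 0 (t ` P))"
  have T: "killed_at R I J M T p" if "p \<in> P" for p
    by (rule killed_at_mono[OF R(1) J _ t[OF that]]) (use P that in \<open>simp add: T_def\<close>)
  have "killed_at R I J M T q" if q: "q \<in> Spec R" "coheight_ge R n q" for q
    unfolding killed_at_def
  proof (intro allI ballI, rule ccontr)
    fix k f \<beta> assume f: "f \<in> ideal_hom R I k M" and \<beta>: "\<beta> \<in> ideal_power R J T"
      and no: "\<not> (\<exists>s\<in>carrier R - q. inner_germ R I M k (\<lambda>r. (s \<otimes>\<^bsub>R\<^esub> \<beta>) \<odot>\<^bsub>M\<^esub> f r))"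
    note fh = ideal_homD[OF I f]
    have \<beta>R: "\<beta> \<in> carrier R" by (rule R.ideal_power_carrier[OF J \<beta>])
    define Ann where "Ann h = {r \<in> carrier R. inner_germ R I M k (\<lambda>\<rho>. r \<odot>\<^bsub>M\<^esub> h \<rho>)}" for h
    have Ann_smult: "Ann (\<lambda>\<rho>. c \<odot>\<^bsub>M\<^esub> h \<rho>) = {r \<in> carrier R. r \<otimes>\<^bsub>R\<^esub> c \<in> Ann h}"
      if h: "h \<in> ideal_hom R I k M" and c: "c \<in> carrier R" for h c
    proof -
      have "inner_germ R I M k (\<lambda>\<rho>. r \<odot>\<^bsub>M\<^esub> (c \<odot>\<^bsub>M\<^esub> h \<rho>)) \<longleftrightarrow> inner_germ R I M k (\<lambda>\<rho>. (r \<otimes>\<^bsub>R\<^esub> c) \<odot>\<^bsub>M\<^esub> h \<rho>)"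
        if "r \<in> carrier R" for r
        using that c ideal_homD(1)[OF I h] by (intro inner_germ_cong[OF R(1) I]) (simp add: smult_assoc1)
      then show ?thesis using c by (auto simp: Ann_def)
    qed
    define g where "g = (\<lambda>\<rho>. \<beta> \<odot>\<^bsub>M\<^esub> f \<rho>)"
    have g: "g \<in> ideal_hom R I k M" unfolding g_def by (rule ideal_hom_smult[OF I f \<beta>R])
    have gq: "Ann g \<subseteq> q"
    proof
      fix s assume s: "s \<in> Ann g"
      then have "s \<in> carrier R" "s \<otimes>\<^bsub>R\<^esub> \<beta> \<in> Ann f" unfolding g_def Ann_smult[OF f \<beta>R] by auto
      then show "s \<in> q" using no by (auto simp: Ann_def)
    qed
    have "ideal (Ann g) R" unfolding Ann_def by (rule inner_germ_ideal[OF I g])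
    then obtain c where c: "c \<in> carrier R" "primeideal {r \<in> carrier R. r \<otimes>\<^bsub>R\<^esub> c \<in> Ann g} R"
      "{r \<in> carrier R. r \<otimes>\<^bsub>R\<^esub> c \<in> Ann g} \<subseteq> q"
      using NR.ex_prime_colon[OF R(1) _ _ gq] q(1) by (auto simp: Spec_def)
    define h where "h = (\<lambda>\<rho>. c \<odot>\<^bsub>M\<^esub> g \<rho>)"
    have h: "h \<in> ideal_hom R I k M" unfolding h_def by (rule ideal_hom_smult[OF I g c(1)])
    have Ah: "Ann h = {r \<in> carrier R. r \<otimes>\<^bsub>R\<^esub> c \<in> Ann g}" unfolding h_def by (rule Ann_smult[OF g c(1)])
    have p: "primeideal (Ann h) R" "Ann h \<subseteq> q" unfolding Ah by (rule c)+
    have "Ann h \<in> colon_primes R (pow_module M A) (tuple_rel I A)"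
      using inner_germ_colon_prime[OF I A(2,1,3) h] p(1) unfolding Ann_def by simp
    moreover have "coheight_ge R n (Ann h)" using coheight_ge_subset[OF q(2) _ p(2)] p(1) by (simp add: Spec_def)
    ultimately have "killed_at R I J M T (Ann h)" by (intro T) (simp add: P_def)
    then obtain s where s: "s \<in> carrier R" "s \<notin> Ann h" "s \<otimes>\<^bsub>R\<^esub> \<beta> \<in> Ann f"
      using f \<beta> \<beta>R unfolding killed_at_def by (fastforce simp: Ann_def)
    then have "s \<in> Ann g" unfolding g_def Ann_smult[OF f \<beta>R] by simp
    moreover have "ideal (Ann g) R" by fact
    ultimately have "s \<otimes>\<^bsub>R\<^esub> c \<in> Ann g" using ideal.ideal_closed(5) c(1) by metis
    then show False using s unfolding Ah by simp
  qed
  then show ?thesis by blast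
qed

section \<open>Annihilation and localization\<close>

context loc
begin

lemma loc_rmodule: "rmodule RS MS"
  by (intro rmodule.intro loc_module)

lemma ext_powerE:
  assumes "ideal I R" "X \<in> ideal_power RS (ext I) k"
  obtains r s where "r \<in> ideal_power R I k" "s \<in> S" "X = rf r s"
  using assms(2) unfolding ext_power[OF assms(1)] unfolding ext_def by blast

lemma ext_powerI:
  assumes "ideal I R" "r \<in> ideal_power R I k" "s \<in> S"
  shows "rf r s \<in> ideal_power RS (ext I) k"
  unfolding ext_power[OF assms(1)] unfolding ext_def using assms(2,3) by blast

text \<open>The elements killed by something in \<open>S\<close> form a submodule, which is finitely
  generated; the product of killers of its generators kills all of it.\<close>

lemma ex_torsion_killer:
  assumes "noeth_module R M"
  shows "\<exists>w\<in>S. \<forall>x\<in>carrier M. (\<exists>u\<in>S. u \<odot>\<^bsub>M\<^esub> x = \<zero>\<^bsub>M\<^esub>) \<longrightarrow> w \<odot>\<^bsub>M\<^esub> x = \<zero>\<^bsub>M\<^esub>"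
proof -
  let ?T = "{x \<in> carrier M. \<exists>u\<in>S. u \<odot>\<^bsub>M\<^esub> x = \<zero>\<^bsub>M\<^esub>}"
  have "submodule ?T R M"
  proof (rule submoduleI')
    show "\<zero>\<^bsub>M\<^esub> \<in> ?T" using S_one by auto
    fix x y assume "x \<in> ?T" "y \<in> ?T"
    then obtain u v where uv: "x \<in> carrier M" "y \<in> carrier M" "u \<in> S" "v \<in> S" "u \<odot>\<^bsub>M\<^esub> x = \<zero>\<^bsub>M\<^esub>" "v \<odot>\<^bsub>M\<^esub> y = \<zero>\<^bsub>M\<^esub>" by auto
    have "(u \<otimes> v) \<odot>\<^bsub>M\<^esub> (x \<oplus>\<^bsub>M\<^esub> y) = v \<odot>\<^bsub>M\<^esub> (u \<odot>\<^bsub>M\<^esub> x) \<oplus>\<^bsub>M\<^esub> u \<odot>\<^bsub>M\<^esub> (v \<odot>\<^bsub>M\<^esub> y)"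
      using uv(1-4) by (simp add: smult_assoc1[symmetric] smult_r_distr R.m_comm)
    then have "(u \<otimes> v) \<odot>\<^bsub>M\<^esub> (x \<oplus>\<^bsub>M\<^esub> y) = \<zero>\<^bsub>M\<^esub>" using uv by simp
    then show "x \<oplus>\<^bsub>M\<^esub> y \<in> ?T" using uv S_mult by blast
  next
    fix r x assume "r \<in> carrier R" "x \<in> ?T"
    then obtain u where u: "x \<in> carrier M" "u \<in> S" "u \<odot>\<^bsub>M\<^esub> x = \<zero>\<^bsub>M\<^esub>" by auto
    then have "u \<odot>\<^bsub>M\<^esub> (r \<odot>\<^bsub>M\<^esub> x) = \<zero>\<^bsub>M\<^esub>" using smult_comm[of u r x] \<open>r \<in> carrier R\<close> by simp
    then show "r \<odot>\<^bsub>M\<^esub> x \<in> ?T" using u \<open>r \<in> carrier R\<close> by blast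
  qed auto
  then obtain X where X: "finite X" "X \<subseteq> carrier M" "?T = gen_submodule R M X"
    using assms unfolding noeth_module_def fg_submodule_def by blast
  have killer: "\<exists>w\<in>S. \<forall>x\<in>Y. w \<odot>\<^bsub>M\<^esub> x = \<zero>\<^bsub>M\<^esub>" if "finite Y" "Y \<subseteq> ?T" for Y
    using that
  proof (induct Y rule: finite_induct)
    case empty
    then show ?case using S_one by auto
  next
    case (insert y Y)
    then obtain w u where w: "w \<in> S" "\<And>x. x \<in> Y \<Longrightarrow> w \<odot>\<^bsub>M\<^esub> x = \<zero>\<^bsub>M\<^esub>" "u \<in> S" "u \<odot>\<^bsub>M\<^esub> y = \<zero>\<^bsub>M\<^esub>" "y \<in> carrier M"
      by auto
    have "(w \<otimes> u) \<odot>\<^bsub>M\<^esub> x = \<zero>\<^bsub>M\<^esub>" if "x \<in> insert y Y" for x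
    proof -
      have x: "x \<in> carrier M" using that insert(4) by auto
      show ?thesis
      proof (cases "x = y")
        case True
        then show ?thesis using w by (simp add: smult_assoc1)
      next
        case False
        then have "w \<odot>\<^bsub>M\<^esub> x = \<zero>\<^bsub>M\<^esub>" using w(2) that by simp
        then show ?thesis using w(1,3) x R.m_comm[of w u] by (simp add: smult_assoc1)
      qed
    qed
    then show ?case using S_mult[OF w(1,3)] by blast
  qed
  have XT: "X \<subseteq> ?T" using X(3) gen_submodule_subset[of X] by simp
  obtain w where w: "w \<in> S" "\<forall>x\<in>X. w \<odot>\<^bsub>M\<^esub> x = \<zero>\<^bsub>M\<^esub>" using killer[OF X(1) XT] by (elim bexE)
  have "submodule {x \<in> carrier M. w \<odot>\<^bsub>M\<^esub> x = \<zero>\<^bsub>M\<^esub>} R M"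
    using w(1) smult_comm[of w] by (intro submoduleI') (auto simp: smult_r_distr)
  then have "gen_submodule R M X \<subseteq> {x \<in> carrier M. w \<odot>\<^bsub>M\<^esub> x = \<zero>\<^bsub>M\<^esub>}"
    by (rule gen_submodule_minimal) (use X(2) w(2) in auto)
  then have "?T \<subseteq> {x \<in> carrier M. w \<odot>\<^bsub>M\<^esub> x = \<zero>\<^bsub>M\<^esub>}" using X(3) by simp
  then show ?thesis using w(1) by blast
qed

text \<open>The multiplier does not depend on the elements. This uniformity allows an identity that
  holds in \<open>MS\<close> for all elements of a power of \<open>I\<close> to be lifted to
  \<open>M\<close> for all of them at once.\<close>

lemma ex_fract_eq_killer:
  assumes "noeth_module R M"
  obtains w where "w \<in> S" "\<And>x y. x \<in> carrier M \<Longrightarrow> y \<in> carrier M \<Longrightarrow> fr x \<one> = fr y \<one> \<Longrightarrow> w \<odot>\<^bsub>M\<^esub> x = w \<odot>\<^bsub>M\<^esub> y"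
proof -
  obtain w where w: "w \<in> S" "\<forall>x\<in>carrier M. (\<exists>u\<in>S. u \<odot>\<^bsub>M\<^esub> x = \<zero>\<^bsub>M\<^esub>) \<longrightarrow> w \<odot>\<^bsub>M\<^esub> x = \<zero>\<^bsub>M\<^esub>"
    using ex_torsion_killer[OF assms] by (elim bexE)
  have "w \<odot>\<^bsub>M\<^esub> x = w \<odot>\<^bsub>M\<^esub> y" if xy: "x \<in> carrier M" "y \<in> carrier M" "fr x \<one> = fr y \<one>" for x y
  proof -
    obtain u where u: "u \<in> S" "u \<odot>\<^bsub>M\<^esub> x = u \<odot>\<^bsub>M\<^esub> y" using fract_eq_iff[OF xy(1,2) S_one S_one] xy(3) by auto
    then have "u \<odot>\<^bsub>M\<^esub> (x \<ominus>\<^bsub>M\<^esub> y) = \<zero>\<^bsub>M\<^esub>" using xy by (simp add: smult_minus minus_eq_zero)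
    then have "w \<odot>\<^bsub>M\<^esub> (x \<ominus>\<^bsub>M\<^esub> y) = \<zero>\<^bsub>M\<^esub>" using w(2) u(1) xy by auto
    then show ?thesis using xy w(1) by (simp add: smult_minus minus_eq_zero)
  qed
  then show ?thesis using that w(1) by blast
qed

text \<open>Sending \<open>r/s\<close> to \<open>f r / s\<close> is well defined, because the linear
  map \<open>f\<close> carries a relation between numerators in \<open>R\<close> to the same
  relation in \<open>M\<close>; \<open>rep\<close> picks some numerator and denominator.\<close>

lemma ex_localized_hom:
  assumes I: "ideal I R" and f: "f \<in> ideal_hom R I k M"
  obtains F where "F \<in> ideal_hom RS (ext I) k MS"
    "\<And>r s. r \<in> ideal_power R I k \<Longrightarrow> s \<in> S \<Longrightarrow> F (rf r s) = fr (f r) s"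
proof -
  interpret L: rmodule "RS" "MS" by (rule loc_rmodule)
  note fh = ideal_homD[OF I f] and car = R.ideal_power_carrier[OF I]
    and pk = ideal.ideal_closed[OF R.ideal_power_ideal[OF I]]
  have wd: "fr (f r) s = fr (f r') s'"
    if rs: "r \<in> ideal_power R I k" "s \<in> S" "r' \<in> ideal_power R I k" "s' \<in> S" "rf r s = rf r' s'" for r s r' s'
  proof -
    obtain u where u: "u \<in> S" "(u \<otimes> s') \<otimes> r = (u \<otimes> s) \<otimes> r'"
      using SM.fract_eq_iff[of r r' s s'] rs car by auto
    have "(u \<otimes> s') \<odot>\<^bsub>M\<^esub> f r = (u \<otimes> s) \<odot>\<^bsub>M\<^esub> f r'"
      using fh(3)[OF _ rs(1), of "u \<otimes> s'"] fh(3)[OF _ rs(3), of "u \<otimes> s"] u rs by simp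
    then show ?thesis by (rule fract_eqI[OF fh(1)[OF rs(1)] fh(1)[OF rs(3)] rs(2,4) u(1)])
  qed
  define rep where "rep X = (SOME p. fst p \<in> ideal_power R I k \<and> snd p \<in> S \<and> X = rf (fst p) (snd p))" for X
  define F where "F X = fr (f (fst (rep X))) (snd (rep X))" for X
  have F: "F (rf r s) = fr (f r) s" if rs: "r \<in> ideal_power R I k" "s \<in> S" for r s
  proof -
    have "fst (r, s) \<in> ideal_power R I k \<and> snd (r, s) \<in> S \<and> rf r s = rf (fst (r, s)) (snd (r, s))" using rs by simp
    then have "fst (rep (rf r s)) \<in> ideal_power R I k \<and> snd (rep (rf r s)) \<in> S \<and>
      rf r s = rf (fst (rep (rf r s))) (snd (rep (rf r s)))"
      unfolding rep_def by (rule someI)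
    then show ?thesis unfolding F_def by (elim conjE) (rule wd[OF rs, symmetric])
  qed
  show ?thesis
  proof (rule that[of F])
    show "F \<in> ideal_hom RS (ext I) k MS"
    proof (rule L.ideal_homI)
      fix X assume "X \<in> ideal_power RS (ext I) k"
      then obtain r s where X: "r \<in> ideal_power R I k" "s \<in> S" "X = rf r s" by (rule ext_powerE[OF I])
      show "F X \<in> carrier MS" using X fh(1) by (auto simp: F intro!: frac_in)
      show "F (C \<otimes>\<^bsub>RS\<^esub> X) = C \<odot>\<^bsub>MS\<^esub> F X" if C: "C \<in> carrier RS" for C
      proof -
        obtain c t where c: "c \<in> carrier R" "t \<in> S" "C = rf c t" using C by (rule ring_cases)
        show ?thesis
          using c X car[OF X(1)] pk(4)[OF c(1) X(1)] S_mult fh(1,3)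
          by (simp add: rf_mult F fract_smult)
      qed
      fix Y assume "Y \<in> ideal_power RS (ext I) k"
      then obtain r' s' where Y: "r' \<in> ideal_power R I k" "s' \<in> S" "Y = rf r' s'" by (rule ext_powerE[OF I])
      have "s' \<otimes> r \<in> ideal_power R I k" "s \<otimes> r' \<in> ideal_power R I k" using X Y pk(4) by auto
      moreover from this have "s' \<otimes> r \<oplus> s \<otimes> r' \<in> ideal_power R I k" using pk(3) by blast
      ultimately show "F (X \<oplus>\<^bsub>RS\<^esub> Y) = F X \<oplus>\<^bsub>MS\<^esub> F Y"
        using X Y car S_mult fh by (simp add: rf_add F fract_add)
    qed
  qed (rule F)
qed

text \<open>Since the kernel of \<open>M \<rightarrow> M\<^sub>S\<close> is killed by one element of \<open>S\<close>, the numerators of a map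
  \<open>I\<^sup>k \<rightarrow> M\<^sub>S\<close> become a well-defined map to \<open>M\<close> after multiplication by that element; no finite
  presentation of \<open>I\<^sup>k\<close> is needed.\<close>

lemma ex_unlocalized_hom:
  assumes NR: "noetherian_ring R" and M: "noeth_module R M" and I: "ideal I R"
    and F: "F \<in> ideal_hom RS (ext I) k MS"
  obtains g s where "g \<in> ideal_hom R I k M" "s \<in> S"
    "\<And>r. r \<in> ideal_power R I k \<Longrightarrow> fr (g r) \<one> = rf s \<one> \<odot>\<^bsub>MS\<^esub> F (rf r \<one>)"
proof -
  interpret L: rmodule "RS" "MS" by (rule loc_rmodule)
  interpret NR: noetherian_ring R by fact
  note Fh = L.ideal_homD[OF ext_ideal[OF I] F] and car = R.ideal_power_carrier[OF I]
    and pk = ideal.ideal_closed[OF R.ideal_power_ideal[OF I]]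
  have in_ext: "rf r \<one> \<in> ideal_power RS (ext I) k" if "r \<in> ideal_power R I k" for r
    using ext_powerI[OF I that S_one] .
  have FL: "F (rf r \<one>) \<in> carrier MS" if "r \<in> ideal_power R I k" for r
    using Fh(1)[OF in_ext[OF that]] .
  obtain A where A: "A \<subseteq> carrier R" "finite A" "ideal_power R I k = Idl A"
    using NR.finetely_gen[OF R.ideal_power_ideal[OF I]] by blast
  have AI: "A \<subseteq> ideal_power R I k" unfolding A(3) by (rule R.genideal_self[OF A(1)])
  \<comment> \<open>A common denominator for finitely many values, to be used for generators of the
    power of \<open>I\<close>.\<close>
  have denom: "\<exists>s\<in>S. \<forall>a\<in>Y. \<exists>m\<in>carrier M. rf s \<one> \<odot>\<^bsub>MS\<^esub> F (rf a \<one>) = fr m \<one>"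
    if "finite Y" "Y \<subseteq> ideal_power R I k" for Y
    using that
  proof (induct Y rule: finite_induct)
    case empty
    then show ?case using S_one by auto
  next
    case (insert y Y)
    then obtain s where s: "s \<in> S" "\<forall>a\<in>Y. \<exists>m\<in>carrier M. rf s \<one> \<odot>\<^bsub>MS\<^esub> F (rf a \<one>) = fr m \<one>" by auto
    have "F (rf y \<one>) \<in> carrier MS" using FL insert(4) by auto
    then obtain x t where x: "x \<in> carrier M" "t \<in> S" "F (rf y \<one>) = fr x t" by (rule frac_cases)
    have "\<exists>m\<in>carrier M. rf (t \<otimes> s) \<one> \<odot>\<^bsub>MS\<^esub> F (rf a \<one>) = fr m \<one>" if a: "a \<in> insert y Y" for a
    proof (cases "a = y")
      case True
      have "rf (t \<otimes> s) \<one> \<odot>\<^bsub>MS\<^esub> F (rf y \<one>) = fr (t \<odot>\<^bsub>M\<^esub> (s \<odot>\<^bsub>M\<^esub> x)) (t \<otimes> \<one>)"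
        using x s S_one S_mult by (simp add: fract_smult smult_assoc1)
      also have "\<dots> = fr (s \<odot>\<^bsub>M\<^esub> x) \<one>" by (rule fract_cancel) (use x s S_one in auto)
      finally show ?thesis using True x s by blast
    next
      case False
      then obtain m where m: "m \<in> carrier M" "rf s \<one> \<odot>\<^bsub>MS\<^esub> F (rf a \<one>) = fr m \<one>" using s a by blast
      have aI: "a \<in> ideal_power R I k" using a insert(4) by auto
      have "rf (t \<otimes> s) \<one> = rf t \<one> \<otimes>\<^bsub>RS\<^esub> rf s \<one>" using x s S_one by (simp add: rf_mult)
      then have "rf (t \<otimes> s) \<one> \<odot>\<^bsub>MS\<^esub> F (rf a \<one>) = rf t \<one> \<odot>\<^bsub>MS\<^esub> fr m \<one>"
        using L.smult_assoc1[of "rf t \<one>" "rf s \<one>" "F (rf a \<one>)"] FL[OF aI] x s S_one rf_in m(2) by simp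
      also have "\<dots> = fr (t \<odot>\<^bsub>M\<^esub> m) \<one>" using x m S_one by (simp add: fract_smult)
      finally show ?thesis using x m by blast
    qed
    then show ?case using S_mult[OF x(2) s(1)] by blast
  qed
  obtain s1 where s1: "s1 \<in> S" "\<forall>a\<in>A. \<exists>m\<in>carrier M. rf s1 \<one> \<odot>\<^bsub>MS\<^esub> F (rf a \<one>) = fr m \<one>"
    using denom[OF A(2) AI] by (elim bexE)
  have rs1: "rf s1 \<one> \<in> carrier RS" using s1 S_one by (intro rf_in) auto
  \<comment> \<open>The arguments whose value gets denominator \<open>\<one>\<close> after
    multiplication by \<open>s1\<close>. They form an ideal that contains the generators, so they
    exhaust the power of \<open>I\<close>.\<close>
  let ?J = "{r \<in> ideal_power R I k. \<exists>m\<in>carrier M. rf s1 \<one> \<odot>\<^bsub>MS\<^esub> F (rf r \<one>) = fr m \<one>}"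
  have add: "rf s1 \<one> \<odot>\<^bsub>MS\<^esub> F (rf (x \<oplus> y) \<one>) = fr (m \<oplus>\<^bsub>M\<^esub> m') \<one>"
    if "x \<in> ideal_power R I k" "y \<in> ideal_power R I k" "m \<in> carrier M" "m' \<in> carrier M"
      "rf s1 \<one> \<odot>\<^bsub>MS\<^esub> F (rf x \<one>) = fr m \<one>" "rf s1 \<one> \<odot>\<^bsub>MS\<^esub> F (rf y \<one>) = fr m' \<one>" for x y m m'
  proof -
    have "rf (x \<oplus> y) \<one> = rf x \<one> \<oplus>\<^bsub>RS\<^esub> rf y \<one>" using car that S_one by (simp add: rf_add_same)
    then show ?thesis
      using Fh(2)[OF in_ext[OF that(1)] in_ext[OF that(2)]] L.smult_r_distr[OF rs1 FL[OF that(1)] FL[OF that(2)]] that S_one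
      by (simp add: fract_add_same)
  qed
  have mul: "rf s1 \<one> \<odot>\<^bsub>MS\<^esub> F (rf (c \<otimes> x) \<one>) = fr (c \<odot>\<^bsub>M\<^esub> m) \<one>"
    if "c \<in> carrier R" "x \<in> ideal_power R I k" "m \<in> carrier M" "rf s1 \<one> \<odot>\<^bsub>MS\<^esub> F (rf x \<one>) = fr m \<one>" for c x m
  proof -
    have c: "rf c \<one> \<in> carrier RS" using that(1) S_one by (rule rf_in)
    have "rf (c \<otimes> x) \<one> = rf c \<one> \<otimes>\<^bsub>RS\<^esub> rf x \<one>" using car that S_one by (simp add: rf_mult)
    then have "rf s1 \<one> \<odot>\<^bsub>MS\<^esub> F (rf (c \<otimes> x) \<one>) = rf c \<one> \<odot>\<^bsub>MS\<^esub> fr m \<one>"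
      using Fh(3)[OF c in_ext[OF that(2)]] L.smult_comm[OF rs1 c FL[OF that(2)]] that(4) by simp
    then show ?thesis using that S_one by (simp add: fract_smult)
  qed
  have "ideal ?J R"
  proof (rule R.idealI')
    show "?J \<subseteq> carrier R" using car by auto
    have "rf \<zero> \<one> = \<zero>\<^bsub>RS\<^esub>" by (simp add: loc_ring_simps)
    moreover have "F \<zero>\<^bsub>RS\<^esub> = \<zero>\<^bsub>MS\<^esub>"
      using Fh(3)[of "\<zero>\<^bsub>RS\<^esub>" "rf \<zero> \<one>"] in_ext[OF pk(2)] FL[OF pk(2)] calculation by simp
    ultimately have "rf s1 \<one> \<odot>\<^bsub>MS\<^esub> F (rf \<zero> \<one>) = fr \<zero>\<^bsub>M\<^esub> \<one>"
      using rs1 by (simp add: loc_module_simps(2)[symmetric])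
    then show "\<zero> \<in> ?J" using pk(2) by blast
    show "x \<oplus> y \<in> ?J" if "x \<in> ?J" "y \<in> ?J" for x y
      using that add[of x y] pk(3)[of x k y] M.a_closed by blast
    show "r \<otimes> x \<in> ?J" if "r \<in> carrier R" "x \<in> ?J" for r x
      using that mul[of r x] pk(4)[of r x k] smult_closed by blast
  qed
  moreover have "A \<subseteq> ?J" using s1 AI by blast
  ultimately have "ideal_power R I k \<subseteq> ?J" unfolding A(3) using R.genideal_minimal[of ?J A] A(3) by simp
  then have "\<forall>r\<in>ideal_power R I k. \<exists>m. m \<in> carrier M \<and> rf s1 \<one> \<odot>\<^bsub>MS\<^esub> F (rf r \<one>) = fr m \<one>" by blast
  then obtain m where m: "\<And>r. r \<in> ideal_power R I k \<Longrightarrow> m r \<in> carrier M"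
    "\<And>r. r \<in> ideal_power R I k \<Longrightarrow> rf s1 \<one> \<odot>\<^bsub>MS\<^esub> F (rf r \<one>) = fr (m r) \<one>" by metis
  \<comment> \<open>The chosen numerators \<open>m r\<close> depend linearly on \<open>r\<close>
    only up to elements killed by something in \<open>S\<close>; multiplication by \<open>w\<close>
    removes this ambiguity.\<close>
  obtain w where w: "w \<in> S" "\<And>x y. x \<in> carrier M \<Longrightarrow> y \<in> carrier M \<Longrightarrow> fr x \<one> = fr y \<one> \<Longrightarrow> w \<odot>\<^bsub>M\<^esub> x = w \<odot>\<^bsub>M\<^esub> y"
    using ex_fract_eq_killer[OF M] by metis
  have wR: "w \<in> carrier R" using w(1) by simp
  show ?thesis
  proof (rule that[of "\<lambda>r. w \<odot>\<^bsub>M\<^esub> m r" "w \<otimes> s1"])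
    show "(\<lambda>r. w \<odot>\<^bsub>M\<^esub> m r) \<in> ideal_hom R I k M"
    proof (rule ideal_homI)
      fix x assume x: "x \<in> ideal_power R I k"
      show "w \<odot>\<^bsub>M\<^esub> m x \<in> carrier M" using m(1)[OF x] wR by simp
      show "w \<odot>\<^bsub>M\<^esub> m (x \<oplus> y) = w \<odot>\<^bsub>M\<^esub> m x \<oplus>\<^bsub>M\<^esub> w \<odot>\<^bsub>M\<^esub> m y" if y: "y \<in> ideal_power R I k" for y
      proof -
        have "fr (m (x \<oplus> y)) \<one> = fr (m x \<oplus>\<^bsub>M\<^esub> m y) \<one>"
          using add[OF x y m(1)[OF x] m(1)[OF y] m(2)[OF x] m(2)[OF y]] m(2)[OF pk(3)[OF x y]] by simp
        then have "w \<odot>\<^bsub>M\<^esub> m (x \<oplus> y) = w \<odot>\<^bsub>M\<^esub> (m x \<oplus>\<^bsub>M\<^esub> m y)"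
          by (rule w(2)[OF m(1)[OF pk(3)[OF x y]] M.a_closed[OF m(1)[OF x] m(1)[OF y]]])
        then show ?thesis using m(1)[OF x] m(1)[OF y] wR by (simp add: smult_r_distr)
      qed
      show "w \<odot>\<^bsub>M\<^esub> m (r \<otimes> x) = r \<odot>\<^bsub>M\<^esub> (w \<odot>\<^bsub>M\<^esub> m x)" if r: "r \<in> carrier R" for r
      proof -
        have "fr (m (r \<otimes> x)) \<one> = fr (r \<odot>\<^bsub>M\<^esub> m x) \<one>"
          using mul[OF r x m(1)[OF x] m(2)[OF x]] m(2)[OF pk(4)[OF r x]] by simp
        then have "w \<odot>\<^bsub>M\<^esub> m (r \<otimes> x) = w \<odot>\<^bsub>M\<^esub> (r \<odot>\<^bsub>M\<^esub> m x)"
          by (rule w(2)[OF m(1)[OF pk(4)[OF r x]] smult_closed[OF r m(1)[OF x]]])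
        then show ?thesis using smult_comm[OF wR r m(1)[OF x]] by simp
      qed
    qed
    show "w \<otimes> s1 \<in> S" by (rule S_mult[OF w(1) s1(1)])
    fix r assume r: "r \<in> ideal_power R I k"
    have "rf (w \<otimes> s1) \<one> = rf w \<one> \<otimes>\<^bsub>RS\<^esub> rf s1 \<one>" using w s1 S_one by (simp add: rf_mult)
    then have "rf (w \<otimes> s1) \<one> \<odot>\<^bsub>MS\<^esub> F (rf r \<one>) = rf w \<one> \<odot>\<^bsub>MS\<^esub> fr (m r) \<one>"
      using L.smult_assoc1[OF rf_in[OF wR S_one] rs1 FL[OF r]] m(2)[OF r] by simp
    then show "fr (w \<odot>\<^bsub>M\<^esub> m r) \<one> = rf (w \<otimes> s1) \<one> \<odot>\<^bsub>MS\<^esub> F (rf r \<one>)"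
      using m(1)[OF r] wR S_one by (simp add: fract_smult)
  qed
qed

text \<open>The map \<open>f\<close> is localized, and the witnesses found over \<open>RS\<close>
  are \<open>s' = s/u\<close> and \<open>m' = m/v\<close>. Clearing denominators, and multiplying by
  one \<open>w\<close> valid for all arguments, gives the multiplier
  \<open>w \<otimes> v \<otimes> s\<close> and the element \<open>(w \<otimes> u) m\<close> over
  \<open>R\<close>. The multiplier is outside \<open>q\<close> because \<open>s\<close> is and
  \<open>q\<close> is disjoint from \<open>S\<close>.\<close>

lemma killed_at_of_loc:
  assumes M: "noeth_module R M" and I: "ideal I R" and J: "ideal J R" and q: "primeideal q R" "q \<inter> S = {}"
    and k: "killed_at RS (ext I) (ext J) MS t (ext q)"
  shows "killed_at R I J M t q"
  unfolding killed_at_def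
proof (intro allI ballI)
  interpret L: rmodule "RS" "MS" by (rule loc_rmodule)
  interpret q: primeideal q R by fact
  fix k f \<beta> assume f: "f \<in> ideal_hom R I k M" and \<beta>: "\<beta> \<in> ideal_power R J t"
  note fh = ideal_homD[OF I f] and car = R.ideal_power_carrier[OF I] and \<beta>R = R.ideal_power_carrier[OF J \<beta>]
  obtain F where F: "F \<in> ideal_hom RS (ext I) k MS"
    "\<And>r s. r \<in> ideal_power R I k \<Longrightarrow> s \<in> S \<Longrightarrow> F (rf r s) = fr (f r) s" using ex_localized_hom[OF I f] by metis
  obtain s' where s': "s' \<in> carrier RS - ext q"
    "inner_germ RS (ext I) MS k (\<lambda>X. (s' \<otimes>\<^bsub>RS\<^esub> rf \<beta> \<one>) \<odot>\<^bsub>MS\<^esub> F X)"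
    using k F(1) ext_powerI[OF J \<beta> S_one] unfolding killed_at_def by blast
  then obtain j m' where j: "j \<ge> k" "m' \<in> carrier MS"
    "\<And>X. X \<in> ideal_power RS (ext I) j \<Longrightarrow>
      (s' \<otimes>\<^bsub>RS\<^esub> rf \<beta> \<one>) \<odot>\<^bsub>MS\<^esub> F X = X \<odot>\<^bsub>MS\<^esub> m'"
    unfolding inner_germ_def by blast
  obtain s u where s: "s \<in> carrier R" "u \<in> S" "s' = rf s u" using s'(1) by (auto elim: ring_cases)
  have sq: "s \<notin> q" using s' s rf_in_ext_iff[OF q s(1,2)] by simp
  obtain m v where m: "m \<in> carrier M" "v \<in> S" "m' = fr m v" using j(2) by (rule frac_cases)
  obtain w where w: "w \<in> S" "\<And>x y. x \<in> carrier M \<Longrightarrow> y \<in> carrier M \<Longrightarrow> fr x \<one> = fr y \<one> \<Longrightarrow> w \<odot>\<^bsub>M\<^esub> x = w \<odot>\<^bsub>M\<^esub> y"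
    using ex_fract_eq_killer[OF M] by metis
  have eq: "((w \<otimes> v \<otimes> s) \<otimes> \<beta>) \<odot>\<^bsub>M\<^esub> f r = r \<odot>\<^bsub>M\<^esub> ((w \<otimes> u) \<odot>\<^bsub>M\<^esub> m)" if r: "r \<in> ideal_power R I j" for r
  proof -
    have rk: "r \<in> ideal_power R I k" and rR: "r \<in> carrier R"
      using r R.ideal_power_antimono[OF I j(1)] car by auto
    have "(rf s u \<otimes>\<^bsub>RS\<^esub> rf \<beta> \<one>) \<odot>\<^bsub>MS\<^esub> F (rf r \<one>) = rf r \<one> \<odot>\<^bsub>MS\<^esub> fr m v"
      using j(3)[OF ext_powerI[OF I r S_one]] s m by simp
    then have e: "fr ((s \<otimes> \<beta>) \<odot>\<^bsub>M\<^esub> f r) u = fr (r \<odot>\<^bsub>M\<^esub> m) v"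
      using F(2)[OF rk S_one] s m rR \<beta>R S_one fh(1)[OF rk] by (simp add: rf_mult fract_smult)
    have "fr ((v \<otimes> s \<otimes> \<beta>) \<odot>\<^bsub>M\<^esub> f r) \<one> = fr ((u \<otimes> r) \<odot>\<^bsub>M\<^esub> m) \<one>"
    proof -
      obtain z where z: "z \<in> S" "(z \<otimes> v) \<odot>\<^bsub>M\<^esub> ((s \<otimes> \<beta>) \<odot>\<^bsub>M\<^esub> f r) = (z \<otimes> u) \<odot>\<^bsub>M\<^esub> (r \<odot>\<^bsub>M\<^esub> m)"
        using e fract_eq_iff[of "(s \<otimes> \<beta>) \<odot>\<^bsub>M\<^esub> f r" "r \<odot>\<^bsub>M\<^esub> m" u v] s m rR \<beta>R fh(1)[OF rk] by auto
      then have "(z \<otimes> \<one>) \<odot>\<^bsub>M\<^esub> ((v \<otimes> s \<otimes> \<beta>) \<odot>\<^bsub>M\<^esub> f r) = (z \<otimes> \<one>) \<odot>\<^bsub>M\<^esub> ((u \<otimes> r) \<odot>\<^bsub>M\<^esub> m)"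
        using s m rR \<beta>R fh(1)[OF rk] by (simp add: smult_assoc1[symmetric] R.m_assoc)
      then show ?thesis using z(1) s m rR \<beta>R fh(1)[OF rk] S_one by (intro fract_eqI[where u = z]) auto
    qed
    then have "w \<odot>\<^bsub>M\<^esub> ((v \<otimes> s \<otimes> \<beta>) \<odot>\<^bsub>M\<^esub> f r) = w \<odot>\<^bsub>M\<^esub> ((u \<otimes> r) \<odot>\<^bsub>M\<^esub> m)"
      using s m rR \<beta>R fh(1)[OF rk] by (intro w(2)) auto
    then show ?thesis using w(1) s m rR \<beta>R fh(1)[OF rk] by (simp add: smult_assoc1[symmetric] R.m_ac)
  qed
  have "(w \<otimes> u) \<odot>\<^bsub>M\<^esub> m \<in> carrier M" using w(1) s(2) m(1) by simp
  then have "inner_germ R I M k (\<lambda>r. ((w \<otimes> v \<otimes> s) \<otimes> \<beta>) \<odot>\<^bsub>M\<^esub> f r)"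
    unfolding inner_germ_def using j(1) eq by blast
  moreover have "w \<otimes> v \<otimes> s \<in> carrier R - q"
  proof -
    have "w \<otimes> v \<notin> q" using S_mult[OF w(1) m(2)] q(2) by auto
    then show ?thesis using q.I_prime[of "w \<otimes> v" s] sq w(1) m(2) s(1) by auto
  qed
  ultimately show "\<exists>s\<in>carrier R - q. inner_germ R I M k (\<lambda>r. (s \<otimes> \<beta>) \<odot>\<^bsub>M\<^esub> f r)" by blast
qed

text \<open>The map \<open>F\<close> is a map \<open>g\<close> over \<open>R\<close> divided by some
  \<open>s0\<close> in \<open>S\<close>, so a multiplier \<open>s\<close> for \<open>g\<close> gives
  the multiplier \<open>s \<otimes> s0\<close> for \<open>F\<close>, still outside the contraction
  of \<open>Q\<close>. The denominator \<open>u\<close> of \<open>\<beta>'\<close> moves into the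
  witness \<open>m/u\<close>.\<close>

lemma killed_at_loc:
  assumes NR: "noetherian_ring R" and M: "noeth_module R M" and I: "ideal I R" and J: "ideal J R"
    and Q: "primeideal Q RS" and k: "killed_at R I J M t (con Q)"
  shows "killed_at RS (ext I) (ext J) MS t Q"
  unfolding killed_at_def
proof (intro allI ballI)
  interpret L: rmodule "RS" "MS" by (rule loc_rmodule)
  interpret Q: primeideal Q "RS" by fact
  interpret q: primeideal "con Q" R by (rule con_prime(1)[OF Q])
  fix k F \<beta>' assume F: "F \<in> ideal_hom RS (ext I) k MS"
    and \<beta>': "\<beta>' \<in> ideal_power RS (ext J) t"
  note Fh = L.ideal_homD[OF ext_ideal[OF I] F] and car = R.ideal_power_carrier[OF I]
  obtain \<beta> u where \<beta>: "\<beta> \<in> ideal_power R J t" "u \<in> S" "\<beta>' = rf \<beta> u" using \<beta>' by (rule ext_powerE[OF J])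
  have \<beta>R: "\<beta> \<in> carrier R" by (rule R.ideal_power_carrier[OF J \<beta>(1)])
  obtain g s0 where g: "g \<in> ideal_hom R I k M" "s0 \<in> S"
    "\<And>r. r \<in> ideal_power R I k \<Longrightarrow> fr (g r) \<one> = rf s0 \<one> \<odot>\<^bsub>MS\<^esub> F (rf r \<one>)"
    using ex_unlocalized_hom[OF NR M I F] by metis
  obtain s where s: "s \<in> carrier R" "s \<notin> con Q" "inner_germ R I M k (\<lambda>r. (s \<otimes> \<beta>) \<odot>\<^bsub>M\<^esub> g r)"
    using k g(1) \<beta>(1) unfolding killed_at_def by blast
  then obtain j m where j: "j \<ge> k" "m \<in> carrier M" "\<And>r. r \<in> ideal_power R I j \<Longrightarrow> (s \<otimes> \<beta>) \<odot>\<^bsub>M\<^esub> g r = r \<odot>\<^bsub>M\<^esub> m"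
    unfolding inner_germ_def by blast
  have "s0 \<notin> con Q" using con_prime(2)[OF Q] g(2) by auto
  then have "s \<otimes> s0 \<notin> con Q" using q.I_prime[of s s0] s g(2) by auto
  then have s': "rf (s \<otimes> s0) \<one> \<in> carrier RS - Q"
    using rf_in_iff_con[OF Q.is_ideal, of "s \<otimes> s0" \<one>] rf_in[of "s \<otimes> s0" \<one>] s(1) g(2) S_one by auto
  have eq: "(rf (s \<otimes> s0) \<one> \<otimes>\<^bsub>RS\<^esub> \<beta>') \<odot>\<^bsub>MS\<^esub> F X = X \<odot>\<^bsub>MS\<^esub> fr m u"
    if X: "X \<in> ideal_power RS (ext I) j" for X
  proof -
    obtain r w where r: "r \<in> ideal_power R I j" "w \<in> S" "X = rf r w" using X by (rule ext_powerE[OF I])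
    have rk: "r \<in> ideal_power R I k" and rR: "r \<in> carrier R"
      using r R.ideal_power_antimono[OF I j(1)] car by auto
    have r1: "rf r \<one> \<in> ideal_power RS (ext I) k" by (rule ext_powerI[OF I rk S_one])
    have gM: "g r \<in> carrier M" using ideal_homD(1)[OF I g(1) rk] .
    have 1: "rf \<one> w \<in> carrier RS" "rf (s \<otimes> \<beta>) u \<in> carrier RS" "rf s0 \<one> \<in> carrier RS"
      using r s \<beta> \<beta>R g(2) S_one by (auto intro!: rf_in)
    have "rf r w = rf \<one> w \<otimes>\<^bsub>RS\<^esub> rf r \<one>" using rR r S_one by (simp add: rf_mult)
    then have FX: "F X = rf \<one> w \<odot>\<^bsub>MS\<^esub> F (rf r \<one>)" using Fh(3)[OF 1(1) r1] r by simp
    have "rf (s \<otimes> s0) \<one> \<otimes>\<^bsub>RS\<^esub> \<beta>' = rf (s \<otimes> \<beta>) u \<otimes>\<^bsub>RS\<^esub> rf s0 \<one>"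
      using s \<beta> \<beta>R g(2) S_one by (simp add: rf_mult R.m_ac)
    then have "(rf (s \<otimes> s0) \<one> \<otimes>\<^bsub>RS\<^esub> \<beta>') \<odot>\<^bsub>MS\<^esub> F X =
      rf (s \<otimes> \<beta>) u \<odot>\<^bsub>MS\<^esub> (rf \<one> w \<odot>\<^bsub>MS\<^esub> (rf s0 \<one> \<odot>\<^bsub>MS\<^esub> F (rf r \<one>)))"
      unfolding FX using 1 Fh(1)[OF r1] L.smult_comm[OF 1(3,1) Fh(1)[OF r1]] by (simp add: L.smult_assoc1)
    also have "\<dots> = rf (s \<otimes> \<beta>) u \<odot>\<^bsub>MS\<^esub> (rf \<one> w \<odot>\<^bsub>MS\<^esub> fr (g r) \<one>)"
      using g(3)[OF rk] by simp
    also have "\<dots> = fr ((s \<otimes> \<beta>) \<odot>\<^bsub>M\<^esub> g r) (u \<otimes> w)"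
      using gM r s \<beta> \<beta>R S_one by (simp add: fract_smult)
    also have "\<dots> = fr (r \<odot>\<^bsub>M\<^esub> m) (w \<otimes> u)" using j(3)[OF r(1)] R.m_comm[of u w] r \<beta> by simp
    also have "\<dots> = X \<odot>\<^bsub>MS\<^esub> fr m u" using r rR j(2) \<beta>(2) by (simp add: fract_smult)
    finally show ?thesis .
  qed
  have "fr m u \<in> carrier MS" using j(2) \<beta>(2) by (rule frac_in)
  then have "inner_germ RS (ext I) MS k
     (\<lambda>X. (rf (s \<otimes> s0) \<one> \<otimes>\<^bsub>RS\<^esub> \<beta>') \<odot>\<^bsub>MS\<^esub> F X)"
    unfolding inner_germ_def using j(1) eq by blast
  then show "\<exists>s'\<in>carrier RS - Q. inner_germ RS (ext I) MS k
     (\<lambda>X. (s' \<otimes>\<^bsub>RS\<^esub> \<beta>') \<odot>\<^bsub>MS\<^esub> F X)" using s' by blast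
qed

section \<open>Chains of primes under localization\<close>

lemma coheight_con:
  assumes "coheight_ge RS n Q"
  shows "coheight_ge R n (con Q)"
proof -
  obtain c where c: "c 0 = Q" "\<And>i. i \<le> n \<Longrightarrow> primeideal (c i) RS" "\<And>i. i < n \<Longrightarrow> c i \<subset> c (Suc i)"
    using assms by (auto simp: coheight_ge_def Spec_def)
  have "con (c i) \<subset> con (c (Suc i))" if "i < n" for i
    using con_mono_strict[OF _ _ c(3)[OF that]] c(2)[of i] c(2)[of "Suc i"] that primeideal.axioms(1) by auto
  then show ?thesis unfolding coheight_ge_def Spec_def using c con_prime(1)
    by (intro exI[of _ "\<lambda>i. con (c i)"]) auto
qed

end

text \<open>The last member \<open>p\<close> of a chain of length \<open>n\<close> starting at \<open>q\<close> is the prime at which the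
  local hypothesis has to be used: the chain survives in \<open>R\<^sub>p\<close>.\<close>

lemma coheight_ext:
  assumes "cring R" "coheight_ge R n q"
  obtains p where "p \<in> Spec R" "q \<subseteq> p" "coheight_ge (ring_at R p) n (mult_set.ext R (carrier R - p) q)"
proof -
  obtain c where c: "c 0 = q" "\<And>i. i \<le> n \<Longrightarrow> primeideal (c i) R" "\<And>i. i < n \<Longrightarrow> c i \<subset> c (Suc i)"
    using assms(2) by (auto simp: coheight_ge_def Spec_def)
  interpret mult_set R "carrier R - c n" by (rule prime_mult_set[OF c(2)[OF order_refl]])
  have sub: "c i \<subseteq> c j" if "i \<le> j" "j \<le> n" for i j
    using that
  proof (induct j rule: dec_induct)
    case (step j)
    then show ?case using c(3)[of j] by auto
  qed simp
  have dis: "c i \<inter> (carrier R - c n) = {}" if "i \<le> n" for i using sub[OF that order_refl] by auto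
  have "ext (c i) \<subset> ext (c (Suc i))" if "i < n" for i
    using that by (intro ext_mono_strict c(2,3) dis) auto
  then have "coheight_ge (ring_at R (c n)) n (ext q)" unfolding coheight_ge_def Spec_def ring_at_def
    using c(1) ext_prime[OF c(2) dis] by (intro exI[of _ "\<lambda>i. ext (c i)"]) auto
  then show ?thesis using that[of "c n"] c(1,2) sub[of 0 n] by (auto simp: Spec_def)
qed

section \<open>The local-global principle in degree 1\<close>

theorem corollary2p13:
  fixes R :: "('r, 'k) ring_scheme" and M :: "('r, 'm) module"
    and \<aa> \<bb> :: "'r set" and n :: nat
  assumes "cring R" and "\<one>\<^bsub>R\<^esub> \<noteq> \<zero>\<^bsub>R\<^esub>" and "noetherian_ring R"
    and "ideal \<aa> R" and "ideal \<bb> R" and "\<bb> \<subseteq> \<aa>"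
    and "fg_module R M"
  shows "(\<forall>p\<in>Spec R. h_dim (ring_at R p) (ideal_at R p \<aa>) (ideal_at R p \<bb>) (module_at R p M) n > 1)
    \<longleftrightarrow> h_dim R \<aa> \<bb> M n > 1"
proof -
  interpret cring R by fact
  note R = assms(1,3) and a = assms(4) and b = assms(5) and ba = assms(6)
  have M: "noeth_module R M" by (rule fg_imp_noeth[OF assms(3,7)])
  have loc: "loc R M (carrier R - p)" if "p \<in> Spec R" for p
    using M that by (intro loc.intro rmodule.intro prime_mult_set) (simp_all add: noeth_module_def Spec_def)
  have local: "h_dim (ring_at R p) (ideal_at R p \<aa>) (ideal_at R p \<bb>) (module_at R p M) n > 1 \<longleftrightarrow>
    (\<exists>t. \<forall>Q\<in>Spec (ring_at R p). coheight_ge (ring_at R p) n Q \<longrightarrow>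
       killed_at (ring_at R p) (mult_set.ext R (carrier R - p) \<aa>) (mult_set.ext R (carrier R - p) \<bb>) (module_at R p M) t Q)"
    if p: "p \<in> Spec R" for p
  proof -
    interpret loc R M "carrier R - p" by (rule loc[OF p])
    have ia: "ideal_at R p I = ext I" if "ideal I R" for I
      unfolding ideal_at_def ring_at_def by (rule Idl_image[OF that])
    have "ext \<bb> \<subseteq> ext \<aa>" using ba by (auto simp: ext_def)
    then show ?thesis unfolding ia[OF a] ia[OF b] unfolding ring_at_def module_at_def
      by (rule h_dim_greater_one_iff[OF noeth_loc_module[OF M] ext_ideal[OF a] ext_ideal[OF b]])
  qed
  have global: "h_dim R \<aa> \<bb> M n > 1 \<longleftrightarrow> (\<exists>t. \<forall>q\<in>Spec R. coheight_ge R n q \<longrightarrow> killed_at R \<aa> \<bb> M t q)"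
    by (rule h_dim_greater_one_iff[OF M a b ba])
  show ?thesis
  proof
    assume L: "\<forall>p\<in>Spec R. h_dim (ring_at R p) (ideal_at R p \<aa>) (ideal_at R p \<bb>) (module_at R p M) n > 1"
    show "h_dim R \<aa> \<bb> M n > 1" unfolding global
    proof (rule uniform_killed_at[OF R M a b])
      fix q assume q: "q \<in> Spec R" "coheight_ge R n q"
      \<comment> \<open>Localizing at \<open>q\<close> itself would not do: the extension of
        \<open>q\<close> is then maximal, and for \<open>n > 0\<close> no chain above it
        remains.\<close>
      obtain p where p: "p \<in> Spec R" "q \<subseteq> p" "coheight_ge (ring_at R p) n (mult_set.ext R (carrier R - p) q)"
        using coheight_ext[OF R(1) q(2)] by blast
      interpret loc R M "carrier R - p" by (rule loc[OF p(1)])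
      have qS: "primeideal q R" "q \<inter> (carrier R - p) = {}" using q(1) p(2) by (auto simp: Spec_def)
      have "ext q \<in> Spec (ring_at R p)" using ext_prime[OF qS] by (simp add: Spec_def ring_at_def)
      then obtain t where "killed_at (ring_at R p) (ext \<aa>) (ext \<bb>) (module_at R p M) t (ext q)"
        using L p local[OF p(1)] by blast
      then show "\<exists>t. killed_at R \<aa> \<bb> M t q"
        using killed_at_of_loc[OF M a b qS] unfolding ring_at_def module_at_def by blast
    qed
  next
    assume "h_dim R \<aa> \<bb> M n > 1"
    \<comment> \<open>The exponent for \<open>R\<close> serves in every localization, since primes
      there are compared with their contractions.\<close>
    then obtain t where t: "\<And>q. q \<in> Spec R \<Longrightarrow> coheight_ge R n q \<Longrightarrow> killed_at R \<aa> \<bb> M t q"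
      unfolding global by blast
    show "\<forall>p\<in>Spec R. h_dim (ring_at R p) (ideal_at R p \<aa>) (ideal_at R p \<bb>) (module_at R p M) n > 1"
    proof
      fix p assume p: "p \<in> Spec R"
      interpret loc R M "carrier R - p" by (rule loc[OF p])
      have "killed_at (ring_at R p) (ext \<aa>) (ext \<bb>) (module_at R p M) t Q"
        if Q: "Q \<in> Spec (ring_at R p)" "coheight_ge (ring_at R p) n Q" for Q
      proof -
        have Q': "primeideal Q (loc_ring R (carrier R - p))" using Q(1) by (simp add: Spec_def ring_at_def)
        have "killed_at R \<aa> \<bb> M t (con Q)"
          using t[of "con Q"] con_prime(1)[OF Q'] coheight_con Q(2) by (simp add: Spec_def ring_at_def)
        then show ?thesis unfolding ring_at_def module_at_def
          by (rule killed_at_loc[OF R(2) M a b Q'])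
      qed
      then show "h_dim (ring_at R p) (ideal_at R p \<aa>) (ideal_at R p \<bb>) (module_at R p M) n > 1"
        unfolding local[OF p] by blast
    qed
  qed
qed

end
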